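(* Let $n\ge 3$, let $\mathcal{A} \subseteq M_n$ be a block upper-triangular algebra and let $\phi : \mathcal{A} \to \mathcal{A}$ be a continuous injective commutativity preserving spectrum shrinking map (not assumed linear). Then one of the following is true: (i) There exists $T \in \mathcal{A}^{\times}$ such that $\phi(X) = TXT^{-1}$ for all $X \in \mathcal{A}$. (ii) $\mathcal{A}^{\odot} = \mathcal{A}$ and there exists $T \in \mathcal{A}^{\times}$ such that $\phi(X) = TX^{\odot}T^{-1}$ for all $X \in \mathcal{A}$.
   Context: $M_n$ is the algebra of $n\times n$ complex matrices and $M_{p,q}$ is the space of $p\times q$ complex matrices. A block upper-triangular (sub)algebra of $M_n$ is a subalgebra of $M_n$ containing all upper-triangular matrices; equivalently, it is one of the algebras $\mathcal{A}_{k_1,\ldots,k_r}$, where $r,k_1,\ldots,k_r\in\mathbb{N}$ (positive integers) satisfy $k_1+\cdots+k_r=n$ and $\mathcal{A}_{k_1,\ldots,k_r}$ consists of all matrices in $M_n$ partitioned into blocks $(X_{ij})_{1\le i,j\le r}$ with $X_{ij}\in M_{k_i,k_j}$ and $X_{ij}=0$ for $i>j$ (the case $r=1$ gives $M_n$ itself). $\mathcal{A}^\times$ is the set of invertible elements of $\mathcal{A}$. For $X\in M_n$, $X^{\odot}:=JX^tJ$, where $X^t$ is the transpose and $J\in M_n$ is the matrix with entries $1$ at positions $(i,n+1-i)$, $1\le i\le n$, and $0$ elsewhere; $\mathcal{A}^{\odot}:=\{X^{\odot}: X\in\mathcal{A}\}$. The map $\phi$ is commutativity preserving if $XY=YX$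 implies $\phi(X)\phi(Y)=\phi(Y)\phi(X)$ for all $X,Y\in\mathcal{A}$; it is spectrum shrinking if $\sigma(\phi(X))\subseteq\sigma(X)$ for all $X\in\mathcal{A}$, where $\sigma$ denotes the set of eigenvalues. *)

theory Defs
  imports
    "HOL-Analysis.Function_Topology"
    "Jordan_Normal_Form.Spectral_Radius"
begin

text \<open>A block upper-triangular algebra is a (complex) subalgebra of the algebra of
  \<open>n \<times> n\<close> matrices that contains every upper-triangular matrix. It contains the identity
  because the identity is upper-triangular.\<close>

definition subalgebra_mat :: "nat \<Rightarrow> complex mat set \<Rightarrow> bool" where
  "subalgebra_mat n \<A> \<longleftrightarrow>
     \<A> \<subseteq> carrier_mat n n \<and> 0\<^sub>m n n \<in> \<A> \<and>
     (\<forall>X\<in>\<A>. \<forall>Y\<in>\<A>. X + Y \<in> \<A>) \<and>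
     (\<forall>c. \<forall>X\<in>\<A>. c \<cdot>\<^sub>m X \<in> \<A>) \<and>
     (\<forall>X\<in>\<A>. \<forall>Y\<in>\<A>. X * Y \<in> \<A>)"

definition block_upper_triangular_algebra :: "nat \<Rightarrow> complex mat set \<Rightarrow> bool" where
  "block_upper_triangular_algebra n \<A> \<longleftrightarrow>
     subalgebra_mat n \<A> \<and> {X \<in> carrier_mat n n. upper_triangular X} \<subseteq> \<A>"

text \<open>Matrix indices start at 0, so position \<open>(i, n + 1 - i)\<close> becomes \<open>i + j + 1 = n\<close>.\<close>

definition exchange_mat :: "nat \<Rightarrow> complex mat" where
  "exchange_mat n = mat n n (\<lambda>(i, j). if i + j + 1 = n then 1 else 0)"

definition odot :: "nat \<Rightarrow> complex mat \<Rightarrow> complex mat" where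
  "odot n X = exchange_mat n * transpose_mat X * exchange_mat n"

text \<open>The type of matrices carries no topology in the library. This is the usual Euclidean
  topology on \<open>n \<times> n\<close> matrices, transported from the product of \<open>n\<^sup>2\<close> copies of the complex
  plane along the entries. The restriction is needed because the entries of a matrix outside its
  dimensions are unspecified.\<close>

definition mat_topology :: "nat \<Rightarrow> complex mat topology" where
  "mat_topology n =
     pullback_topology (carrier_mat n n)
       (\<lambda>X. restrict (\<lambda>p. X $$ p) ({..<n} \<times> {..<n}))
       (product_topology (\<lambda>_. euclidean) ({..<n} \<times> {..<n}))"

lemma topspace_mat_topology [simp]: "topspace (mat_topology n) = carrier_mat n n"
  by (auto simp: mat_topology_def topspace_pullback_topology)

lemma limitin_mat_topology:
  "limitin (mat_topology n) f X F \<longleftrightarrow>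
     X \<in> carrier_mat n n \<and> (\<forall>\<^sub>F x in F. f x \<in> carrier_mat n n) \<and>
     (\<forall>i<n. \<forall>j<n. ((\<lambda>x. f x $$ (i, j)) \<longlongrightarrow> X $$ (i, j)) F)"
  (is "?L \<longleftrightarrow> ?R")
proof -
  let ?I = "{..<n} \<times> {..<n}"
  let ?e = "\<lambda>X :: complex mat. restrict (\<lambda>p. X $$ p) ?I"
  let ?P = "product_topology (\<lambda>_. euclidean :: complex topology) ?I"
  have *: "limitin ?P (\<lambda>x. ?e (f x)) (?e X) F \<longleftrightarrow>
      (\<forall>i<n. \<forall>j<n. ((\<lambda>x. f x $$ (i, j)) \<longlongrightarrow> X $$ (i, j)) F)"
    by (auto simp: limitin_componentwise)
  show ?thesis
  proof
    assume L: ?L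
    have X: "X \<in> carrier_mat n n" using limitin_topspace[OF L] by simp
    have ev: "\<forall>\<^sub>F x in F. f x \<in> carrier_mat n n"
      using L X openin_topspace[of "mat_topology n"] unfolding limitin_def by auto
    have "continuous_map (mat_topology n) ?P ?e"
      unfolding mat_topology_def by (rule continuous_map_pullback[of ?P ?P id, simplified])
    from continuous_map_limit[OF this L] have "limitin ?P (\<lambda>x. ?e (f x)) (?e X) F"
      by (simp add: o_def)
    with X ev show ?R using * by blast
  next
    assume R: ?R
    then have lim: "limitin ?P (\<lambda>x. ?e (f x)) (?e X) F" using * by blast
    show ?L unfolding limitin_def
    proof (intro conjI allI impI)
      show "X \<in> topspace (mat_topology n)" using R by simp
      fix U assume "openin (mat_topology n) U \<and> X \<in> U"
      then obtain V where V: "openin ?P V" "U = ?e -` V \<inter> carrier_mat n n" and "X \<in> U"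
        unfolding mat_topology_def openin_pullback_topology by auto
      then have "\<forall>\<^sub>F x in F. ?e (f x) \<in> V" using lim unfolding limitin_def by auto
      moreover have "\<forall>\<^sub>F x in F. f x \<in> carrier_mat n n" using R by blast
      ultimately show "\<forall>\<^sub>F x in F. f x \<in> U" by eventually_elim (simp add: V)
    qed
  qed
qed

definition continuous_on_mat :: "nat \<Rightarrow> complex mat set \<Rightarrow> (complex mat \<Rightarrow> complex mat) \<Rightarrow> bool" where
  "continuous_on_mat n \<A> \<phi> \<longleftrightarrow>
     continuous_map (subtopology (mat_topology n) \<A>) (mat_topology n) \<phi>"

definition commutativity_preserving :: "complex mat set \<Rightarrow> (complex mat \<Rightarrow> complex mat) \<Rightarrow> bool" where
  "commutativity_preserving \<A> \<phi> \<longleftrightarrow>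
     (\<forall>X\<in>\<A>. \<forall>Y\<in>\<A>. X * Y = Y * X \<longrightarrow> \<phi> X * \<phi> Y = \<phi> Y * \<phi> X)"

definition spectrum_shrinking :: "complex mat set \<Rightarrow> (complex mat \<Rightarrow> complex mat) \<Rightarrow> bool" where
  "spectrum_shrinking \<A> \<phi> \<longleftrightarrow> (\<forall>X\<in>\<A>. spectrum (\<phi> X) \<subseteq> spectrum X)"

text \<open>\<open>T\<close> is an invertible element of \<open>\<A>\<close> and \<open>S\<close> is its (unique) inverse.\<close>

definition inverse_in :: "complex mat set \<Rightarrow> complex mat \<Rightarrow> complex mat \<Rightarrow> bool" where
  "inverse_in \<A> T S \<longleftrightarrow> T \<in> \<A> \<and> S \<in> \<A> \<and> inverts_mat T S \<and> inverts_mat S T"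

end

theory Submission
  imports Defs "HOL-Homology.Invariance_of_Domain"
begin

text \<open>By invariance of domain \<open>\<phi>(\<A>)\<close> is open in \<open>\<A>\<close>, so it contains a matrix with \<open>n\<close> distinct
  eigenvalues; connectedness then upgrades spectrum shrinking to spectrum preservation on all
  matrices with \<open>n\<close> distinct eigenvalues. Hence \<open>\<phi>\<close> is linear on every maximal commuting
  diagonalizable family \<open>T D T\<^sup>-\<^sup>1\<close>, it sends rank-one idempotents to rank-one idempotents, and
  it preserves their orthogonality. Normalize \<open>\<phi>\<close> to fix the diagonal matrices.
  Orthogonality forces \<open>\<phi>(E\<^sub>i\<^sub>i + t E\<^sub>i\<^sub>j) = E\<^sub>i\<^sub>i + g\<^sub>i\<^sub>j(t) E\<^sub>i\<^sub>j\<close> for all \<open>(i, j)\<close>, or the transposed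
  form for all \<open>(i, j)\<close>, with \<open>g\<^sub>i\<^sub>j(a + bc) = g\<^sub>i\<^sub>j(a) - g\<^sub>i\<^sub>k(b) g\<^sub>k\<^sub>j(-c)\<close>. So \<open>g\<^sub>i\<^sub>j(t) = (d\<^sub>i/d\<^sub>j) t\<close>, and a
  diagonal conjugation makes \<open>\<phi>\<close> fix all \<open>E\<^sub>i\<^sub>i + t E\<^sub>i\<^sub>j\<close>. This property is stable under
  conjugation by elementary matrices of \<open>\<A>\<close>; therefore \<open>\<phi>\<close> fixes every rank-one idempotent,
  every matrix with distinct eigenvalues, and by continuity everything.\<close>

hide_const (open) Finite_Cartesian_Product.mat Finite_Cartesian_Product.vec
  Finite_Cartesian_Product.row
unbundle no vec_syntax

section \<open>Matrices with distinct eigenvalues\<close>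

text \<open>Matrices with repeated eigenvalues are the obstacle: eigenvalues cannot be followed
  individually there, and commutation says little. The discriminant, a polynomial in the entries,
  avoids any choice of eigenvalues; a complex line through a matrix with distinct eigenvalues meets
  its zeros in finitely many points, and continuity crosses them. Block sizes never appear: the
  algebra is encoded by the relation of admissible matrix positions. Normalizing \<phi> conjugates
  its values by matrices not yet known to lie in the algebra, and the transposed case may leave the
  algebra altogether, so the intermediate maps take arbitrary n x n values; membership of T in the
  algebra is recovered at the very end from the form of the map. The hypothesis n \<ge> 3 supplies a
  third index, through which different positions (i, j) are compared and the scalar functions are
  shown to be linear.\<close>

definition mtrace :: "complex mat \<Rightarrow> complex" where
  "mtrace M = (\<Sum>i<dim_row M. M $$ (i, i))"

lemma mtrace_comm:
  assumes "A \<in> carrier_mat n m" "B \<in> carrier_mat m n"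
  shows "mtrace (A * B) = mtrace (B * A)"
proof -
  have "mtrace (A * B) = (\<Sum>i<n. \<Sum>k<m. A $$ (i, k) * B $$ (k, i))"
    using assms by (simp add: mtrace_def scalar_prod_def atLeast0LessThan)
  also have "\<dots> = (\<Sum>k<m. \<Sum>i<n. B $$ (k, i) * A $$ (i, k))"
    by (subst sum.swap) (simp add: mult.commute)
  also have "\<dots> = mtrace (B * A)"
    using assms by (simp add: mtrace_def scalar_prod_def atLeast0LessThan)
  finally show ?thesis .
qed

lemma upper_triangular_pow:
  fixes B :: "complex mat"
  assumes B: "B \<in> carrier_mat n n" and ut: "upper_triangular B"
  shows "(\<forall>i<n. \<forall>j<i. (B ^\<^sub>m k) $$ (i, j) = 0) \<and> (\<forall>i<n. (B ^\<^sub>m k) $$ (i, i) = B $$ (i, i) ^ k)"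
proof (induction k)
  case 0
  then show ?case using B by auto
next
  case (Suc k)
  have P: "B ^\<^sub>m k \<in> carrier_mat n n" using B by (rule pow_carrier_mat)
  have ent: "(B ^\<^sub>m Suc k) $$ (i, j) = (\<Sum>l<n. (B ^\<^sub>m k) $$ (i, l) * B $$ (l, j))" if "i < n" "j < n" for i j
    using that B P by (simp add: scalar_prod_def atLeast0LessThan)
  have z: "B $$ (l, j) = 0" if "j < l" "l < n" for l j
    using ut that B by (auto simp: upper_triangular_def)
  have "(B ^\<^sub>m Suc k) $$ (i, j) = 0" if "i < n" "j < i" for i j
  proof -
    have "(B ^\<^sub>m k) $$ (i, l) * B $$ (l, j) = 0" if "l < n" for l
      using Suc z[of j l] that \<open>i < n\<close> \<open>j < i\<close> by (cases "l < i") auto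
    then show ?thesis using that ent by (simp add: sum.neutral del: mult_eq_0_iff)
  qed
  moreover have "(B ^\<^sub>m Suc k) $$ (i, i) = B $$ (i, i) ^ Suc k" if "i < n" for i
  proof -
    have "(\<Sum>l<n. (B ^\<^sub>m k) $$ (i, l) * B $$ (l, i)) = (\<Sum>l\<in>{i}. (B ^\<^sub>m k) $$ (i, l) * B $$ (l, i))"
    proof (rule sum.mono_neutral_right)
      show "\<forall>l\<in>{..<n} - {i}. (B ^\<^sub>m k) $$ (i, l) * B $$ (l, i) = 0"
      proof
        fix l assume "l \<in> {..<n} - {i}"
        then show "(B ^\<^sub>m k) $$ (i, l) * B $$ (l, i) = 0"
          using Suc z[of i l] \<open>i < n\<close> by (cases "l < i") auto
      qed
    qed (use that in auto)
    then show ?thesis using ent[OF that that] Suc that by simp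
  qed
  ultimately show ?case by blast
qed

text \<open>Schur triangularization puts the eigenvalues on the diagonal, where powers act
  entrywise, and similarity does not change the trace. Traces thus give the power sums of the
  eigenvalues with multiplicity.\<close>

lemma mtrace_pow:
  assumes M: "M \<in> carrier_mat n n" and c: "char_poly M = (\<Prod>e\<leftarrow>es. [:- e, 1:])"
  shows "mtrace (M ^\<^sub>m k) = (\<Sum>e\<leftarrow>es. e ^ k)"
proof -
  obtain B P Q where "schur_decomposition M es = (B, P, Q)" by (cases "schur_decomposition M es") auto
  from schur_decomposition[OF M c this]
  have sim: "similar_mat_wit M B P Q" and ut: "upper_triangular B" and d: "diag_mat B = es" by auto
  from similar_mat_witD2[OF M sim] have B: "B \<in> carrier_mat n n" by auto
  have sk: "similar_mat_wit (M ^\<^sub>m k) (B ^\<^sub>m k) P Q" using similar_mat_wit_pow[OF sim] .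
  have Mk: "M ^\<^sub>m k \<in> carrier_mat n n" using M by (rule pow_carrier_mat)
  note w = similar_mat_witD2[OF Mk sk]
  have "mtrace (M ^\<^sub>m k) = mtrace (P * (B ^\<^sub>m k * Q))" using w by (simp add: assoc_mult_mat)
  also have "\<dots> = mtrace (B ^\<^sub>m k * Q * P)" using w mtrace_comm[of P n n "B ^\<^sub>m k * Q"] by simp
  also have "\<dots> = mtrace (B ^\<^sub>m k)" using w by (simp add: assoc_mult_mat[of _ n n _ n _ n] right_mult_one_mat[of _ n n])
  also have "\<dots> = (\<Sum>i<n. B $$ (i, i) ^ k)"
    using upper_triangular_pow[OF B ut, of k] w B by (simp add: mtrace_def)
  also have "\<dots> = (\<Sum>e\<leftarrow>es. e ^ k)"
    using B unfolding d[symmetric] diag_mat_def by (simp add: sum_list_sum_nth atLeast0LessThan)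
  finally show ?thesis .
qed

lemma spectrum_set:
  fixes M :: "complex mat"
  assumes M: "M \<in> carrier_mat n n" and c: "char_poly M = (\<Prod>e\<leftarrow>es. [:- e, 1:])"
  shows "spectrum M = set es"
  using spectrum_root_char_poly[OF M] unfolding c poly_prod_list prod_list_zero_iff
  by auto

lemma spectrum_diag: "spectrum (mat_diag n d :: complex mat) = d ` {..<n}"
proof -
  have ut: "upper_triangular (mat_diag n d :: complex mat)" by (auto simp: mat_diag_def)
  have "diag_mat (mat_diag n d :: complex mat) = map d [0..<n]"
    by (simp add: diag_mat_def mat_diag_def)
  then show ?thesis using spectrum_set[OF mat_diag_dim char_poly_upper_triangular[OF mat_diag_dim ut]]
    by (auto simp: lessThan_atLeast0)
qed

definition vandermonde :: "complex list \<Rightarrow> complex mat" where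
  "vandermonde es = mat (length es) (length es) (\<lambda>(m, i). es ! m ^ i)"

text \<open>A kernel vector is the coefficient list of a nonzero polynomial of degree less than the
  number of nodes that vanishes at all of them; for distinct nodes these are too many roots. Two
  equal nodes give two equal rows.\<close>

lemma det_vandermonde:
  "det (vandermonde es) \<noteq> 0 \<longleftrightarrow> distinct es"
proof -
  let ?n = "length es"
  have V: "vandermonde es \<in> carrier_mat ?n ?n" by (simp add: vandermonde_def)
  show ?thesis
  proof
    assume nz: "det (vandermonde es) \<noteq> 0"
    show "distinct es" unfolding distinct_conv_nth
    proof (intro allI impI notI)
      fix i j assume ij: "i < ?n" "j < ?n" "i \<noteq> j" "es ! i = es ! j"
      then have "row (vandermonde es) i = row (vandermonde es) j"
        by (auto simp: vandermonde_def)
      from det_identical_rows[OF V ij(3,1,2) this] nz show False by simp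
    qed
  next
    assume d: "distinct es"
    show "det (vandermonde es) \<noteq> 0"
    proof
      assume "det (vandermonde es) = 0"
      then obtain v where v: "v \<in> carrier_vec ?n" "v \<noteq> 0\<^sub>v ?n" "vandermonde es *\<^sub>v v = 0\<^sub>v ?n"
        using det_0_iff_vec_prod_zero[OF V] by blast
      define p where "p = (\<Sum>i<?n. Polynomial.monom (v $ i) i)"
      have cp: "Polynomial.coeff p i = (if i < ?n then v $ i else 0)" for i
        unfolding p_def by (simp add: coeff_sum sum.delta)
      have "p \<noteq> 0"
      proof
        assume "p = 0"
        then have "v $ i = 0" if "i < ?n" for i using cp[of i] that by simp
        then show False using v(1,2) by auto
      qed
      have root: "poly p (es ! m) = 0" if "m < ?n" for m
      proof -
        have "poly p (es ! m) = (\<Sum>i<?n. v $ i * es ! m ^ i)"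
          unfolding p_def by (simp add: poly_sum poly_monom)
        also have "\<dots> = (vandermonde es *\<^sub>v v) $ m"
          using that v(1) by (simp add: vandermonde_def scalar_prod_def atLeast0LessThan mult.commute)
        finally show ?thesis using v(3) that by simp
      qed
      have "0 < ?n" using \<open>p \<noteq> 0\<close> by (auto simp: p_def)
      then have "degree p < ?n"
        using cp coeff_eq_0 by (metis \<open>p \<noteq> 0\<close> leading_coeff_0_iff)
      moreover have "?n \<le> card {x. poly p x = 0}"
      proof -
        have "set es \<subseteq> {x. poly p x = 0}" using root by (auto simp: in_set_conv_nth)
        from card_mono[OF poly_roots_finite[OF \<open>p \<noteq> 0\<close>] this] show ?thesis
          by (simp add: distinct_card[OF d])
      qed
      ultimately show False using poly_roots_degree[OF \<open>p \<noteq> 0\<close>] by simp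
    qed
  qed
qed

text \<open>The discriminant of the characteristic polynomial, as the Hankel determinant of the
  power sums of the eigenvalues. This form is visibly polynomial in the entries and involves no
  roots.\<close>

definition discr :: "nat \<Rightarrow> complex mat \<Rightarrow> complex" where
  "discr n M = det (mat n n (\<lambda>(i, j). mtrace (M ^\<^sub>m (i + j))))"

text \<open>The Hankel matrix of power sums is V^t V for the Vandermonde matrix V of the
  eigenvalues.\<close>

lemma discr_eq:
  assumes M: "M \<in> carrier_mat n n" and c: "char_poly M = (\<Prod>e\<leftarrow>es. [:- e, 1:])" and l: "length es = n"
  shows "discr n M = det (vandermonde es) ^ 2"
proof -
  let ?V = "vandermonde es"
  have V: "?V \<in> carrier_mat n n" using l by (simp add: vandermonde_def)
  have "mat n n (\<lambda>(i, j). mtrace (M ^\<^sub>m (i + j))) = transpose_mat ?V * ?V"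
    using V l by (intro eq_matI)
      (auto simp: mtrace_pow[OF M c] scalar_prod_def vandermonde_def sum_list_sum_nth atLeast0LessThan power_add)
  then show ?thesis using V by (simp add: discr_def det_mult[of _ n] det_transpose[OF V] power2_eq_square)
qed

lemma discr_nonzero_iff:
  assumes M: "M \<in> carrier_mat n n"
  shows "discr n M \<noteq> 0 \<longleftrightarrow> card (spectrum M) = n"
proof -
  obtain es where es: "char_poly M = (\<Prod>e\<leftarrow>es. [:- e, 1:])" "length es = n"
    using char_poly_factorized[OF M] by blast
  have "discr n M \<noteq> 0 \<longleftrightarrow> distinct es"
    using det_vandermonde[of es] by (simp add: discr_eq[OF M es])
  also have "\<dots> \<longleftrightarrow> card (spectrum M) = n"
    unfolding spectrum_set[OF M es(1)] using es(2) distinct_card[of es] card_distinct[of es] by auto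
  finally show ?thesis .
qed

text \<open>Full cardinality makes every eigenvalue simple, so the spectrum as a set determines all
  power sums.\<close>

lemma discr_cong:
  assumes M: "M \<in> carrier_mat n n" and N: "N \<in> carrier_mat n n"
    and s: "spectrum M = spectrum N" and c: "card (spectrum M) = n"
  shows "discr n M = discr n N"
proof -
  obtain es where es: "char_poly M = (\<Prod>e\<leftarrow>es. [:- e, 1:])" "length es = n"
    using char_poly_factorized[OF M] by blast
  obtain fs where fs: "char_poly N = (\<Prod>e\<leftarrow>fs. [:- e, 1:])" "length fs = n"
    using char_poly_factorized[OF N] by blast
  have st: "set es = set fs" using s spectrum_set[OF M es(1)] spectrum_set[OF N fs(1)] by simp
  have "distinct es" "distinct fs"
    using c st es(2) fs(2) spectrum_set[OF M es(1)] by (auto intro!: card_distinct)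
  then have "mtrace (M ^\<^sub>m k) = mtrace (N ^\<^sub>m k)" for k
    using st by (simp add: mtrace_pow[OF M es(1)] mtrace_pow[OF N fs(1)] sum_list_distinct_conv_sum_set)
  then show ?thesis by (simp add: discr_def)
qed

section \<open>The discriminant along families of matrices\<close>

text \<open>The discriminant is built from the entries by sums and products, so one closure argument
  serves twice: polynomials in \<open>z\<close> give finitely many zeros on a line, continuous
  functions give continuity of the discriminant of the image.\<close>

locale function_algebra =
  fixes F :: "(complex \<Rightarrow> complex) set"
  assumes const: "\<And>c. (\<lambda>z. c) \<in> F"
    and add: "\<And>f g. f \<in> F \<Longrightarrow> g \<in> F \<Longrightarrow> (\<lambda>z. f z + g z) \<in> F"
    and mult: "\<And>f g. f \<in> F \<Longrightarrow> g \<in> F \<Longrightarrow> (\<lambda>z. f z * g z) \<in> F"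
begin

lemma sum: "(\<And>i. i \<in> I \<Longrightarrow> f i \<in> F) \<Longrightarrow> (\<lambda>z. \<Sum>i\<in>I. f i z) \<in> F"
proof (induction I rule: infinite_finite_induct)
  case (insert x I)
  then show ?case using add[of "f x" "\<lambda>z. \<Sum>i\<in>I. f i z"] by simp
qed (simp_all add: const)

lemma prod: "(\<And>i. i \<in> I \<Longrightarrow> f i \<in> F) \<Longrightarrow> (\<lambda>z. \<Prod>i\<in>I. f i z) \<in> F"
proof (induction I rule: infinite_finite_induct)
  case (insert x I)
  then show ?case using mult[of "f x" "\<lambda>z. \<Prod>i\<in>I. f i z"] by simp
qed (simp_all add: const)

lemma det:
  assumes "\<And>z. M z \<in> carrier_mat n n" "\<And>i j. i < n \<Longrightarrow> j < n \<Longrightarrow> (\<lambda>z. M z $$ (i, j)) \<in> F"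
  shows "(\<lambda>z. det (M z)) \<in> F"
proof -
  have "(\<lambda>z. \<Sum>p\<in>{p. p permutes {0..<n}}. signof p * (\<Prod>i = 0..<n. M z $$ (i, p i))) \<in> F"
    by (intro sum mult const prod assms) (auto simp: permutes_in_image)
  then show ?thesis by (simp add: det_def'[OF assms(1)])
qed

lemma pow_mat:
  assumes M: "\<And>z. M z \<in> carrier_mat n n" "\<And>i j. i < n \<Longrightarrow> j < n \<Longrightarrow> (\<lambda>z. M z $$ (i, j)) \<in> F"
    and "i < n" "j < n"
  shows "(\<lambda>z. (M z ^\<^sub>m k) $$ (i, j)) \<in> F"
  using assms(3,4)
proof (induction k arbitrary: i j)
  case 0
  then show ?case using M(1) const by (simp add: carrier_matD[OF M(1)])
next
  case (Suc k)
  have P: "M z ^\<^sub>m k \<in> carrier_mat n n" for z using M(1) by (rule pow_carrier_mat)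
  have "(\<lambda>z. \<Sum>l<n. (M z ^\<^sub>m k) $$ (i, l) * M z $$ (l, j)) \<in> F"
    by (intro sum mult Suc M) (use Suc in auto)
  then show ?case
    using Suc(2,3) by (simp add: carrier_matD[OF M(1)] carrier_matD[OF P] scalar_prod_def atLeast0LessThan)
qed

lemma discr:
  assumes M: "\<And>z. M z \<in> carrier_mat n n" "\<And>i j. i < n \<Longrightarrow> j < n \<Longrightarrow> (\<lambda>z. M z $$ (i, j)) \<in> F"
  shows "(\<lambda>z. discr n (M z)) \<in> F"
  unfolding discr_def
proof (rule det[of _ n])
  have P: "M z ^\<^sub>m k \<in> carrier_mat n n" for z k using M(1) by (rule pow_carrier_mat)
  fix i j assume "i < n" "j < n"
  have "(\<lambda>z. \<Sum>l<n. (M z ^\<^sub>m (i + j)) $$ (l, l)) \<in> F"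
    by (intro sum pow_mat[OF M]) auto
  then show "(\<lambda>z. mat n n (\<lambda>(i, j). mtrace (M z ^\<^sub>m (i + j))) $$ (i, j)) \<in> F"
    using \<open>i < n\<close> \<open>j < n\<close> by (simp add: mtrace_def carrier_matD[OF P] carrier_matD[OF M(1)])
qed simp

end

lemma function_algebra_continuous: "function_algebra {f. continuous_on S f}"
  by unfold_locales (auto intro: continuous_intros)

lemma function_algebra_poly: "function_algebra {f. \<exists>p. \<forall>z. f z = poly p z}"
proof (unfold_locales, goal_cases)
  case (1 c)
  then show ?case by (auto intro!: exI[of _ "[:c:]"])
next
  case (2 f g)
  then show ?case by (force intro: poly_add[symmetric])
next
  case (3 f g)
  then show ?case by (force intro: poly_mult[symmetric])
qed

text \<open>All deformations are along complex affine lines, where the exceptional set is finite and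
  hence does not disconnect the parameter plane.\<close>

lemma finite_discr_zero:
  fixes X Y :: "complex mat"
  assumes X: "X \<in> carrier_mat n n" and Y: "Y \<in> carrier_mat n n"
    and c: "card (spectrum (X + z0 \<cdot>\<^sub>m Y)) = n"
  shows "finite {z. card (spectrum (X + z \<cdot>\<^sub>m Y)) \<noteq> n}"
proof -
  interpret function_algebra "{f. \<exists>p. \<forall>z. f z = poly p z}" by (rule function_algebra_poly)
  have XY: "X + z \<cdot>\<^sub>m Y \<in> carrier_mat n n" for z using X Y by simp
  have "(\<lambda>z. discr n (X + z \<cdot>\<^sub>m Y)) \<in> {f. \<exists>p. \<forall>z. f z = poly p z}"
  proof (rule discr[OF XY])
    fix i j assume "i < n" "j < n"
    then show "(\<lambda>z. (X + z \<cdot>\<^sub>m Y) $$ (i, j)) \<in> {f. \<exists>p. \<forall>z. f z = poly p z}"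
      using X Y by (auto intro!: exI[of _ "[:X $$ (i, j), Y $$ (i, j):]"])
  qed
  then obtain p where p: "discr n (X + z \<cdot>\<^sub>m Y) = poly p z" for z by auto
  have "p \<noteq> 0" using c discr_nonzero_iff[OF XY, of z0] p[of z0] by auto
  then show ?thesis
    using poly_roots_finite[of p] by (simp add: discr_nonzero_iff[OF XY, symmetric] p)
qed

section \<open>Diagonalization and selection of branches\<close>

text \<open>The order \<open>d\<close> of the eigenvalues is prescribed: column i of
  \<open>T\<close> is an eigenvector for \<open>d i\<close>, and injectivity of \<open>d\<close>
  makes the columns independent.\<close>

lemma ex_diagonalization:
  fixes M :: "complex mat"
  assumes M: "M \<in> carrier_mat n n" and d: "inj_on d {..<n}" and s: "d ` {..<n} \<subseteq> spectrum M"
  shows "\<exists>T S. T \<in> carrier_mat n n \<and> S \<in> carrier_mat n n \<and> T * S = 1\<^sub>m n \<and> S * T = 1\<^sub>m n \<and>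
           M = T * mat_diag n d * S"
proof -
  have "\<forall>i\<in>{..<n}. \<exists>v. eigenvector M v (d i)"
    using s by (auto simp: spectrum_def eigenvalue_def)
  then obtain v where v: "\<And>i. i < n \<Longrightarrow> eigenvector M (v i) (d i)" by (metis lessThan_iff)
  have vc: "v i \<in> carrier_vec n" "v i \<noteq> 0\<^sub>v n" "M *\<^sub>v v i = d i \<cdot>\<^sub>v v i" if "i < n" for i
    using v[OF that] M by (auto simp: eigenvector_def)
  define T where "T = mat n n (\<lambda>(a, i). v i $ a)"
  have T: "T \<in> carrier_mat n n" by (simp add: T_def)
  have MT: "M * T = T * mat_diag n d"
  proof (rule eq_matI)
    fix a i assume "a < dim_row (T * mat_diag n d)" "i < dim_col (T * mat_diag n d)"
    then have ai: "a < n" "i < n" by (auto simp: T_def mat_diag_def)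
    have "(M * T) $$ (a, i) = (M *\<^sub>v v i) $ a"
      using ai M vc(1)[OF ai(2)] by (simp add: T_def scalar_prod_def)
    also have "\<dots> = d i * v i $ a" using vc[OF ai(2)] ai by simp
    also have "\<dots> = (T * mat_diag n d) $$ (a, i)"
      using ai by (subst mat_diag_mult_right[OF T]) (simp add: T_def)
    finally show "(M * T) $$ (a, i) = (T * mat_diag n d) $$ (a, i)" .
  qed (use M in \<open>auto simp: T_def mat_diag_def\<close>)
  define es where "es = map d [0..<n]"
  have len: "length es = n" by (simp add: es_def)
  have "distinct es" using d by (auto simp: es_def distinct_map lessThan_atLeast0)
  then have dv: "det (vandermonde es) \<noteq> 0" by (simp add: det_vandermonde)
  have "det T \<noteq> 0"
  proof
    assume "det T = 0"
    then obtain c where c: "c \<in> carrier_vec n" "c \<noteq> 0\<^sub>v n" "T *\<^sub>v c = 0\<^sub>v n"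
      using det_0_iff_vec_prod_zero[OF T] by blast
    \<comment> \<open>Applying the powers of \<open>M\<close> to the relation \<open>T c = 0\<close>
      multiplies its i-th term by \<open>d i ^ k\<close>; invertibility of the Vandermonde matrix
      then makes each term vanish separately.\<close>
    have pw: "M ^\<^sub>m k * T = T * mat_diag n (\<lambda>i. d i ^ k)" for k
    proof (induction k)
      case 0
      then show ?case using M T by simp
    next
      case (Suc k)
      have "M ^\<^sub>m Suc k * T = M ^\<^sub>m k * (M * T)" using M T by (simp add: assoc_mult_mat[of _ n n _ n _ n])
      also have "\<dots> = M ^\<^sub>m k * T * mat_diag n d"
        using M T by (simp add: MT assoc_mult_mat[of _ n n _ n _ n, symmetric] mat_diag_dim)
      also have "\<dots> = T * mat_diag n (\<lambda>i. d i ^ Suc k)"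
        unfolding Suc using T by (simp add: assoc_mult_mat[of _ n n _ n _ n] mult.commute mat_diag_dim)
      finally show ?case .
    qed
    have zero: "(\<Sum>i<n. T $$ (a, i) * c $ i * d i ^ k) = 0" if a: "a < n" for a k
    proof -
      have "(T * mat_diag n (\<lambda>i. d i ^ k)) *\<^sub>v c = M ^\<^sub>m k *\<^sub>v (T *\<^sub>v c)"
        using M T c(1) by (subst pw[symmetric]) (simp add: assoc_mult_mat_vec[of _ n n _ n])
      also have "\<dots> = 0\<^sub>v n" unfolding c(3) using M
        by (intro eq_vecI) (auto simp: scalar_prod_def)
      finally have "((T * mat_diag n (\<lambda>i. d i ^ k)) *\<^sub>v c) $ a = 0" using a by simp
      then show ?thesis using a T c(1)
        by (simp add: mat_diag_mult_right[OF T] scalar_prod_def atLeast0LessThan mult_ac)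
    qed
    have Tc: "T $$ (a, i) * c $ i = 0" if a: "a < n" and i: "i < n" for a i
    proof -
      define w where "w = vec n (\<lambda>i. T $$ (a, i) * c $ i)"
      have tr: "transpose_mat (vandermonde es) \<in> carrier_mat n n" by (simp add: vandermonde_def len)
      have w0: "transpose_mat (vandermonde es) *\<^sub>v w = 0\<^sub>v n"
        using zero[OF a] by (intro eq_vecI)
          (auto simp: w_def vandermonde_def es_def scalar_prod_def atLeast0LessThan mult_ac)
      have dt: "det (transpose_mat (vandermonde es)) \<noteq> 0"
        using dv by (subst det_transpose[of _ n]) (simp_all add: vandermonde_def len)
      have "w = 0\<^sub>v n"
      proof (rule ccontr)
        assume "w \<noteq> 0\<^sub>v n"
        then have "det (transpose_mat (vandermonde es)) = 0"
          unfolding det_0_iff_vec_prod_zero[OF tr] using w0 by (intro exI[of _ w]) (simp add: w_def)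
        with dt show False by simp
      qed
      then have "w $ i = 0" using i by simp
      then show ?thesis using i by (simp add: w_def)
    qed
    have "c $ i = 0" if "i < n" for i
    proof (rule ccontr)
      assume "c $ i \<noteq> 0"
      then have "v i $ a = 0" if "a < n" for a
        using Tc[OF that \<open>i < n\<close>] that \<open>i < n\<close> by (simp add: T_def)
      then have "v i = 0\<^sub>v n" using vc(1)[OF that] by (intro eq_vecI) auto
      with vc(2)[OF that] show False by simp
    qed
    then show False using c(1,2) by auto
  qed
  then obtain S where S: "S \<in> carrier_mat n n" "S * T = 1\<^sub>m n"  "T * S = 1\<^sub>m n"
    using det_non_zero_imp_unit[OF T, of "()"] unfolding Units_def ring_mat_def by auto
  have "M = M * (T * S)" using S M by simp
  also have "\<dots> = T * mat_diag n d * S" using M T S by (simp add: MT[symmetric] assoc_mult_mat[of _ n n _ n _ n])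
  finally show ?thesis using T S by blast
qed

lemma connected_minus_finite: "finite (F :: complex set) \<Longrightarrow> connected (- F)"
  using path_connected_complement_countable[of F]
  by (simp add: countable_finite path_connected_imp_connected)

text \<open>Off \<open>F\<close> the closed sets on which \<open>f\<close> agrees with the various
  \<open>g j\<close> are disjoint and cover a connected set, so \<open>f\<close> cannot change
  branch; density of the complement carries the equality over to \<open>F\<close>. With
  \<open>n = 1\<close> only the density is at work.\<close>

lemma continuous_selection:
  fixes f :: "complex \<Rightarrow> complex" and g :: "nat \<Rightarrow> complex \<Rightarrow> complex"
  assumes F: "finite F" and z0: "z0 \<notin> F" and f: "continuous_on UNIV f"
    and g: "\<And>j. j < n \<Longrightarrow> continuous_on UNIV (g j)"
    and sel: "\<And>z. z \<notin> F \<Longrightarrow> \<exists>j<n. f z = g j z"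
    and dist: "\<And>z i j. z \<notin> F \<Longrightarrow> i < n \<Longrightarrow> j < n \<Longrightarrow> g i z = g j z \<Longrightarrow> i = j"
    and i: "i < n" "f z0 = g i z0"
  shows "f z = g i z"
proof -
  have cl: "closed {z. f z = g j z}" if "j < n" for j
    using closed_Collect_eq[OF f g[OF that]] .
  let ?A = "{z. f z = g i z}" and ?B = "\<Union>j\<in>{..<n} - {i}. {z. f z = g j z}"
  have "- F \<subseteq> ?A"
  proof (rule ccontr)
    assume "\<not> - F \<subseteq> ?A"
    then have 1: "?B \<inter> - F \<noteq> {}" using sel by fastforce
    have 2: "?A \<inter> - F \<noteq> {}" using z0 i by auto
    have 3: "- F \<subseteq> ?A \<union> ?B" using sel by fastforce
    have 4: "?A \<inter> ?B \<inter> - F = {}" using dist i(1) by fastforce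
    have "closed ?A" "closed ?B" using cl i(1) by auto
    then have "\<not> connected (- F)"
      unfolding connected_closed not_not using 1 2 3 4 by (intro exI[of _ ?A] exI[of _ ?B] conjI)
    then show False using connected_minus_finite[OF F] by simp
  qed
  then have "closure (- F) \<subseteq> ?A" using cl[OF i(1)] closure_minimal by blast
  moreover have "closure (- F) = UNIV"
    using F finite_imp_not_open[of "interior F"] finite_subset[OF interior_subset, of F]
    by (auto simp: closure_complement)
  ultimately show ?thesis by auto
qed

section \<open>Pattern algebras and preservation of the spectrum\<close>

text \<open>Prescribing the positions of possibly nonzero entries describes all block
  upper-triangular algebras at once: \<open>R\<close> is then a total preorder whose equivalence
  classes are the blocks.\<close>

definition pattern_algebra :: "nat \<Rightarrow> (nat \<Rightarrow> nat \<Rightarrow> bool) \<Rightarrow> complex mat set" where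
  "pattern_algebra n R = {X \<in> carrier_mat n n. \<forall>i<n. \<forall>j<n. X $$ (i, j) \<noteq> 0 \<longrightarrow> R i j}"

definition total_preorder :: "nat \<Rightarrow> (nat \<Rightarrow> nat \<Rightarrow> bool) \<Rightarrow> bool" where
  "total_preorder n R \<longleftrightarrow> (\<forall>i<n. \<forall>j<n. R i j \<or> R j i) \<and>
     (\<forall>i<n. \<forall>j<n. \<forall>k<n. R i j \<longrightarrow> R j k \<longrightarrow> R i k)"

lemma total_preorder_refl: "total_preorder n R \<Longrightarrow> i < n \<Longrightarrow> R i i"
  unfolding total_preorder_def by blast

lemma total_preorder_total: "total_preorder n R \<Longrightarrow> i < n \<Longrightarrow> j < n \<Longrightarrow> R i j \<or> R j i"
  unfolding total_preorder_def by blast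

lemma total_preorder_trans:
  "total_preorder n R \<Longrightarrow> R i j \<Longrightarrow> R j k \<Longrightarrow> i < n \<Longrightarrow> j < n \<Longrightarrow> k < n \<Longrightarrow> R i k"
  unfolding total_preorder_def by blast

lemma pattern_carrier: "X \<in> pattern_algebra n R \<Longrightarrow> X \<in> carrier_mat n n"
  by (simp add: pattern_algebra_def)

lemma pattern_add: "X \<in> pattern_algebra n R \<Longrightarrow> Y \<in> pattern_algebra n R \<Longrightarrow> X + Y \<in> pattern_algebra n R"
  by (auto simp: pattern_algebra_def) fastforce

lemma pattern_smult: "X \<in> pattern_algebra n R \<Longrightarrow> c \<cdot>\<^sub>m X \<in> pattern_algebra n R"
  by (auto simp: pattern_algebra_def)

lemma pattern_line: "X \<in> pattern_algebra n R \<Longrightarrow> Y \<in> pattern_algebra n R \<Longrightarrow> X + z \<cdot>\<^sub>m Y \<in> pattern_algebra n R"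
  by (intro pattern_add pattern_smult)

lemma pattern_mult:
  assumes R: "total_preorder n R" and X: "X \<in> pattern_algebra n R" and Y: "Y \<in> pattern_algebra n R"
  shows "X * Y \<in> pattern_algebra n R"
proof -
  have "R i j" if ij: "i < n" "j < n" and nz: "(X * Y) $$ (i, j) \<noteq> 0" for i j
  proof -
    have "(X * Y) $$ (i, j) = (\<Sum>k<n. X $$ (i, k) * Y $$ (k, j))"
      using ij pattern_carrier[OF X] pattern_carrier[OF Y] by (simp add: scalar_prod_def atLeast0LessThan)
    with nz obtain k where "k < n" "X $$ (i, k) * Y $$ (k, j) \<noteq> 0"
      by (metis (no_types, lifting) lessThan_iff sum.neutral)
    then have "R i k" "R k j" using X Y ij by (auto simp: pattern_algebra_def)
    with total_preorder_trans[OF R this] ij \<open>k < n\<close> show ?thesis by blast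
  qed
  then show ?thesis using X Y by (auto simp: pattern_algebra_def)
qed

lemma pattern_diag: "total_preorder n R \<Longrightarrow> mat_diag n d \<in> pattern_algebra n R"
  by (auto simp: pattern_algebra_def mat_diag_def total_preorder_refl)

lemma pattern_sandwich:
  "total_preorder n R \<Longrightarrow> S \<in> pattern_algebra n R \<Longrightarrow> X \<in> pattern_algebra n R \<Longrightarrow> T \<in> pattern_algebra n R \<Longrightarrow>
     S * X * T \<in> pattern_algebra n R"
  by (intro pattern_mult)

text \<open>\<open>R i j\<close> says that the matrix unit \<open>E i j\<close> lies in the algebra.
  Upper-triangular units give totality, products of units give transitivity, and
  \<open>E i i * X * E j j\<close> isolates an entry of \<open>X\<close>, so a nonzero entry at (i,
  j) puts \<open>E i j\<close> into the algebra.\<close>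

lemma block_upper_triangular_pattern:
  assumes A: "block_upper_triangular_algebra n \<A>"
  shows "\<exists>R. total_preorder n R \<and> (\<forall>i<n. \<forall>j<n. i \<le> j \<longrightarrow> R i j) \<and> \<A> = pattern_algebra n R"
proof -
  define E :: "nat \<Rightarrow> nat \<Rightarrow> complex mat" where
    "E i j = mat n n (\<lambda>(a, b). if a = i \<and> b = j then 1 else 0)" for i j
  define R where "R i j \<longleftrightarrow> E i j \<in> \<A>" for i j
  have carr: "\<A> \<subseteq> carrier_mat n n" and zero: "0\<^sub>m n n \<in> \<A>"
    and add: "\<And>X Y. X \<in> \<A> \<Longrightarrow> Y \<in> \<A> \<Longrightarrow> X + Y \<in> \<A>"
    and smult: "\<And>c X. X \<in> \<A> \<Longrightarrow> c \<cdot>\<^sub>m X \<in> \<A>"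
    and mult: "\<And>X Y. X \<in> \<A> \<Longrightarrow> Y \<in> \<A> \<Longrightarrow> X * Y \<in> \<A>"
    and ut: "\<And>X. X \<in> carrier_mat n n \<Longrightarrow> upper_triangular X \<Longrightarrow> X \<in> \<A>"
    using A unfolding block_upper_triangular_algebra_def subalgebra_mat_def by blast+
  have le: "R i j" if "i < n" "j < n" "i \<le> j" for i j
    unfolding R_def using that by (intro ut) (auto simp: E_def upper_triangular_def)
  have EE: "E i j * E j k = E i k" if "i < n" "j < n" "k < n" for i j k
  proof (rule eq_matI)
    fix a b assume "a < dim_row (E i k)" "b < dim_col (E i k)"
    then have ab: "a < n" "b < n" by (auto simp: E_def)
    then have "(E i j * E j k) $$ (a, b) =
      (\<Sum>l<n. (if a = i \<and> l = j then 1 else 0) * (if l = j \<and> b = k then 1 else 0))"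
      by (simp add: E_def scalar_prod_def atLeast0LessThan)
    also have "\<dots> = (\<Sum>l<n. if l = j then (if a = i \<and> b = k then 1 else 0) else 0)"
      by (rule sum.cong) auto
    also have "\<dots> = E i k $$ (a, b)" using that ab by (simp add: E_def)
    finally show "(E i j * E j k) $$ (a, b) = E i k $$ (a, b)" .
  qed (auto simp: E_def)
  have R: "total_preorder n R"
    unfolding total_preorder_def
  proof (intro conjI allI impI)
    fix i j assume "i < n" "j < n" then show "R i j \<or> R j i" using le[of i j] le[of j i] by linarith
  next
    fix i j k assume "i < n" "j < n" "k < n" "R i j" "R j k"
    then show "R i k" using mult EE unfolding R_def by metis
  qed
  have "\<A> \<subseteq> pattern_algebra n R"
  proof
    fix X assume X: "X \<in> \<A>"
    then have Xc: "X \<in> carrier_mat n n" using carr by auto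
    have "R i j" if ij: "i < n" "j < n" and nz: "X $$ (i, j) \<noteq> 0" for i j
    proof -
      have EX: "(E i i * X) $$ (a, b) = (if a = i then X $$ (i, b) else 0)" if "a < n" "b < n" for a b
      proof -
        have "(E i i * X) $$ (a, b) = (\<Sum>l<n. (if a = i \<and> l = i then 1 else 0) * X $$ (l, b))"
          using that Xc by (simp add: E_def scalar_prod_def atLeast0LessThan)
        also have "\<dots> = (\<Sum>l<n. if l = i then (if a = i then X $$ (i, b) else 0) else 0)"
          by (rule sum.cong) auto
        finally show ?thesis using ij by simp
      qed
      have EXE: "(E i i * X * E j j) $$ (a, b) = (if a = i \<and> b = j then X $$ (i, j) else 0)"
        if "a < n" "b < n" for a b
      proof -
        have "(E i i * X * E j j) $$ (a, b) = (\<Sum>l<n. (E i i * X) $$ (a, l) * (if l = j \<and> b = j then 1 else 0))"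
          using that Xc by (simp add: E_def scalar_prod_def atLeast0LessThan)
        also have "\<dots> = (\<Sum>l<n. if l = j then (if a = i \<and> b = j then X $$ (i, j) else 0) else 0)"
          by (rule sum.cong) (use that EX in auto)
        finally show ?thesis using ij by simp
      qed
      have "E i j = inverse (X $$ (i, j)) \<cdot>\<^sub>m (E i i * X * E j j)"
        using nz Xc EXE by (intro eq_matI) (auto simp: E_def)
      also have "\<dots> \<in> \<A>" using le[of i i] le[of j j] ij X by (intro smult mult) (auto simp: R_def)
      finally show ?thesis by (simp add: R_def)
    qed
    then show "X \<in> pattern_algebra n R" using Xc by (auto simp: pattern_algebra_def)
  qed
  moreover have "pattern_algebra n R \<subseteq> \<A>"
  proof
    fix X assume X: "X \<in> pattern_algebra n R"
    have part: "mat n n (\<lambda>p. if p \<in> S then X $$ p else 0) \<in> \<A>" if "finite S" for S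
      using that
    proof (induction S rule: finite_induct)
      case empty
      have "mat n n (\<lambda>p. if p \<in> {} then X $$ p else 0) = 0\<^sub>m n n" by (intro eq_matI) auto
      then show ?case using zero by simp
    next
      case (insert p S)
      obtain i j where p: "p = (i, j)" by (cases p)
      show ?case
      proof (cases "i < n \<and> j < n \<and> X $$ (i, j) \<noteq> 0")
        case True
        then have "E i j \<in> \<A>" using X by (auto simp: pattern_algebra_def R_def)
        moreover have "mat n n (\<lambda>q. if q \<in> insert p S then X $$ q else 0) =
            mat n n (\<lambda>q. if q \<in> S then X $$ q else 0) + X $$ (i, j) \<cdot>\<^sub>m E i j"
          using insert(2) p by (intro eq_matI) (auto simp: E_def)
        ultimately show ?thesis using insert.IH add smult by simp
      next
        case False
        then have "mat n n (\<lambda>q. if q \<in> insert p S then X $$ q else 0) =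
            mat n n (\<lambda>q. if q \<in> S then X $$ q else 0)"
          using p by (intro eq_matI) auto
        then show ?thesis using insert.IH by simp
      qed
    qed
    have "X = mat n n (\<lambda>p. if p \<in> {..<n} \<times> {..<n} then X $$ p else 0)"
      using X by (intro eq_matI) (auto simp: pattern_algebra_def)
    then show "X \<in> \<A>" using part[of "{..<n} \<times> {..<n}"] by simp
  qed
  ultimately show ?thesis using R le by blast
qed

section \<open>Continuity, invariance of domain and the spectrum\<close>

text \<open>Translates continuity for the matrix topology into continuity of entries along
  parametrized families, the form in which it is used from here on.\<close>

lemma continuous_on_mat_entries:
  fixes \<gamma> :: "'a::topological_space \<Rightarrow> complex mat"
  assumes \<phi>: "continuous_on_mat n \<A> \<phi>" and A: "\<A> \<subseteq> carrier_mat n n"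
    and \<gamma>: "\<And>z. z \<in> S \<Longrightarrow> \<gamma> z \<in> \<A>"
    and c: "\<And>i j. i < n \<Longrightarrow> j < n \<Longrightarrow> continuous_on S (\<lambda>z. \<gamma> z $$ (i, j))"
    and ij: "i < n" "j < n"
  shows "continuous_on S (\<lambda>z. \<phi> (\<gamma> z) $$ (i, j))"
  unfolding continuous_on_def
proof
  fix z assume z: "z \<in> S"
  let ?F = "at z within S"
  have ev: "\<forall>\<^sub>F w in ?F. \<gamma> w \<in> \<A>" using \<gamma> by (auto simp: eventually_at_filter)
  have "limitin (mat_topology n) \<gamma> (\<gamma> z) ?F"
    unfolding limitin_mat_topology using \<gamma>[OF z] A c z eventually_mono[OF ev, of "\<lambda>w. \<gamma> w \<in> carrier_mat n n"]
    by (auto simp: continuous_on_def)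
  then have "limitin (subtopology (mat_topology n) \<A>) \<gamma> (\<gamma> z) ?F"
    unfolding limitin_subtopology using \<gamma>[OF z] ev by blast
  from continuous_map_limit[OF \<phi>[unfolded continuous_on_mat_def] this]
  show "((\<lambda>z. \<phi> (\<gamma> z) $$ (i, j)) \<longlongrightarrow> \<phi> (\<gamma> z) $$ (i, j)) ?F"
    unfolding limitin_mat_topology using ij by auto
qed

text \<open>In real coordinates \<phi> is a continuous injection of a Euclidean space into itself,
  so its range is open. A line from a point of the range to a diagonal matrix with distinct entries
  has finitely many exceptional points, hence a good point inside the range.\<close>

lemma ex_distinct_spectrum_image:
  assumes R: "total_preorder n R"
    and \<phi>: "\<phi> ` pattern_algebra n R \<subseteq> pattern_algebra n R"
    and cont: "continuous_on_mat n (pattern_algebra n R) \<phi>"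
    and inj: "inj_on \<phi> (pattern_algebra n R)"
  shows "\<exists>X\<in>pattern_algebra n R. card (spectrum (\<phi> X)) = n"
proof -
  let ?A = "pattern_algebra n R"
  define K where "K = {(i, j). i < n \<and> j < n \<and> R i j}"
  have "K \<subseteq> {..<n} \<times> {..<n}" by (auto simp: K_def)
  then have "finite K" using finite_subset by blast
  then obtain e where e: "bij_betw e {0..<card K} K" using ex_bij_betw_nat_finite by blast
  define N where "N = card K"
  define pos where "pos = inv_into {0..<N} e"
  have pos: "pos p < N" "e (pos p) = p" if "p \<in> K" for p
    using that e bij_betw_inv_into_right[OF e] bij_betw_apply[OF bij_betw_inv_into[OF e]]
    by (auto simp: pos_def N_def)
  have pose: "pos (e m) = m" "e m \<in> K" if "m < N" for m
    using that e bij_betw_inv_into_left[OF e] bij_betwE[OF e] by (auto simp: pos_def N_def)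
  define U where "U = {x :: nat \<Rightarrow> real. \<forall>i\<ge>2 * N. x i = 0}"
  \<comment> \<open>\<open>h\<close> and \<open>k\<close> are mutually inverse coordinate maps
    between the algebra and \<open>U\<close>: the admissible position numbered m uses the
    coordinates 2m and 2m+1 for its real and imaginary parts.\<close>
  define h where "h x = mat n n (\<lambda>p. if p \<in> K then Complex (x (2 * pos p)) (x (2 * pos p + 1)) else 0)"
    for x :: "nat \<Rightarrow> real"
  define k where "k X m = (if m < 2 * N then (if even m then Re else Im) (X $$ e (m div 2)) else 0)"
    for X :: "complex mat" and m
  have E: "Euclidean_space (2 * N) = top_of_set U"
    by (simp add: Euclidean_space_def euclidean_product_topology U_def)
  have hA: "h x \<in> ?A" for x by (auto simp: h_def pattern_algebra_def K_def)
  have kU: "k X \<in> U" for X by (auto simp: k_def U_def)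
  have hk: "h (k X) = X" if "X \<in> ?A" for X
  proof (rule eq_matI)
    fix i j assume "i < dim_row X" "j < dim_col X"
    then have ij: "i < n" "j < n" using that by (auto simp: pattern_algebra_def)
    show "h (k X) $$ (i, j) = X $$ (i, j)"
    proof (cases "(i, j) \<in> K")
      case True
      then have "2 * pos (i, j) + 1 < 2 * N" "2 * pos (i, j) < 2 * N" "e (pos (i, j)) = (i, j)"
        using pos[OF True] by auto
      then show ?thesis using ij True by (simp add: h_def k_def)
    next
      case False
      then show ?thesis using ij that by (auto simp: h_def K_def pattern_algebra_def)
    qed
  qed (use that in \<open>auto simp: h_def pattern_algebra_def\<close>)
  have kh: "k (h x) = x" if "x \<in> U" for x
  proof
    fix m
    show "k (h x) m = x m"
    proof (cases "m < 2 * N")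
      case True
      then have "m div 2 < N" by auto
      then have pe: "pos (e (m div 2)) = m div 2" "e (m div 2) \<in> K" using pose by auto
      obtain i j where ij: "e (m div 2) = (i, j)" by (cases "e (m div 2)")
      then have "i < n" "j < n" using pe(2) by (auto simp: K_def)
      then have "h x $$ (i, j) = Complex (x (2 * (m div 2))) (x (2 * (m div 2) + 1))"
        using pe unfolding ij by (simp add: h_def)
      then show ?thesis using True ij by (cases "even m") (simp_all add: k_def)
    next
      case False
      then show ?thesis using that by (simp add: k_def U_def)
    qed
  qed
  define f where "f = k \<circ> \<phi> \<circ> h"
  have \<phi>A: "\<phi> X \<in> ?A" if "X \<in> ?A" for X using \<phi> that by blast
  have kcont: "continuous_on S (\<lambda>z. k (g z))"
    if "\<And>i j. i < n \<Longrightarrow> j < n \<Longrightarrow> continuous_on S (\<lambda>z. g z $$ (i, j))"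
    for S and g :: "'a::topological_space \<Rightarrow> complex mat"
  proof (rule continuous_on_coordinatewise_then_product)
    fix m
    show "continuous_on S (\<lambda>z. k (g z) m)"
    proof (cases "m < 2 * N")
      case True
      then have "e (m div 2) \<in> K" using pose by auto
      then obtain i j where ij: "e (m div 2) = (i, j)" "i < n" "j < n" unfolding K_def by blast
      have "(\<lambda>z. k (g z) m) = (\<lambda>z. (if even m then Re else Im) (g z $$ (i, j)))"
        using True ij(1) by (simp add: k_def)
      moreover have "continuous_on S (\<lambda>z. Re (g z $$ (i, j)))" "continuous_on S (\<lambda>z. Im (g z $$ (i, j)))"
        by (intro continuous_on_Re continuous_on_Im that ij)+
      ultimately show ?thesis by (cases "even m") (simp_all only: if_True if_False)
    qed (simp add: k_def)
  qed
  have hcont: "continuous_on U (\<lambda>x. h x $$ (i, j))" if "i < n" "j < n" for i j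
  proof -
    have co: "continuous_on U (\<lambda>x :: nat \<Rightarrow> real. x m)" for m
      by (rule continuous_on_subset[OF continuous_on_product_coordinates]) simp
    have "continuous_on U (\<lambda>x. complex_of_real (x a) + \<i> * complex_of_real (x b))" for a b
      by (intro continuous_on_add continuous_on_mult continuous_on_const continuous_on_of_real co)
    then show ?thesis using that by (cases "(i, j) \<in> K") (simp_all add: h_def Complex_eq)
  qed
  have fcont: "continuous_on U f"
    unfolding f_def o_def
    by (intro kcont continuous_on_mat_entries[OF cont]) (auto simp: hA hcont pattern_carrier)
  have finj: "inj_on f U"
  proof (rule inj_onI)
    fix x y assume xy: "x \<in> U" "y \<in> U" "f x = f y"
    then have "\<phi> (h x) = \<phi> (h y)" using hk[OF \<phi>A[OF hA]] unfolding f_def by (metis comp_apply)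
    then show "x = y" using inj hA kh xy by (metis inj_onD)
  qed
  have "openin (Euclidean_space (2 * N)) (f ` U)"
  proof (rule invariance_of_domain_Euclidean_space[OF _ _ finj])
    show "openin (Euclidean_space (2 * N)) U" using openin_topspace[of "top_of_set U"] by (simp add: E)
    show "continuous_map (subtopology (Euclidean_space (2 * N)) U) (Euclidean_space (2 * N)) f"
      using fcont kU by (simp add: E subtopology_subtopology f_def)
  qed
  then obtain W where W: "open W" "f ` U = U \<inter> W"
    unfolding E openin_open by blast
  define Y where "Y = \<phi> (h (k (0\<^sub>m n n)))"
  \<comment> \<open>Chosen so that the line \<open>Y + z L\<close> passes through diag(0, ..., n-1)
    at \<open>z = 1\<close>.\<close>
  define L where "L = mat_diag n of_nat + (-1) \<cdot>\<^sub>m Y"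
  have Y: "Y \<in> ?A" unfolding Y_def using \<phi>A hA by blast
  have L: "L \<in> ?A" unfolding L_def using pattern_line[OF pattern_diag[OF R] Y] by blast
  have Yz: "Y + z \<cdot>\<^sub>m L \<in> ?A" for z using pattern_line[OF Y L] .
  define V where "V = (\<lambda>z. k (Y + z \<cdot>\<^sub>m L)) -` W"
  have "continuous_on UNIV (\<lambda>z. k (Y + z \<cdot>\<^sub>m L))"
  proof (rule kcont)
    fix i j assume "i < n" "j < n"
    then have "(\<lambda>z. (Y + z \<cdot>\<^sub>m L) $$ (i, j)) = (\<lambda>z. Y $$ (i, j) + z * L $$ (i, j))"
      using Y L by (auto simp: pattern_algebra_def)
    then show "continuous_on UNIV (\<lambda>z. (Y + z \<cdot>\<^sub>m L) $$ (i, j))" by (simp only:) (intro continuous_intros)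
  qed
  then have "open V" unfolding V_def using W(1) by (simp add: open_vimage)
  have "Y + 0 \<cdot>\<^sub>m L = Y" using Y L by (intro eq_matI) (auto simp: pattern_algebra_def)
  moreover have "k Y \<in> f ` U" unfolding Y_def f_def using kU by auto
  ultimately have "0 \<in> V" unfolding V_def using W(2) by auto
  have "Y + 1 \<cdot>\<^sub>m L = mat_diag n of_nat"
    using Y by (intro eq_matI) (auto simp: L_def pattern_algebra_def mat_diag_def)
  then have "card (spectrum (Y + 1 \<cdot>\<^sub>m L)) = n"
    by (simp add: spectrum_diag card_image inj_on_def)
  from finite_discr_zero[OF pattern_carrier[OF Y] pattern_carrier[OF L] this]
  have "finite {z. card (spectrum (Y + z \<cdot>\<^sub>m L)) \<noteq> n}" .
  with \<open>open V\<close> \<open>0 \<in> V\<close> obtain z where z: "z \<in> V" "card (spectrum (Y + z \<cdot>\<^sub>m L)) = n"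
    using finite_imp_not_open[of V] finite_subset[of V "{z. card (spectrum (Y + z \<cdot>\<^sub>m L)) \<noteq> n}"] by blast
  then have "k (Y + z \<cdot>\<^sub>m L) \<in> f ` U" using W(2) kU by (auto simp: V_def)
  then obtain x where "k (Y + z \<cdot>\<^sub>m L) = k (\<phi> (h x))" unfolding f_def by auto
  then have "Y + z \<cdot>\<^sub>m L = \<phi> (h x)" using hk[OF Yz] hk[OF \<phi>A[OF hA]] by metis
  then show ?thesis using z(2) hA by auto
qed

text \<open>Wherever the image has n eigenvalues, shrinking forces equal spectra. So along a line
  the discriminant of the image is at each point either 0 or the discriminant of the argument;
  starting where the image has n eigenvalues, it cannot jump to 0 at points where the argument has
  n.\<close>

lemma spectrum_preserved:
  assumes R: "total_preorder n R"
    and \<phi>: "\<phi> ` pattern_algebra n R \<subseteq> pattern_algebra n R"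
    and cont: "continuous_on_mat n (pattern_algebra n R) \<phi>"
    and inj: "inj_on \<phi> (pattern_algebra n R)"
    and shr: "spectrum_shrinking (pattern_algebra n R) \<phi>"
    and X: "X \<in> pattern_algebra n R" and c: "card (spectrum X) = n"
  shows "spectrum (\<phi> X) = spectrum X"
proof -
  let ?A = "pattern_algebra n R"
  have \<phi>c: "\<phi> Z \<in> carrier_mat n n" if "Z \<in> ?A" for Z using \<phi> that pattern_carrier by blast
  have eq: "spectrum (\<phi> Z) = spectrum Z \<and> card (spectrum Z) = n"
    if Z: "Z \<in> ?A" and cZ: "card (spectrum (\<phi> Z)) = n" for Z
  proof -
    have "spectrum (\<phi> Z) \<subseteq> spectrum Z" using shr Z by (simp add: spectrum_shrinking_def)
    moreover have "finite (spectrum Z)" "card (spectrum Z) \<le> n"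
      using card_finite_spectrum[OF pattern_carrier[OF Z]] by auto
    ultimately have "spectrum (\<phi> Z) = spectrum Z" using cZ by (intro card_seteq) auto
    then show ?thesis using cZ by simp
  qed
  obtain X0 where X0: "X0 \<in> ?A" "card (spectrum (\<phi> X0)) = n"
    using ex_distinct_spectrum_image[OF R \<phi> cont inj] by blast
  define D where "D = X + (-1) \<cdot>\<^sub>m X0"
  have D: "D \<in> ?A" unfolding D_def using pattern_line[OF X X0(1)] .
  let ?\<gamma> = "\<lambda>z. X0 + z \<cdot>\<^sub>m D"
  have \<gamma>: "?\<gamma> z \<in> ?A" for z using pattern_line[OF X0(1) D] .
  have X0D: "?\<gamma> 0 = X0" "?\<gamma> 1 = X"
    using X X0(1) D by (auto intro!: eq_matI simp: D_def pattern_algebra_def)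
  have \<gamma>cont: "continuous_on UNIV (\<lambda>z. ?\<gamma> z $$ (i, j))" if "i < n" "j < n" for i j
  proof -
    have "(\<lambda>z. ?\<gamma> z $$ (i, j)) = (\<lambda>z. X0 $$ (i, j) + z * D $$ (i, j))"
      using X0(1) D that by (auto simp: pattern_algebra_def)
    then show ?thesis by (simp only:) (intro continuous_intros)
  qed
  interpret function_algebra "{f. continuous_on UNIV f}" by (rule function_algebra_continuous)
  have ca: "continuous_on UNIV (\<lambda>z. discr n (?\<gamma> z))"
    using discr[of ?\<gamma> n] \<gamma>cont pattern_carrier[OF \<gamma>] by auto
  have cb: "continuous_on UNIV (\<lambda>z. discr n (\<phi> (?\<gamma> z)))"
    using discr[of "\<lambda>z. \<phi> (?\<gamma> z)" n] \<phi>c[OF \<gamma>]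
      continuous_on_mat_entries[OF cont, of UNIV ?\<gamma>] \<gamma>cont \<gamma> pattern_carrier by blast
  let ?F = "{z. card (spectrum (?\<gamma> z)) \<noteq> n}"
  have "discr n (\<phi> (?\<gamma> 1)) = (if (0::nat) = 0 then discr n (?\<gamma> 1) else 0)"
  proof (rule continuous_selection[where F = ?F and ?z0.0 = 0 and n = 2 and
        g = "\<lambda>j z. if j = 0 then discr n (?\<gamma> z) else 0" and f = "\<lambda>z. discr n (\<phi> (?\<gamma> z))"])
    show "finite ?F"
      using finite_discr_zero[OF pattern_carrier[OF X0(1)] pattern_carrier[OF D], of 0] eq[OF X0] X0D by simp
    show "0 \<notin> ?F" using eq[OF X0] X0D by simp
    show "continuous_on UNIV (\<lambda>z. if j = 0 then discr n (?\<gamma> z) else 0)" for j :: nat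
      using ca by (cases "j = 0") auto
    show "discr n (\<phi> (?\<gamma> 0)) = (if (0::nat) = 0 then discr n (?\<gamma> 0) else 0)"
      using eq[OF X0] X0D discr_cong[OF \<phi>c[OF X0(1)] pattern_carrier[OF X0(1)]] X0(2) by simp
    fix z assume z: "z \<notin> ?F"
    show "\<exists>j<2. discr n (\<phi> (?\<gamma> z)) = (if j = (0::nat) then discr n (?\<gamma> z) else 0)"
    proof (cases "discr n (\<phi> (?\<gamma> z)) = 0")
      case True
      then show ?thesis by (auto intro!: exI[of _ 1])
    next
      case False
      then have "card (spectrum (\<phi> (?\<gamma> z))) = n" using discr_nonzero_iff[OF \<phi>c[OF \<gamma>]] by blast
      then show ?thesis
        using eq[OF \<gamma>] discr_cong[OF \<phi>c[OF \<gamma>] pattern_carrier[OF \<gamma>]] by (auto intro!: exI[of _ 0])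
    qed
    fix i j :: nat
    assume "i < 2" "j < 2" "(if i = 0 then discr n (?\<gamma> z) else 0) = (if j = 0 then discr n (?\<gamma> z) else 0)"
    moreover have "discr n (?\<gamma> z) \<noteq> 0" using z discr_nonzero_iff[OF pattern_carrier[OF \<gamma>]] by simp
    ultimately show "i = j" by (auto split: if_splits)
  qed (use cb in auto)
  then have "discr n (\<phi> X) \<noteq> 0"
    using X0D discr_nonzero_iff[OF pattern_carrier[OF X]] c by simp
  then show ?thesis using eq[OF X] discr_nonzero_iff[OF \<phi>c[OF X]] by blast
qed

section \<open>Rank-one idempotents\<close>

definition inverse_pair :: "nat \<Rightarrow> complex mat \<Rightarrow> complex mat \<Rightarrow> bool" where
  "inverse_pair n T S \<longleftrightarrow> T \<in> carrier_mat n n \<and> S \<in> carrier_mat n n \<and> T * S = 1\<^sub>m n \<and> S * T = 1\<^sub>m n"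

lemma inverse_pairD:
  assumes "inverse_pair n T S"
  shows "T \<in> carrier_mat n n" "S \<in> carrier_mat n n" "T * S = 1\<^sub>m n" "S * T = 1\<^sub>m n"
  using assms by (auto simp: inverse_pair_def)

lemma inverse_pair_sym: "inverse_pair n T S \<Longrightarrow> inverse_pair n S T"
  by (auto simp: inverse_pair_def)

lemma inverse_pair_cancel:
  assumes p: "inverse_pair n T S" and X: "X \<in> carrier_mat n n"
  shows "S * (T * X * S) * T = X"
proof -
  note c = inverse_pairD[OF p]
  have "S * (T * X * S) * T = (S * T) * X * (S * T)"
    using c(1,2) X by (simp add: assoc_mult_mat[of _ n n _ n _ n])
  then show ?thesis using c X by simp
qed

lemma inverse_pair_inj:
  assumes "inverse_pair n T S" "X \<in> carrier_mat n n" "Y \<in> carrier_mat n n" "T * X * S = T * Y * S"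
  shows "X = Y"
  using inverse_pair_cancel[OF assms(1,2)] inverse_pair_cancel[OF assms(1,3)] assms(4) by metis

lemma inverse_pair_mult:
  assumes p: "inverse_pair n T S" and p': "inverse_pair n T' S'"
  shows "inverse_pair n (T * T') (S' * S)"
proof -
  note c = inverse_pairD[OF p] and c' = inverse_pairD[OF p']
  have "(T * T') * (S' * S) = T * (T' * S') * S" "(S' * S) * (T * T') = S' * (S * T) * T'"
    using c(1,2) c'(1,2) by (simp_all add: assoc_mult_mat[of _ n n _ n _ n])
  then show ?thesis using c c' by (simp add: inverse_pair_def)
qed

lemma assoc_mult_mat5:
  fixes A B C D E :: "complex mat"
  assumes "A \<in> carrier_mat n n" "B \<in> carrier_mat n n" "C \<in> carrier_mat n n" "D \<in> carrier_mat n n" "E \<in> carrier_mat n n"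
  shows "A * B * C * (D * E) = A * (B * C * D) * E"
  using assms by (simp add: assoc_mult_mat[of _ n n _ n _ n])

lemma conj_mult:
  assumes p: "inverse_pair n T S" and X: "X \<in> carrier_mat n n" and Y: "Y \<in> carrier_mat n n"
  shows "(T * X * S) * (T * Y * S) = T * (X * Y) * S"
proof -
  note c = inverse_pairD[OF p]
  have "(T * X * S) * (T * Y * S) = T * X * (S * T) * Y * S"
    using c(1,2) X Y by (simp add: assoc_mult_mat[of _ n n _ n _ n])
  also have "\<dots> = T * (X * Y) * S" using c X Y by (simp add: assoc_mult_mat[of _ n n _ n _ n])
  finally show ?thesis .
qed

lemma spectrum_conj:
  assumes p: "inverse_pair n T S" and X: "X \<in> carrier_mat n n"
  shows "spectrum (T * X * S) = spectrum X"
proof -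
  note c = inverse_pairD[OF p]
  have "similar_mat (T * X * S) X" using c X by (intro similar_matI[of _ _ T S n]) auto
  from char_poly_similar[OF this] show ?thesis
    using spectrum_root_char_poly[of "T * X * S" n] spectrum_root_char_poly[OF X] c X by simp
qed

lemma card_spectrum_diag: "card (spectrum (mat_diag n d :: complex mat)) = n \<longleftrightarrow> inj_on d {..<n}"
  unfolding spectrum_diag by (metis card_image card_lessThan eq_card_imp_inj_on finite_lessThan)

lemma mult_mat_index:
  assumes "A \<in> carrier_mat n n" "B \<in> carrier_mat n n" "i < n" "j < n"
  shows "(A * B) $$ (i, j) = (\<Sum>k<n. A $$ (i, k) * B $$ (k, j))"
  using assms by (simp add: scalar_prod_def atLeast0LessThan)

lemma conj_diag_index:
  fixes T S :: "complex mat"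
  assumes "T \<in> carrier_mat n n" "S \<in> carrier_mat n n" "i < n" "j < n"
  shows "(T * mat_diag n d * S) $$ (i, j) = (\<Sum>k<n. d k * (T $$ (i, k) * S $$ (k, j)))"
proof -
  have "(T * mat_diag n d * S) $$ (i, j) = (\<Sum>k<n. (T * mat_diag n d) $$ (i, k) * S $$ (k, j))"
    by (rule mult_mat_index) (use assms in auto)
  also have "\<dots> = (\<Sum>k<n. d k * (T $$ (i, k) * S $$ (k, j)))"
    unfolding mat_diag_mult_right[OF assms(1)] using assms(3) by (intro sum.cong) (auto simp: ac_simps)
  finally show ?thesis .
qed

lemma conj_index:
  fixes T S X :: "complex mat"
  assumes "T \<in> carrier_mat n n" "S \<in> carrier_mat n n" "X \<in> carrier_mat n n" "i < n" "j < n"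
  shows "(T * X * S) $$ (i, j) = (\<Sum>l<n. \<Sum>k<n. T $$ (i, k) * X $$ (k, l) * S $$ (l, j))"
proof -
  have "(T * X * S) $$ (i, j) = (\<Sum>l<n. (T * X) $$ (i, l) * S $$ (l, j))"
    using assms by (simp add: scalar_prod_def atLeast0LessThan del: assoc_mult_mat)
  also have "\<dots> = (\<Sum>l<n. (\<Sum>k<n. T $$ (i, k) * X $$ (k, l)) * S $$ (l, j))"
    using assms by (intro sum.cong) (simp_all add: scalar_prod_def atLeast0LessThan)
  finally show ?thesis by (simp add: sum_distrib_right)
qed

lemma continuous_on_conj_index:
  fixes B C :: "complex mat" and f :: "'a::topological_space \<Rightarrow> complex mat"
  assumes "B \<in> carrier_mat n n" "C \<in> carrier_mat n n" "\<And>z. f z \<in> carrier_mat n n" "i < n" "j < n"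
    and f: "\<And>k l. k < n \<Longrightarrow> l < n \<Longrightarrow> continuous_on S (\<lambda>z. f z $$ (k, l))"
  shows "continuous_on S (\<lambda>z. (B * f z * C) $$ (i, j))"
  unfolding conj_index[OF assms(1,2,3,4,5)]
proof (rule continuous_on_sum, rule continuous_on_sum)
  fix k l assume "l \<in> {..<n}" "k \<in> {..<n}"
  then have "continuous_on S (\<lambda>z. f z $$ (k, l))" using f by simp
  then show "continuous_on S (\<lambda>z. B $$ (i, k) * f z $$ (k, l) * C $$ (l, j))"
    by (rule continuous_on_mult[OF continuous_on_mult[OF continuous_on_const] continuous_on_const])
qed

lemma conj_line:
  fixes T S X Y :: "complex mat"
  assumes "T \<in> carrier_mat n n" "S \<in> carrier_mat n n" "X \<in> carrier_mat n n" "Y \<in> carrier_mat n n"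
  shows "T * (X + z \<cdot>\<^sub>m Y) * S = T * X * S + z \<cdot>\<^sub>m (T * Y * S)"
  using assms
  by (simp add: mult_add_distrib_mat[of _ n n _ n] add_mult_distrib_mat[of _ n n _ _ n]
      mult_smult_distrib[of _ n n _ n] mult_smult_assoc_mat[of _ n n _ n])

section \<open>Preservers up to change of basis\<close>

text \<open>The properties of \<open>\<phi>\<close> that survive a change of basis in the domain (by an element of the
  algebra) and in the codomain (by any invertible matrix).\<close>

definition preserver :: "nat \<Rightarrow> (nat \<Rightarrow> nat \<Rightarrow> bool) \<Rightarrow> (complex mat \<Rightarrow> complex mat) \<Rightarrow> bool" where
  "preserver n R \<psi> \<longleftrightarrow>
     (\<forall>X\<in>pattern_algebra n R. \<psi> X \<in> carrier_mat n n) \<and>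
     inj_on \<psi> (pattern_algebra n R) \<and>
     commutativity_preserving (pattern_algebra n R) \<psi> \<and>
     (\<forall>X\<in>pattern_algebra n R. card (spectrum X) = n \<longrightarrow> spectrum (\<psi> X) = spectrum X) \<and>
     (\<forall>X\<in>pattern_algebra n R. \<forall>Y\<in>pattern_algebra n R. \<forall>i<n. \<forall>j<n.
        continuous_on UNIV (\<lambda>z. \<psi> (X + z \<cdot>\<^sub>m Y) $$ (i, j)))"

lemma preserverD:
  assumes "preserver n R \<psi>"
  shows "\<And>X. X \<in> pattern_algebra n R \<Longrightarrow> \<psi> X \<in> carrier_mat n n"
    and "inj_on \<psi> (pattern_algebra n R)"
    and "\<And>X Y. X \<in> pattern_algebra n R \<Longrightarrow> Y \<in> pattern_algebra n R \<Longrightarrow> X * Y = Y * X \<Longrightarrow> \<psi> X * \<psi> Y = \<psi> Y * \<psi> X"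
    and "\<And>X. X \<in> pattern_algebra n R \<Longrightarrow> card (spectrum X) = n \<Longrightarrow> spectrum (\<psi> X) = spectrum X"
    and "\<And>X Y i j. X \<in> pattern_algebra n R \<Longrightarrow> Y \<in> pattern_algebra n R \<Longrightarrow> i < n \<Longrightarrow> j < n \<Longrightarrow>
           continuous_on UNIV (\<lambda>z. \<psi> (X + z \<cdot>\<^sub>m Y) $$ (i, j))"
  using assms unfolding preserver_def commutativity_preserving_def by blast+

lemma preserver_codomain_conj:
  assumes \<psi>: "preserver n R \<psi>" and p: "inverse_pair n B C"
  shows "preserver n R (\<lambda>X. B * \<psi> X * C)"
proof -
  let ?A = "pattern_algebra n R"
  note c = inverse_pairD[OF p] and \<psi>' = preserverD[OF \<psi>]
  show ?thesis unfolding preserver_def commutativity_preserving_def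
  proof (intro conjI ballI allI impI)
    fix X assume X: "X \<in> ?A"
    show "B * \<psi> X * C \<in> carrier_mat n n" using c \<psi>'(1)[OF X] by simp
    show "spectrum (B * \<psi> X * C) = spectrum X" if "card (spectrum X) = n"
      using spectrum_conj[OF p \<psi>'(1)[OF X]] \<psi>'(4)[OF X that] by simp
    fix Y assume Y: "Y \<in> ?A"
    show "B * \<psi> X * C * (B * \<psi> Y * C) = B * \<psi> Y * C * (B * \<psi> X * C)" if "X * Y = Y * X"
      using conj_mult[OF p \<psi>'(1)[OF X] \<psi>'(1)[OF Y]] conj_mult[OF p \<psi>'(1)[OF Y] \<psi>'(1)[OF X]]
        \<psi>'(3)[OF X Y that] by simp
    fix i j assume ij: "i < n" "j < n"
    show "continuous_on UNIV (\<lambda>z. (B * \<psi> (X + z \<cdot>\<^sub>m Y) * C) $$ (i, j))"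
    proof (rule continuous_on_conj_index[where f = "\<lambda>z. \<psi> (X + z \<cdot>\<^sub>m Y)" and n = n])
      show "\<psi> (X + z \<cdot>\<^sub>m Y) \<in> carrier_mat n n" for z by (rule \<psi>'(1)[OF pattern_line[OF X Y]])
      show "continuous_on UNIV (\<lambda>z. \<psi> (X + z \<cdot>\<^sub>m Y) $$ (k, l))" if "k < n" "l < n" for k l
        by (rule \<psi>'(5)[OF X Y that])
    qed (rule c ij)+
  next
    show "inj_on (\<lambda>X. B * \<psi> X * C) ?A"
    proof (rule inj_onI)
      fix X Y assume X: "X \<in> ?A" and Y: "Y \<in> ?A" and "B * \<psi> X * C = B * \<psi> Y * C"
      then have "\<psi> X = \<psi> Y"
        using inverse_pair_inj[OF p \<psi>'(1)[OF X] \<psi>'(1)[OF Y]] by blast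
      then show "X = Y" using \<psi>'(2) X Y by (meson inj_onD)
    qed
  qed
qed

lemma preserver_domain_conj:
  assumes R: "total_preorder n R" and \<psi>: "preserver n R \<psi>" and p: "inverse_pair n S S'"
    and S: "S \<in> pattern_algebra n R" "S' \<in> pattern_algebra n R"
  shows "preserver n R (\<lambda>X. \<psi> (S * X * S'))"
proof -
  let ?A = "pattern_algebra n R"
  note c = inverse_pairD[OF p] and \<psi>' = preserverD[OF \<psi>]
  have SA: "S * X * S' \<in> ?A" if "X \<in> ?A" for X using pattern_sandwich[OF R S(1) that S(2)] .
  show ?thesis unfolding preserver_def commutativity_preserving_def
  proof (intro conjI ballI allI impI)
    fix X assume X: "X \<in> ?A"
    note Xc = pattern_carrier[OF X]
    show "\<psi> (S * X * S') \<in> carrier_mat n n" using \<psi>'(1)[OF SA[OF X]] .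
    show "spectrum (\<psi> (S * X * S')) = spectrum X" if "card (spectrum X) = n"
      using spectrum_conj[OF p Xc] \<psi>'(4)[OF SA[OF X]] that by simp
    fix Y assume Y: "Y \<in> ?A"
    note Yc = pattern_carrier[OF Y]
    show "\<psi> (S * X * S') * \<psi> (S * Y * S') = \<psi> (S * Y * S') * \<psi> (S * X * S')" if "X * Y = Y * X"
      using conj_mult[OF p Xc Yc] conj_mult[OF p Yc Xc] \<psi>'(3)[OF SA[OF X] SA[OF Y]] that by simp
    fix i j assume ij: "i < n" "j < n"
    show "continuous_on UNIV (\<lambda>z. \<psi> (S * (X + z \<cdot>\<^sub>m Y) * S') $$ (i, j))"
      using \<psi>'(5)[OF SA[OF X] SA[OF Y] ij] by (simp only: conj_line[OF c(1,2) Xc Yc])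
  next
    show "inj_on (\<lambda>X. \<psi> (S * X * S')) ?A"
    proof (rule inj_onI)
      fix X Y assume X: "X \<in> ?A" and Y: "Y \<in> ?A" and "\<psi> (S * X * S') = \<psi> (S * Y * S')"
      then have "S * X * S' = S * Y * S'" using \<psi>'(2) SA[OF X] SA[OF Y] by (meson inj_onD)
      then show "X = Y"
        using inverse_pair_inj[OF p pattern_carrier[OF X] pattern_carrier[OF Y]] by blast
    qed
  qed
qed

text \<open>Transposition reverses both sides of a commutation relation and keeps the characteristic
  polynomial. It may carry values out of the algebra, but \<open>preserver\<close> only asks for n x
  n values. The column case is reduced to the row case in this way.\<close>

lemma preserver_transpose:
  assumes \<psi>: "preserver n R \<psi>"
  shows "preserver n R (\<lambda>X. transpose_mat (\<psi> X))"
proof -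
  let ?A = "pattern_algebra n R"
  note \<psi>' = preserverD[OF \<psi>]
  show ?thesis unfolding preserver_def commutativity_preserving_def
  proof (intro conjI ballI allI impI)
    fix X assume X: "X \<in> ?A"
    note Xc = \<psi>'(1)[OF X]
    show "transpose_mat (\<psi> X) \<in> carrier_mat n n" using Xc by simp
    then show "spectrum (transpose_mat (\<psi> X)) = spectrum X" if "card (spectrum X) = n"
      using \<psi>'(4)[OF X that] spectrum_root_char_poly[OF Xc] spectrum_root_char_poly[of "transpose_mat (\<psi> X)" n]
        char_poly_transpose_mat[OF Xc] by simp
    fix Y assume Y: "Y \<in> ?A"
    note Yc = \<psi>'(1)[OF Y]
    show "transpose_mat (\<psi> X) * transpose_mat (\<psi> Y) = transpose_mat (\<psi> Y) * transpose_mat (\<psi> X)"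
      if "X * Y = Y * X"
      using transpose_mult[OF Xc Yc] transpose_mult[OF Yc Xc] \<psi>'(3)[OF X Y that] by simp
    fix i j assume ij: "i < n" "j < n"
    have "(\<lambda>z. transpose_mat (\<psi> (X + z \<cdot>\<^sub>m Y)) $$ (i, j)) = (\<lambda>z. \<psi> (X + z \<cdot>\<^sub>m Y) $$ (j, i))"
      using carrier_matD[OF \<psi>'(1)[OF pattern_line[OF X Y]]] ij by simp
    then show "continuous_on UNIV (\<lambda>z. transpose_mat (\<psi> (X + z \<cdot>\<^sub>m Y)) $$ (i, j))"
      using \<psi>'(5)[OF X Y ij(2,1)] by (simp only:)
  next
    show "inj_on (\<lambda>X. transpose_mat (\<psi> X)) ?A"
    proof (rule inj_onI)
      fix X Y assume XY: "X \<in> ?A" "Y \<in> ?A" "transpose_mat (\<psi> X) = transpose_mat (\<psi> Y)"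
      have "\<psi> X = \<psi> Y" using arg_cong[OF XY(3), of transpose_mat] by simp
      then show "X = Y" using \<psi>'(2) XY(1,2) by (meson inj_onD)
    qed
  qed
qed

text \<open>A maximal commuting family \<open>T D S\<close> inside the algebra, with \<open>D\<close> ranging over the diagonal
  matrices, is mapped to another such family, and linearly so: the eigenvalues of the image are
  a permutation of those of the argument, and this permutation cannot jump along lines.\<close>

lemma preserver_frame:
  assumes \<psi>: "preserver n R \<psi>" and p: "inverse_pair n T S"
    and A: "\<And>d. T * mat_diag n d * S \<in> pattern_algebra n R"
  shows "\<exists>T' S'. inverse_pair n T' S' \<and> (\<forall>d. \<psi> (T * mat_diag n d * S) = T' * mat_diag n d * S')"
proof -
  note c = inverse_pairD[OF p] and \<psi>' = preserverD[OF \<psi>]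
  have spec: "spectrum (T * mat_diag n d * S) = d ` {..<n}" for d
    using spectrum_conj[OF p mat_diag_dim] spectrum_diag by simp
  have card: "card (spectrum (T * mat_diag n d * S)) = n \<longleftrightarrow> inj_on d {..<n}" for d
    using spectrum_conj[OF p mat_diag_dim] card_spectrum_diag by simp
  \<comment> \<open>A base point with simple spectrum; any injective choice serves.\<close>
  define d0 :: "nat \<Rightarrow> complex" where "d0 = of_nat"
  have inj0: "inj_on d0 {..<n}" by (simp add: d0_def inj_on_def)
  define M where "M = \<psi> (T * mat_diag n d0 * S)"
  have Mc: "M \<in> carrier_mat n n" unfolding M_def using \<psi>'(1)[OF A] .
  have "spectrum M = d0 ` {..<n}"
    unfolding M_def using \<psi>'(4)[OF A] card[of d0] inj0 spec by simp
  then obtain T' S' where T': "T' \<in> carrier_mat n n" "S' \<in> carrier_mat n n" "T' * S' = 1\<^sub>m n" "S' * T' = 1\<^sub>m n"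
    and M: "M = T' * mat_diag n d0 * S'"
    using ex_diagonalization[OF Mc inj0] by auto
  have p': "inverse_pair n T' S'" using T' by (simp add: inverse_pair_def)
  define \<mu> where "\<mu> d i = (S' * \<psi> (T * mat_diag n d * S) * T') $$ (i, i)" for d i
  have form: "\<psi> (T * mat_diag n d * S) = T' * mat_diag n (\<mu> d) * S'" for d
  proof -
    let ?Y = "\<psi> (T * mat_diag n d * S)"
    have Y: "?Y \<in> carrier_mat n n" using \<psi>'(1)[OF A] .
    let ?N = "S' * ?Y * T'"
    have N: "?N \<in> carrier_mat n n" using T' Y by simp
    have "T * mat_diag n d * S * (T * mat_diag n d0 * S) = T * mat_diag n d0 * S * (T * mat_diag n d * S)"
      using conj_mult[OF p] by (simp add: mult.commute)
    from \<psi>'(3)[OF A A this] have YM: "?Y * M = M * ?Y" by (simp add: M_def)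
    have M': "S' * M * T' = mat_diag n d0" unfolding M using inverse_pair_cancel[OF p'] by simp
    \<comment> \<open>A matrix that commutes with a diagonal matrix of distinct entries is
      diagonal.\<close>
    have "?N * mat_diag n d0 = mat_diag n d0 * ?N"
      using conj_mult[OF inverse_pair_sym[OF p'] Y Mc] conj_mult[OF inverse_pair_sym[OF p'] Mc Y] YM M' by simp
    then have "?N $$ (i, j) * d0 j = d0 i * ?N $$ (i, j)" if "i < n" "j < n" for i j
      using that unfolding mat_diag_mult_left[OF N] mat_diag_mult_right[OF N]
      by (metis (no_types, lifting) case_prod_conv index_mat(1))
    then have "?N $$ (i, j) = 0" if "i < n" "j < n" "i \<noteq> j" for i j
      using that by (force simp: d0_def)
    then have "?N = mat_diag n (\<mu> d)"
      using N by (intro eq_matI) (auto simp: mat_diag_def \<mu>_def)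
    then show ?thesis using inverse_pair_cancel[OF inverse_pair_sym[OF p'] Y] by simp
  qed
  have "\<mu> d i = d i" if i: "i < n" for d i
  proof -
    \<comment> \<open>The affine line from \<open>d0\<close> to \<open>d\<close>. Off finitely many
      \<open>z\<close> its values are distinct, and there the i-th eigenvalue of the image is one of
      the functions \<open>dz z j\<close>; at \<open>z = 0\<close> it is the one with j = i.\<close>
    define dz where "dz z i = d0 i + z * (d i - d0 i)" for z i
    define D where "D = T * mat_diag n (\<lambda>i. d i - d0 i) * S"
    have line: "T * mat_diag n d0 * S + z \<cdot>\<^sub>m D = T * mat_diag n (dz z) * S" for z
    proof -
      have "mat_diag n (dz z) = mat_diag n d0 + z \<cdot>\<^sub>m mat_diag n (\<lambda>i. d i - d0 i)"
        by (intro eq_matI) (auto simp: mat_diag_def dz_def)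
      then show ?thesis unfolding D_def using conj_line[OF c(1,2) mat_diag_dim mat_diag_dim] by simp
    qed
    let ?F = "{z. card (spectrum (T * mat_diag n d0 * S + z \<cdot>\<^sub>m D)) \<noteq> n}"
    have F: "z \<in> ?F \<longleftrightarrow> \<not> inj_on (dz z) {..<n}" for z using card line by simp
    have D: "D \<in> pattern_algebra n R" unfolding D_def by (rule A)
    have dz0: "dz 0 = d0" and dz1: "dz 1 = d" by (auto simp: dz_def)
    have "\<mu> (dz 1) i = dz 1 i"
    proof (rule continuous_selection[where F = ?F and n = n and g = "\<lambda>j z. dz z j" and
          f = "\<lambda>z. \<mu> (dz z) i" and ?z0.0 = 0])
      show "0 \<notin> ?F" using F dz0 inj0 by simp
      have "card (spectrum (T * mat_diag n d0 * S + 0 \<cdot>\<^sub>m D)) = n" using F dz0 inj0 by auto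
      then show "finite ?F"
        by (rule finite_discr_zero[OF pattern_carrier[OF A] pattern_carrier[OF D]])
      show "continuous_on UNIV (\<lambda>z. \<mu> (dz z) i)"
        unfolding \<mu>_def line[symmetric]
      proof (rule continuous_on_conj_index[where n = n and
              f = "\<lambda>z. \<psi> (T * mat_diag n d0 * S + z \<cdot>\<^sub>m D)"])
        show "\<psi> (T * mat_diag n d0 * S + z \<cdot>\<^sub>m D) \<in> carrier_mat n n" for z
          by (rule \<psi>'(1)[OF pattern_line[OF A D]])
        show "continuous_on UNIV (\<lambda>z. \<psi> (T * mat_diag n d0 * S + z \<cdot>\<^sub>m D) $$ (k, l))"
          if "k < n" "l < n" for k l by (rule \<psi>'(5)[OF A D that])
      qed (rule T' i)+
      show "continuous_on UNIV (\<lambda>z. dz z j)" for j unfolding dz_def by (intro continuous_intros)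
      have "mat_diag n d0 = S' * M * T'" unfolding M using inverse_pair_cancel[OF p'] by simp
      then have "(mat_diag n d0) $$ (i, i) = \<mu> d0 i" by (simp add: \<mu>_def M_def)
      then show "\<mu> (dz 0) i = dz 0 i" using i dz0 by (simp add: mat_diag_def)
      fix z assume "z \<notin> ?F"
      then have inj: "inj_on (dz z) {..<n}" using F by blast
      then have "spectrum (\<psi> (T * mat_diag n (dz z) * S)) = dz z ` {..<n}"
        using \<psi>'(4)[OF A] card spec by simp
      then have "\<mu> (dz z) ` {..<n} = dz z ` {..<n}"
        using spectrum_conj[OF p' mat_diag_dim] spectrum_diag form by simp
      then show "\<exists>j<n. \<mu> (dz z) i = dz z j" using i by (metis image_iff lessThan_iff)
      show "j = k" if "j < n" "k < n" "dz z j = dz z k" for j k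
        using inj that by (auto simp: inj_on_def)
    qed (use i in auto)
    then show ?thesis using dz1 by simp
  qed
  then have "mat_diag n (\<mu> d) = mat_diag n d" for d by (intro eq_matI) (auto simp: mat_diag_def)
  then show ?thesis using p' form by auto
qed

section \<open>Rank-one matrices and elementary conjugations\<close>

definition outer :: "nat \<Rightarrow> (nat \<Rightarrow> complex) \<Rightarrow> (nat \<Rightarrow> complex) \<Rightarrow> complex mat" where
  "outer n x y = mat n n (\<lambda>(i, j). x i * y j)"

text \<open>The bilinear pairing, without complex conjugation: the square of x y^t is
  \<open>dot n y x\<close> times itself, so \<open>dot n y x = 1\<close> marks the rank-one
  idempotents. Vectors are functions on all naturals, of which only the values below n
  matter.\<close>

definition dot :: "nat \<Rightarrow> (nat \<Rightarrow> complex) \<Rightarrow> (nat \<Rightarrow> complex) \<Rightarrow> complex" where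
  "dot n x y = (\<Sum>i<n. x i * y i)"

definition ev :: "nat \<Rightarrow> nat \<Rightarrow> complex" where
  "ev i k = (if k = i then 1 else 0)"

lemma ev_simps [simp]: "ev i i = 1" "k \<noteq> i \<Longrightarrow> ev i k = 0"
  by (auto simp: ev_def)

lemma outer_carrier [simp]: "outer n x y \<in> carrier_mat n n"
  by (simp add: outer_def)

lemma outer_index [simp]: "i < n \<Longrightarrow> j < n \<Longrightarrow> outer n x y $$ (i, j) = x i * y j"
  by (simp add: outer_def)

lemma one_smult_outer [simp]: "1 \<cdot>\<^sub>m outer n x y = outer n x y"
  by (intro eq_matI) (auto simp: outer_def)

lemma outer_eqI: "(\<And>i j. i < n \<Longrightarrow> j < n \<Longrightarrow> x i * y j = u i * v j) \<Longrightarrow> outer n x y = outer n u v"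
  by (auto simp: outer_def intro!: eq_matI)

lemma outer_dim [simp]: "dim_row (outer n x y) = n" "dim_col (outer n x y) = n"
  by (simp_all add: outer_def)

lemma dot_commute: "dot n x y = dot n y x"
  by (simp add: dot_def mult.commute)

lemma dot_ev [simp]: "i < n \<Longrightarrow> dot n (ev i) x = x i" "i < n \<Longrightarrow> dot n x (ev i) = x i"
proof -
  show "dot n (ev i) x = x i" if "i < n"
  proof -
    have "dot n (ev i) x = (\<Sum>k<n. if k = i then x i else 0)"
      unfolding dot_def by (rule sum.cong) auto
    then show ?thesis using that by simp
  qed
  then show "i < n \<Longrightarrow> dot n x (ev i) = x i" by (simp add: dot_commute)
qed

lemma dot_add: "dot n (\<lambda>k. x k + y k) z = dot n x z + dot n y z" "dot n z (\<lambda>k. x k + y k) = dot n z x + dot n z y"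
  by (simp_all add: dot_def distrib_left distrib_right sum.distrib)

lemma dot_scale: "dot n (\<lambda>k. c * x k) z = c * dot n x z" "dot n z (\<lambda>k. c * x k) = c * dot n z x"
  by (simp_all add: dot_def sum_distrib_left mult_ac)

lemma diag_ev: "mat_diag n (ev k) = outer n (ev k) (ev k)"
  by (intro eq_matI) (auto simp: mat_diag_def ev_def)

lemma outer_mult: "outer n x y * outer n u v = dot n y u \<cdot>\<^sub>m outer n x v"
  by (intro eq_matI)
    (auto simp: scalar_prod_def atLeast0LessThan dot_def sum_distrib_left sum_distrib_right mult_ac)

text \<open>If the pairing of q and u is nonzero, contracting the commutation relation with u on the
  right and with q on the left gives p = c' u and v = c' q with the same scalar, so the two
  idempotents coincide. Distinct commuting rank-one idempotents are therefore orthogonal.\<close>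

lemma outer_commute_imp:
  assumes pq: "dot n q p = 1" and uv: "dot n v u = 1"
    and comm: "outer n p q * outer n u v = outer n u v * outer n p q" and ne: "outer n p q \<noteq> outer n u v"
  shows "dot n q u = 0"
proof (rule ccontr)
  define c c' where "c = dot n q u" and "c' = dot n v p"
  assume "dot n q u \<noteq> 0"
  then have c: "c \<noteq> 0" by (simp add: c_def)
  have e: "c * (p i * v j) = c' * (u i * q j)" if "i < n" "j < n" for i j
    using arg_cong[OF comm[unfolded outer_mult], of "\<lambda>M. M $$ (i, j)"] that by (simp add: c_def c'_def)
  have p: "p i = c' * u i" if i: "i < n" for i
  proof -
    have "(\<Sum>j<n. c * (p i * v j) * u j) = (\<Sum>j<n. c' * (u i * q j) * u j)"
      using e[OF i] by (intro sum.cong) auto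
    then have "c * p i * dot n v u = c' * u i * dot n q u"
      by (simp add: dot_def sum_distrib_left mult_ac)
    then show ?thesis using uv c by (simp add: c_def[symmetric])
  qed
  have v: "v j = c' * q j" if j: "j < n" for j
  proof -
    have "(\<Sum>i<n. c * (p i * v j) * q i) = (\<Sum>i<n. c' * (u i * q j) * q i)"
      using e[OF _ j] by (intro sum.cong) auto
    then have "c * v j * dot n q p = c' * q j * dot n q u"
      by (simp add: dot_def sum_distrib_left mult_ac)
    then show ?thesis using pq c by (simp add: c_def[symmetric])
  qed
  have "outer n p q = outer n u v" by (rule outer_eqI) (simp add: p v)
  with ne show False by simp
qed

text \<open>The matrix I + u e_k^t, and dually I + e_k w^t in \<open>rowm\<close>; when the k-th
  coordinate of the vector vanishes, the inverse arises by changing its sign.\<close>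

definition colm :: "nat \<Rightarrow> nat \<Rightarrow> (nat \<Rightarrow> complex) \<Rightarrow> complex mat" where
  "colm n k u = mat n n (\<lambda>(i, j). ev i j + u i * ev k j)"

definition rowm :: "nat \<Rightarrow> nat \<Rightarrow> (nat \<Rightarrow> complex) \<Rightarrow> complex mat" where
  "rowm n k w = mat n n (\<lambda>(i, j). ev i j + ev k i * w j)"

lemma colm_carrier [simp]: "colm n k u \<in> carrier_mat n n" by (simp add: colm_def)

lemma rowm_carrier [simp]: "rowm n k u \<in> carrier_mat n n" by (simp add: rowm_def)

lemma colm_mult:
  assumes X: "X \<in> carrier_mat n n" and ij: "i < n" "j < n" "k < n"
  shows "(colm n k u * X) $$ (i, j) = X $$ (i, j) + u i * X $$ (k, j)"
proof -
  have "(colm n k u * X) $$ (i, j) = dot n (\<lambda>l. ev i l + u i * ev k l) (\<lambda>l. X $$ (l, j))"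
    using X ij by (simp add: colm_def scalar_prod_def atLeast0LessThan dot_def)
  then show ?thesis using ij by (simp add: dot_add dot_scale)
qed

lemma ev_swap: "ev i j = ev j i" by (simp add: ev_def)

lemma mult_colm:
  assumes X: "X \<in> carrier_mat n n" and ij: "i < n" "j < n" "k < n"
  shows "(X * colm n k u) $$ (i, j) = X $$ (i, j) + dot n (\<lambda>l. X $$ (i, l)) u * ev k j"
proof -
  have "(X * colm n k u) $$ (i, j) = dot n (\<lambda>l. X $$ (i, l)) (\<lambda>l. ev j l + ev k j * u l)"
    using X ij by (simp add: colm_def scalar_prod_def atLeast0LessThan dot_def ev_swap[of j] mult.commute)
  then show ?thesis using ij by (simp add: dot_add dot_scale)
qed

lemma rowm_mult:
  assumes X: "X \<in> carrier_mat n n" and ij: "i < n" "j < n" "k < n"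
  shows "(rowm n k w * X) $$ (i, j) = X $$ (i, j) + ev k i * dot n w (\<lambda>l. X $$ (l, j))"
proof -
  have "(rowm n k w * X) $$ (i, j) = dot n (\<lambda>l. ev i l + ev k i * w l) (\<lambda>l. X $$ (l, j))"
    using X ij by (simp add: rowm_def scalar_prod_def atLeast0LessThan dot_def)
  then show ?thesis using ij by (simp add: dot_add dot_scale)
qed

lemma mult_rowm:
  assumes X: "X \<in> carrier_mat n n" and ij: "i < n" "j < n" "k < n"
  shows "(X * rowm n k w) $$ (i, j) = X $$ (i, j) + X $$ (i, k) * w j"
proof -
  have "(X * rowm n k w) $$ (i, j) = dot n (\<lambda>l. X $$ (i, l)) (\<lambda>l. ev j l + w j * ev k l)"
    using X ij by (simp add: rowm_def scalar_prod_def atLeast0LessThan dot_def ev_swap[of j] ev_swap[of k] mult.commute)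
  then show ?thesis using ij by (simp add: dot_add dot_scale mult.commute)
qed

lemma inverse_pair_colm:
  assumes k: "k < n" and u: "u k = 0"
  shows "inverse_pair n (colm n k u) (colm n k (\<lambda>i. - u i))"
proof -
  have *: "colm n k v * colm n k (\<lambda>i. - v i) = 1\<^sub>m n" if "v k = 0" for v
  proof (rule eq_matI)
    fix i j assume "i < dim_row (1\<^sub>m n :: complex mat)" "j < dim_col (1\<^sub>m n :: complex mat)"
    then show "(colm n k v * colm n k (\<lambda>i. - v i)) $$ (i, j) = 1\<^sub>m n $$ (i, j)"
      using k that by (auto simp: colm_mult) (auto simp: colm_def ev_def)
  qed (simp_all add: colm_def)
  show ?thesis using *[of u] *[of "\<lambda>i. - u i"] u by (simp add: inverse_pair_def)
qed

lemma inverse_pair_rowm: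
  assumes k: "k < n" and w: "w k = 0"
  shows "inverse_pair n (rowm n k (\<lambda>i. - w i)) (rowm n k w)"
proof -
  have *: "rowm n k (\<lambda>i. - v i) * rowm n k v = 1\<^sub>m n" if "v k = 0" for v
  proof (rule eq_matI)
    fix i j assume "i < dim_row (1\<^sub>m n :: complex mat)" "j < dim_col (1\<^sub>m n :: complex mat)"
    then show "(rowm n k (\<lambda>i. - v i) * rowm n k v) $$ (i, j) = 1\<^sub>m n $$ (i, j)"
      using k that by (auto simp: mult_rowm) (auto simp: rowm_def ev_def)
  qed (simp_all add: rowm_def)
  show ?thesis using *[of w] *[of "\<lambda>i. - w i"] w by (simp add: inverse_pair_def)
qed

lemma colm_conj_outer:
  assumes k: "k < n" and u: "u k = 0"
  shows "colm n k u * outer n x y * colm n k (\<lambda>i. - u i) =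
    outer n (\<lambda>i. x i + x k * u i) (\<lambda>j. y j - dot n y u * ev k j)"
proof (rule eq_matI)
  fix i j assume "i < dim_row (outer n (\<lambda>i. x i + x k * u i) (\<lambda>j. y j - dot n y u * ev k j))"
    "j < dim_col (outer n (\<lambda>i. x i + x k * u i) (\<lambda>j. y j - dot n y u * ev k j))"
  then have ij: "i < n" "j < n" by auto
  have prod: "colm n k u * outer n x y = outer n (\<lambda>i. x i + x k * u i) y"
    using k by (intro eq_matI) (auto simp: colm_mult algebra_simps, auto simp: colm_def)
  have dt: "dot n (\<lambda>l. outer n (\<lambda>i. x i + x k * u i) y $$ (i, l)) (\<lambda>i. - u i) = - (x i + x k * u i) * dot n y u"
    using ij by (simp add: dot_def sum_distrib_left sum_negf[symmetric] algebra_simps)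
  show "(colm n k u * outer n x y * colm n k (\<lambda>i. - u i)) $$ (i, j) =
      outer n (\<lambda>i. x i + x k * u i) (\<lambda>j. y j - dot n y u * ev k j) $$ (i, j)"
    by (simp only: prod mult_colm[OF outer_carrier ij k] dt outer_index[OF ij]) (simp add: algebra_simps)
qed (simp_all add: colm_def)

lemma rowm_conj_ev:
  assumes k: "k < n" and w: "w k = 0"
  shows "rowm n k (\<lambda>i. - w i) * outer n (ev k) (ev k) * rowm n k w = outer n (ev k) (\<lambda>j. ev k j + w j)"
proof -
  have 1: "rowm n k (\<lambda>i. - w i) * outer n (ev k) (ev k) = outer n (ev k) (ev k)"
  proof (rule eq_matI)
    fix i j assume "i < dim_row (outer n (ev k) (ev k))" "j < dim_col (outer n (ev k) (ev k))"
    then have ij: "i < n" "j < n" by auto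
    have "dot n (\<lambda>i. - w i) (\<lambda>l. outer n (ev k) (ev k) $$ (l, j)) = - (dot n w (ev k) * ev k j)"
      using ij by (simp add: dot_def sum_distrib_right sum_negf mult.assoc)
    then show "(rowm n k (\<lambda>i. - w i) * outer n (ev k) (ev k)) $$ (i, j) = outer n (ev k) (ev k) $$ (i, j)"
      using ij k w by (simp add: rowm_mult)
  qed (simp_all add: rowm_def)
  show ?thesis unfolding 1 using k
    by (intro eq_matI) (auto simp: mult_rowm algebra_simps, auto simp: rowm_def)
qed

lemma colm_pattern:
  "total_preorder n R \<Longrightarrow> (\<And>i. i < n \<Longrightarrow> u i \<noteq> 0 \<Longrightarrow> R i k) \<Longrightarrow> colm n k u \<in> pattern_algebra n R"
  by (auto simp: pattern_algebra_def colm_def ev_def total_preorder_refl)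

lemma rowm_pattern:
  "total_preorder n R \<Longrightarrow> (\<And>i. i < n \<Longrightarrow> w i \<noteq> 0 \<Longrightarrow> R k i) \<Longrightarrow> rowm n k w \<in> pattern_algebra n R"
  by (auto simp: pattern_algebra_def rowm_def ev_def total_preorder_refl)

text \<open>Choose k with x_k y_k nonzero; then u and w are x / x_k and x_k y without their k-th
  coordinates. Nonzero entries x_i y_k and x_k y_i sit at admissible positions, which gives the
  support conditions. The pairing of w and u is 1 - x_k y_k, and this corrects the k-th entry of the
  row vector.\<close>

lemma rank_one_idempotent_conj:
  assumes P: "outer n x y \<in> pattern_algebra n R" and xy: "dot n y x = 1"
  shows "\<exists>k u w. k < n \<and> u k = 0 \<and> w k = 0 \<and> (\<forall>i<n. u i \<noteq> 0 \<longrightarrow> R i k) \<and> (\<forall>i<n. w i \<noteq> 0 \<longrightarrow> R k i) \<and>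
     outer n x y = colm n k u * outer n (ev k) (\<lambda>j. ev k j + w j) * colm n k (\<lambda>i. - u i)"
proof -
  from xy obtain k where k: "k < n" "y k * x k \<noteq> 0"
    unfolding dot_def by (metis (no_types, lifting) lessThan_iff sum.neutral zero_neq_one)
  define u where "u i = (if i = k then 0 else x i / x k)" for i
  define w where "w j = (if j = k then 0 else x k * y j)" for j
  have e: "outer n x y $$ (i, j) = x i * y j" if "i < n" "j < n" for i j using that by simp
  have "R i k" if "i < n" "u i \<noteq> 0" for i
  proof -
    have "outer n x y $$ (i, k) \<noteq> 0" using that k by (auto simp: u_def split: if_splits)
    then show ?thesis using P that(1) k(1) unfolding pattern_algebra_def by blast
  qed
  moreover have "R k i" if "i < n" "w i \<noteq> 0" for i
  proof -
    have "outer n x y $$ (k, i) \<noteq> 0" using that k by (auto simp: w_def split: if_splits)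
    then show ?thesis using P that(1) k(1) unfolding pattern_algebra_def by blast
  qed
  moreover have "outer n x y = colm n k u * outer n (ev k) (\<lambda>j. ev k j + w j) * colm n k (\<lambda>i. - u i)"
  proof -
    have "1 = (\<Sum>i<n. w i * u i + ev k i * (x k * y k))"
      unfolding xy[symmetric] dot_def using k(2)
      by (intro sum.cong) (auto simp: w_def u_def ev_def mult.commute)
    also have "\<dots> = dot n w u + x k * y k"
    proof -
      have "(\<Sum>i<n. ev k i * (x k * y k)) = dot n (ev k) (\<lambda>i. x k * y k)" by (simp add: dot_def)
      then show ?thesis using k(1) by (simp add: sum.distrib dot_def[symmetric])
    qed
    finally have wu: "dot n w u = 1 - x k * y k" by (simp add: algebra_simps)
    have uk: "u k = 0" by (simp add: u_def)
    have wk: "w k = 0" by (simp add: w_def)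
    have du: "dot n (\<lambda>j. ev k j + w j) u = 1 - x k * y k" using k(1) uk by (simp add: dot_add wu)
    show ?thesis
      unfolding colm_conj_outer[where u = u, OF k(1) uk]
    proof (rule outer_eqI)
      fix i j assume "i < n" "j < n"
      have a: "ev k i + ev k k * u i = x i / x k" using k by (auto simp: u_def ev_def)
      have b: "ev k j + w j - dot n (\<lambda>j. ev k j + w j) u * ev k j = x k * y j"
        unfolding du by (cases "j = k") (auto simp: wk, simp add: w_def)
      show "x i * y j = (ev k i + ev k k * u i) * (ev k j + w j - dot n (\<lambda>j. ev k j + w j) u * ev k j)"
        unfolding a b using k by simp
    qed
  qed
  moreover have "u k = 0" "w k = 0" by (auto simp: u_def w_def)
  ultimately show ?thesis using k(1) by blast
qed

text \<open>The elementary matrices of the decomposition lie in the algebra, so every rank-one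
  idempotent of the algebra belongs to a frame \<open>T D S\<close> inside it. All scalar multiples
  are recorded because they later allow a passage to the limit at the nilpotent matrix E_ij.\<close>

lemma preserver_rank_one:
  assumes R: "total_preorder n R" and \<psi>: "preserver n R \<psi>"
    and P: "outer n x y \<in> pattern_algebra n R" and xy: "dot n y x = 1"
  shows "\<exists>p q. dot n q p = 1 \<and> (\<forall>c. \<psi> (c \<cdot>\<^sub>m outer n x y) = c \<cdot>\<^sub>m outer n p q)"
proof -
  obtain k u w where k: "k < n" and uw: "u k = 0" "w k = 0"
    and Ru: "\<And>i. i < n \<Longrightarrow> u i \<noteq> 0 \<Longrightarrow> R i k" and Rw: "\<And>i. i < n \<Longrightarrow> w i \<noteq> 0 \<Longrightarrow> R k i"
    and o: "outer n x y = colm n k u * outer n (ev k) (\<lambda>j. ev k j + w j) * colm n k (\<lambda>i. - u i)"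
    using rank_one_idempotent_conj[OF P xy] by blast
  define T where "T = colm n k u * rowm n k (\<lambda>i. - w i)"
  define S where "S = rowm n k w * colm n k (\<lambda>i. - u i)"
  have p: "inverse_pair n T S"
    unfolding T_def S_def by (intro inverse_pair_mult inverse_pair_colm inverse_pair_rowm k uw)
  note c = inverse_pairD[OF p]
  have T: "T \<in> pattern_algebra n R" "S \<in> pattern_algebra n R"
    unfolding T_def S_def using Ru Rw by (auto intro!: pattern_mult[OF R] colm_pattern[OF R] rowm_pattern[OF R])
  have "T * outer n (ev k) (ev k) * S =
      colm n k u * (rowm n k (\<lambda>i. - w i) * outer n (ev k) (ev k) * rowm n k w) * colm n k (\<lambda>i. - u i)"
    unfolding T_def S_def by (rule assoc_mult_mat5[where n = n]) simp_all
  then have TS: "outer n x y = T * outer n (ev k) (ev k) * S"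
    unfolding o using rowm_conj_ev[where w = w, OF k uw(2)] by simp
  have A: "T * mat_diag n d * S \<in> pattern_algebra n R" for d
    using pattern_sandwich[OF R T(1) pattern_diag[OF R] T(2)] .
  from preserver_frame[OF \<psi> p A] obtain T' S' where p': "inverse_pair n T' S'"
    and T': "\<And>d. \<psi> (T * mat_diag n d * S) = T' * mat_diag n d * S'" by blast
  note c' = inverse_pairD[OF p']
  have sc: "U * mat_diag n (\<lambda>i. a * ev k i) * V = a \<cdot>\<^sub>m outer n (\<lambda>i. U $$ (i, k)) (\<lambda>j. V $$ (k, j))"
    if UV: "U \<in> carrier_mat n n" "V \<in> carrier_mat n n" for a U V
  proof (rule eq_matI)
    fix i j assume "i < dim_row (a \<cdot>\<^sub>m outer n (\<lambda>i. U $$ (i, k)) (\<lambda>j. V $$ (k, j)))"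
      "j < dim_col (a \<cdot>\<^sub>m outer n (\<lambda>i. U $$ (i, k)) (\<lambda>j. V $$ (k, j)))"
    then have ij: "i < n" "j < n" by auto
    have "(U * mat_diag n (\<lambda>i. a * ev k i) * V) $$ (i, j) = a * dot n (ev k) (\<lambda>l. U $$ (i, l) * V $$ (l, j))"
      using conj_diag_index[OF UV ij] by (simp add: dot_def sum_distrib_left mult.assoc)
    then show "(U * mat_diag n (\<lambda>i. a * ev k i) * V) $$ (i, j) =
        (a \<cdot>\<^sub>m outer n (\<lambda>i. U $$ (i, k)) (\<lambda>j. V $$ (k, j))) $$ (i, j)"
      using ij k by simp
  qed (use UV in auto)
  have o2: "outer n x y = outer n (\<lambda>i. T $$ (i, k)) (\<lambda>j. S $$ (k, j))"
  proof -
    have "T * mat_diag n (\<lambda>i. 1 * ev k i) * S = 1 \<cdot>\<^sub>m outer n (\<lambda>i. T $$ (i, k)) (\<lambda>j. S $$ (k, j))"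
      by (rule sc[OF c(1,2)])
    then show ?thesis unfolding TS diag_ev[symmetric] by simp
  qed
  have "\<psi> (a \<cdot>\<^sub>m outer n x y) = a \<cdot>\<^sub>m outer n (\<lambda>i. T' $$ (i, k)) (\<lambda>j. S' $$ (k, j))" for a
    unfolding o2 sc[OF c(1,2), symmetric] T' by (rule sc[OF c'(1,2)])
  moreover have "dot n (\<lambda>j. S' $$ (k, j)) (\<lambda>i. T' $$ (i, k)) = 1"
  proof -
    have "(S' * T') $$ (k, k) = dot n (\<lambda>j. S' $$ (k, j)) (\<lambda>i. T' $$ (i, k))"
      using c'(1,2) k by (simp add: scalar_prod_def atLeast0LessThan dot_def)
    then show ?thesis using c'(4) k by simp
  qed
  ultimately show ?thesis by blast
qed

lemma preserver_rank_one':
  assumes R: "total_preorder n R" and \<psi>: "preserver n R \<psi>"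
    and P: "outer n x y \<in> pattern_algebra n R" and xy: "dot n y x = 1"
  obtains p q where "dot n q p = 1" "\<psi> (outer n x y) = outer n p q"
proof -
  obtain p q where "dot n q p = 1" "\<And>c. \<psi> (c \<cdot>\<^sub>m outer n x y) = c \<cdot>\<^sub>m outer n p q"
    using preserver_rank_one[OF R \<psi> P xy] by blast
  moreover from this(2)[of 1] have "\<psi> (outer n x y) = outer n p q" by simp
  ultimately show ?thesis using that by blast
qed

text \<open>Orthogonality of rank-one idempotents amounts to commutation together with distinctness;
  the former is preserved by assumption, the latter by injectivity.\<close>

lemma preserver_orthogonal:
  assumes \<psi>: "preserver n R \<psi>"
    and P: "outer n x y \<in> pattern_algebra n R" "dot n y x = 1" "\<psi> (outer n x y) = outer n p q" "dot n q p = 1"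
    and Q: "outer n x' y' \<in> pattern_algebra n R" "dot n y' x' = 1" "\<psi> (outer n x' y') = outer n p' q'" "dot n q' p' = 1"
    and orth: "dot n y x' = 0" "dot n y' x = 0"
  shows "dot n q p' = 0" "dot n q' p = 0"
proof -
  note \<psi>' = preserverD[OF \<psi>]
  have comm: "outer n x y * outer n x' y' = outer n x' y' * outer n x y"
    unfolding outer_mult orth by (intro eq_matI) auto
  have c: "outer n p q * outer n p' q' = outer n p' q' * outer n p q"
    using \<psi>'(3)[OF P(1) Q(1) comm] P(3) Q(3) by simp
  have "outer n x y \<noteq> outer n x' y'"
  proof
    assume e: "outer n x y = outer n x' y'"
    have "outer n x y * outer n x y = 0 \<cdot>\<^sub>m outer n x y'"
      using outer_mult[of n x y x' y'] orth e by simp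
    then have dz: "dot n y x \<cdot>\<^sub>m outer n x y = 0 \<cdot>\<^sub>m outer n x y'" by (simp add: outer_mult)
    have z: "x i * y j = 0" if "i < n" "j < n" for i j
    proof -
      have "(dot n y x \<cdot>\<^sub>m outer n x y) $$ (i, j) = (0 \<cdot>\<^sub>m outer n x y') $$ (i, j)"
        using dz by simp
      then show ?thesis using that P(2) by simp
    qed
    have "dot n y x = 0" unfolding dot_def by (rule sum.neutral) (use z in \<open>auto simp: mult.commute\<close>)
    with P(2) show False by simp
  qed
  then have ne: "outer n p q \<noteq> outer n p' q'" using \<psi>'(2) P(1,3) Q(1,3) by (metis inj_onD)
  show "dot n q p' = 0" using outer_commute_imp[OF P(4) Q(4) c ne] .
  show "dot n q' p = 0" using outer_commute_imp[OF Q(4) P(4) c[symmetric] ne[symmetric]] .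
qed

text \<open>A frame is linear in \<open>d\<close>, hence determined by its n rank-one
  idempotents.\<close>

lemma frame_fixed:
  assumes \<psi>: "preserver n R \<psi>" and p: "inverse_pair n T S"
    and A: "\<And>d. T * mat_diag n d * S \<in> pattern_algebra n R"
    and fixed: "\<And>k. k < n \<Longrightarrow> \<psi> (T * outer n (ev k) (ev k) * S) = T * outer n (ev k) (ev k) * S"
  shows "\<psi> (T * mat_diag n d * S) = T * mat_diag n d * S"
proof -
  from preserver_frame[OF \<psi> p A] obtain T' S' where p': "inverse_pair n T' S'"
    and T': "\<And>d. \<psi> (T * mat_diag n d * S) = T' * mat_diag n d * S'" by blast
  note c = inverse_pairD[OF p] and c' = inverse_pairD[OF p']
  have eq: "T' $$ (i, k) * S' $$ (k, j) = T $$ (i, k) * S $$ (k, j)" if "i < n" "j < n" "k < n" for i j k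
  proof -
    have "T' * mat_diag n (ev k) * S' = T * mat_diag n (ev k) * S"
      using T'[of "ev k"] fixed[OF that(3)] by (simp add: diag_ev)
    then have "(\<Sum>l<n. ev k l * (T' $$ (i, l) * S' $$ (l, j))) = (\<Sum>l<n. ev k l * (T $$ (i, l) * S $$ (l, j)))"
      using conj_diag_index[OF c(1,2) that(1,2), of "ev k"] conj_diag_index[OF c'(1,2) that(1,2), of "ev k"] by simp
    then show ?thesis using dot_ev(1)[OF that(3)] unfolding dot_def by simp
  qed
  have "T' * mat_diag n d * S' = T * mat_diag n d * S"
  proof (rule eq_matI)
    fix i j assume "i < dim_row (T * mat_diag n d * S)" "j < dim_col (T * mat_diag n d * S)"
    then have ij: "i < n" "j < n" using c by auto
    show "(T' * mat_diag n d * S') $$ (i, j) = (T * mat_diag n d * S) $$ (i, j)"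
      unfolding conj_diag_index[OF c(1,2) ij] conj_diag_index[OF c'(1,2) ij] using eq[OF ij] by simp
  qed (use c c' in auto)
  then show ?thesis using T' by simp
qed

section \<open>Elementary idempotents\<close>

lemma dot_diff: "dot n (\<lambda>k. x k - y k) z = dot n x z - dot n y z" "dot n z (\<lambda>k. x k - y k) = dot n z x - dot n z y"
  by (simp_all add: dot_def left_diff_distrib right_diff_distrib sum_subtractf)

lemma dot_support2:
  assumes "i < n" "j < n" "i \<noteq> j" "\<And>k. k < n \<Longrightarrow> k \<noteq> i \<Longrightarrow> k \<noteq> j \<Longrightarrow> x k * y k = 0"
  shows "dot n x y = x i * y i + x j * y j"
proof -
  have "(\<Sum>k<n. x k * y k) = (\<Sum>k\<in>{i, j}. x k * y k)"
    by (rule sum.mono_neutral_right) (use assms in auto)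
  then show ?thesis using assms(3) by (simp add: dot_def)
qed

lemma dot_support1:
  assumes "j < n" "\<And>k. k < n \<Longrightarrow> k \<noteq> j \<Longrightarrow> x k * y k = 0"
  shows "dot n x y = x j * y j"
proof -
  have "(\<Sum>k<n. x k * y k) = (\<Sum>k\<in>{j}. x k * y k)"
    by (rule sum.mono_neutral_right) (use assms in auto)
  then show ?thesis by (simp add: dot_def)
qed

definition row_idem :: "nat \<Rightarrow> nat \<Rightarrow> (nat \<Rightarrow> complex) \<Rightarrow> complex mat" where
  "row_idem n i w = outer n (ev i) (\<lambda>k. ev i k + w k)"

definition col_idem :: "nat \<Rightarrow> nat \<Rightarrow> (nat \<Rightarrow> complex) \<Rightarrow> complex mat" where
  "col_idem n j u = outer n (\<lambda>k. ev j k + u k) (ev j)"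

lemma row_idem_cong: "(\<And>k. k < n \<Longrightarrow> w k = w' k) \<Longrightarrow> row_idem n i w = row_idem n i w'"
  unfolding row_idem_def by (rule outer_eqI) simp

lemma col_idem_cong: "(\<And>k. k < n \<Longrightarrow> w k = w' k) \<Longrightarrow> col_idem n i w = col_idem n i w'"
  unfolding col_idem_def by (rule outer_eqI) simp

section \<open>Images of elementary idempotents and their types\<close>

locale diag_preserver =
  fixes n :: nat and R :: "nat \<Rightarrow> nat \<Rightarrow> bool" and \<psi> :: "complex mat \<Rightarrow> complex mat"
  assumes n3: "3 \<le> n" and R: "total_preorder n R"
    and le: "\<And>i j. i < n \<Longrightarrow> j < n \<Longrightarrow> i \<le> j \<Longrightarrow> R i j"
    and \<psi>: "preserver n R \<psi>"
    and diag: "\<And>d. \<psi> (mat_diag n d) = mat_diag n d"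
begin

abbreviation A where "A \<equiv> pattern_algebra n R"

lemmas trans = total_preorder_trans[OF R]

lemma ex_third: "\<exists>k<n. k \<noteq> i \<and> k \<noteq> j"
  using n3 by presburger

lemma inj: "X \<in> A \<Longrightarrow> Y \<in> A \<Longrightarrow> \<psi> X = \<psi> Y \<Longrightarrow> X = Y"
  using preserverD(2)[OF \<psi>] by (meson inj_onD)

lemma row_idem_in: "i < n \<Longrightarrow> (\<And>j. j < n \<Longrightarrow> w j \<noteq> 0 \<Longrightarrow> R i j) \<Longrightarrow> row_idem n i w \<in> A"
  using total_preorder_refl[OF R] by (auto simp: pattern_algebra_def row_idem_def ev_def split: if_splits)

lemma col_idem_in: "j < n \<Longrightarrow> (\<And>i. i < n \<Longrightarrow> u i \<noteq> 0 \<Longrightarrow> R i j) \<Longrightarrow> col_idem n j u \<in> A"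
  using total_preorder_refl[OF R] by (auto simp: pattern_algebra_def col_idem_def ev_def split: if_splits)

lemma ev_in: "outer n (ev i) (ev i) \<in> A"
  using pattern_diag[OF R, of "ev i"] by (simp add: diag_ev)

lemma \<psi>_ev: "\<psi> (outer n (ev i) (ev i)) = outer n (ev i) (ev i)"
  using diag[of "ev i"] by (simp add: diag_ev)

text \<open>A k-th coordinate vanishing in both factors means orthogonality to the fixed idempotent
  E_kk.\<close>

lemma support:
  assumes "outer n x y \<in> A" "dot n y x = 1" "\<psi> (outer n x y) = outer n p q" "dot n q p = 1"
    and "k < n" "x k = 0" "y k = 0"
  shows "p k = 0" "q k = 0"
  using preserver_orthogonal[OF \<psi> assms(1-4) ev_in _ \<psi>_ev, of k] assms(5-7) by simp_all

text \<open>These are E_ii + t E_ij and E_jj + t E_ij. The second family serves as a probe: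
  \<open>E i j t\<close> and \<open>F i j (- t)\<close> are orthogonal.\<close>

definition E where "E i j t = row_idem n i (\<lambda>k. t * ev j k)"
definition F where "F i j t = col_idem n j (\<lambda>k. t * ev i k)"

lemma E_in: "i < n \<Longrightarrow> j < n \<Longrightarrow> R i j \<Longrightarrow> E i j t \<in> A"
  unfolding E_def by (rule row_idem_in) (auto simp: ev_def split: if_splits)

lemma F_in: "i < n \<Longrightarrow> j < n \<Longrightarrow> R i j \<Longrightarrow> F i j t \<in> A"
  unfolding F_def by (rule col_idem_in) (auto simp: ev_def split: if_splits)

lemma E_index: "i < n \<Longrightarrow> j < n \<Longrightarrow> i \<noteq> j \<Longrightarrow> E i j t $$ (i, j) = t"
  by (simp add: E_def row_idem_def)

lemma E_zero: "E i j 0 = outer n (ev i) (ev i)" "F i j 0 = outer n (ev j) (ev j)"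
  by (simp_all add: E_def F_def row_idem_def col_idem_def)

lemma image_eq_ev:
  assumes ij: "i < n" "j < n" "i \<noteq> j" and supp: "\<And>k. k < n \<Longrightarrow> k \<noteq> i \<Longrightarrow> k \<noteq> j \<Longrightarrow> p k = 0 \<and> q k = 0"
    and "p i * q i + p j * q j = 1" "p j = 0" "q j = 0"
  shows "outer n p q = outer n (ev i) (ev i)"
proof (rule outer_eqI)
  fix a b assume "a < n" "b < n"
  then show "p a * q b = ev i a * ev i b"
    using supp[of a] supp[of b] assms(5-7) by (cases "a = i"; cases "b = i"; cases "a = j"; cases "b = j") auto
qed

text \<open>Orthogonality to the remaining E_kk confines the image to the indices i and j. If both
  of its j-th coordinates vanished, it would be E_ii, the image of \<open>E i j 0\<close>, against
  injectivity.\<close>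

lemma E_image:
  assumes ij: "i < n" "j < n" "i \<noteq> j" "R i j"
  obtains p q where "\<psi> (E i j t) = outer n p q" "dot n q p = 1"
    "\<And>k. k < n \<Longrightarrow> k \<noteq> i \<Longrightarrow> k \<noteq> j \<Longrightarrow> p k = 0 \<and> q k = 0"
    "p i * q i + p j * q j = 1" "t \<noteq> 0 \<Longrightarrow> \<not> (p j = 0 \<and> q j = 0)"
proof -
  let ?y = "\<lambda>k. ev i k + t * ev j k"
  have e: "E i j t = outer n (ev i) ?y" by (simp add: E_def row_idem_def)
  have in_A: "outer n (ev i) ?y \<in> A" and d: "dot n ?y (ev i) = 1"
    using E_in[OF ij(1,2,4), of t] e ij by simp_all
  obtain p q where pq: "dot n q p = 1" "\<psi> (outer n (ev i) ?y) = outer n p q"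
    using preserver_rank_one'[OF R \<psi> in_A d] by blast
  have s: "p k = 0 \<and> q k = 0" if "k < n" "k \<noteq> i" "k \<noteq> j" for k
    using support[OF in_A d pq(2,1) that(1)] that by simp
  have one: "p i * q i + p j * q j = 1"
    using dot_support2[OF ij(1-3), of q p] s pq(1) by (simp add: mult.commute)
  have "\<not> (p j = 0 \<and> q j = 0)" if "t \<noteq> 0"
  proof
    assume "p j = 0 \<and> q j = 0"
    with image_eq_ev[OF ij(1-3) s one] have "\<psi> (E i j t) = \<psi> (E i j 0)"
      using pq(2) e by (simp add: E_zero \<psi>_ev)
    then have "E i j t = E i j 0" using inj E_in[OF ij(1,2,4)] by blast
    then show False using E_index[OF ij(1-3)] that by metis
  qed
  then show ?thesis using that[of p q] pq s one e by simp
qed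

lemma F_image:
  assumes ij: "i < n" "j < n" "i \<noteq> j" "R i j"
  obtains p q where "\<psi> (F i j t) = outer n p q" "dot n q p = 1"
    "\<And>k. k < n \<Longrightarrow> k \<noteq> i \<Longrightarrow> k \<noteq> j \<Longrightarrow> p k = 0 \<and> q k = 0"
    "p i * q i + p j * q j = 1" "t \<noteq> 0 \<Longrightarrow> \<not> (p i = 0 \<and> q i = 0)"
proof -
  let ?x = "\<lambda>k. ev j k + t * ev i k"
  have e: "F i j t = outer n ?x (ev j)" by (simp add: F_def col_idem_def)
  have in_A: "outer n ?x (ev j) \<in> A" and d: "dot n (ev j) ?x = 1"
    using F_in[OF ij(1,2,4), of t] e ij by simp_all
  obtain p q where pq: "dot n q p = 1" "\<psi> (outer n ?x (ev j)) = outer n p q"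
    using preserver_rank_one'[OF R \<psi> in_A d] by blast
  have s: "p k = 0 \<and> q k = 0" if "k < n" "k \<noteq> i" "k \<noteq> j" for k
    using support[OF in_A d pq(2,1) that(1)] that by simp
  have one: "p i * q i + p j * q j = 1"
    using dot_support2[OF ij(1-3), of q p] s pq(1) by (simp add: mult.commute)
  have "\<not> (p i = 0 \<and> q i = 0)" if "t \<noteq> 0"
  proof
    assume "p i = 0 \<and> q i = 0"
    with image_eq_ev[OF ij(2,1) ij(3)[symmetric], of p q] s one have "\<psi> (F i j t) = \<psi> (F i j 0)"
      using pq(2) e by (simp add: E_zero \<psi>_ev)
    then have "F i j t = F i j 0" using inj F_in[OF ij(1,2,4)] by blast
    moreover have "F i j t $$ (i, j) = t" for t using ij by (simp add: F_def col_idem_def)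
    ultimately show False using that by metis
  qed
  then show ?thesis using that[of p q] pq s one e by simp
qed

lemma E_F_orthogonal:
  assumes ij: "i < n" "j < n" "i \<noteq> j" "R i j"
    and E: "\<psi> (E i j t) = outer n p q" "dot n q p = 1" and F: "\<psi> (F i j (- t)) = outer n p' q'" "dot n q' p' = 1"
  shows "dot n q p' = 0" "dot n q' p = 0"
proof -
  have "dot n (\<lambda>k. ev i k + t * ev j k) (\<lambda>k. ev j k + - t * ev i k) = 0"
    using ij by (simp add: dot_add dot_diff dot_scale)
  moreover have "dot n (ev j) (ev i) = 0" using ij by simp
  ultimately show "dot n q p' = 0" "dot n q' p = 0"
    using preserver_orthogonal[OF \<psi>, of "ev i" "\<lambda>k. ev i k + t * ev j k" p q "\<lambda>k. ev j k + - t * ev i k" "ev j" p' q']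
      E_in[OF ij(1,2,4), of t] F_in[OF ij(1,2,4), of "- t"] E F ij
    by (simp_all add: E_def F_def row_idem_def col_idem_def)
qed

text \<open>\<open>row_type\<close> and \<open>col_type\<close> say that \<open>\<psi>\<close> looks like \<open>X \<mapsto> T X T\<^sup>-\<^sup>1\<close>, respectively
  like \<open>X \<mapsto> T X\<^sup>t T\<^sup>-\<^sup>1\<close>, on the idempotent \<open>E i j t\<close>.\<close>

definition row_type where "row_type i j t \<longleftrightarrow> (\<forall>k<n. \<psi> (E i j t) $$ (j, k) = 0)"
definition col_type where "col_type i j t \<longleftrightarrow> (\<forall>k<n. \<psi> (E i j t) $$ (k, j) = 0)"

lemma type_iff:
  assumes "i < n" "j < n" "\<psi> (E i j t) = outer n p q" "p i * q i + p j * q j = 1"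
  shows "row_type i j t \<longleftrightarrow> p j = 0" "col_type i j t \<longleftrightarrow> q j = 0"
proof -
  have e: "\<psi> (E i j t) $$ (j, k) = p j * q k" "\<psi> (E i j t) $$ (k, j) = p k * q j" if "k < n" for k
    using assms that by simp_all
  show "row_type i j t \<longleftrightarrow> p j = 0"
  proof
    assume "row_type i j t"
    then have "p j * q i = 0" "p j * q j = 0" using e(1) assms(1,2) unfolding row_type_def by metis+
    then show "p j = 0" using assms(4) by auto
  qed (simp add: row_type_def e)
  show "col_type i j t \<longleftrightarrow> q j = 0"
  proof
    assume "col_type i j t"
    then have "p i * q j = 0" "p j * q j = 0" using e(2) assms(1,2) unfolding col_type_def by metis+
    then show "q j = 0" using assms(4) by auto
  qed (simp add: col_type_def e)
qed

text \<open>For t = 0 both types hold at once, so positions are compared through exclusive types;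
  \<open>True\<close> stands for row.\<close>

definition typed where
  "typed b i j t \<longleftrightarrow> (if b then row_type i j t \<and> \<not> col_type i j t else col_type i j t \<and> \<not> row_type i j t)"

lemma typed_unique: "typed b i j t \<Longrightarrow> typed b' i j t \<Longrightarrow> b = b'"
  by (auto simp: typed_def split: if_splits)

text \<open>The two idempotents are orthogonal and the supports of their images meet at most in j,
  which leaves q_j p'_j = 0 = q'_j p_j. As neither image loses both of its j-th coordinates, both
  lose the same one.\<close>

lemma column_partner:
  assumes "i < n" "j < n" "k < n" "i \<noteq> j" "k \<noteq> j" "i \<noteq> k" "R i j" "R k j" "t \<noteq> 0" "s \<noteq> 0"
  shows "\<exists>b. typed b i j t \<and> typed b k j s"
proof -
  obtain p q where pq: "\<psi> (E i j t) = outer n p q" "dot n q p = 1"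
    "\<And>k. k < n \<Longrightarrow> k \<noteq> i \<Longrightarrow> k \<noteq> j \<Longrightarrow> p k = 0 \<and> q k = 0"
    "p i * q i + p j * q j = 1" "\<not> (p j = 0 \<and> q j = 0)"
    using E_image[of i j t] assms by metis
  obtain p' q' where pq': "\<psi> (E k j s) = outer n p' q'" "dot n q' p' = 1"
    "\<And>l. l < n \<Longrightarrow> l \<noteq> k \<Longrightarrow> l \<noteq> j \<Longrightarrow> p' l = 0 \<and> q' l = 0"
    "p' k * q' k + p' j * q' j = 1" "\<not> (p' j = 0 \<and> q' j = 0)"
    using E_image[of k j s] assms by metis
  have "dot n q p' = 0" "dot n q' p = 0"
    using preserver_orthogonal[OF \<psi>, of "ev i" "\<lambda>k. ev i k + t * ev j k" p q "ev k" "\<lambda>l. ev k l + s * ev j l" p' q']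
      E_in[of i j t] E_in[of k j s] pq(1,2) pq'(1,2) assms
    by (simp_all add: E_def row_idem_def)
  moreover have "q l * p' l = 0" "q' l * p l = 0" if "l < n" "l \<noteq> j" for l
    using pq(3)[of l] pq'(3)[of l] that assms(6) by (cases "l = i"; auto)+
  then have "dot n q p' = q j * p' j" "dot n q' p = q' j * p j"
    using dot_support1[OF assms(2)] by blast+
  ultimately have "(p j = 0 \<and> p' j = 0 \<and> q j \<noteq> 0 \<and> q' j \<noteq> 0) \<or> (q j = 0 \<and> q' j = 0 \<and> p j \<noteq> 0 \<and> p' j \<noteq> 0)"
    using pq(5) pq'(5) by auto
  then show ?thesis
    using type_iff[OF assms(1,2) pq(1,4)] type_iff[OF assms(3,2) pq'(1,4)] unfolding typed_def by metis
qed

text \<open>\<open>E i j t\<close> and \<open>E i k s\<close> share their column vector and are not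
  orthogonal. Their probes \<open>F i j (- t)\<close> and \<open>F i k (- s)\<close> are, with
  supports of the images meeting at most in i; orthogonality of each idempotent to its own probe
  carries the conclusion back.\<close>

lemma row_partner:
  assumes "i < n" "j < n" "k < n" "i \<noteq> j" "i \<noteq> k" "j \<noteq> k" "R i j" "R i k" "t \<noteq> 0" "s \<noteq> 0"
  shows "\<exists>b. typed b i j t \<and> typed b i k s"
proof -
  obtain p q where pq: "\<psi> (E i j t) = outer n p q" "dot n q p = 1"
    "\<And>k. k < n \<Longrightarrow> k \<noteq> i \<Longrightarrow> k \<noteq> j \<Longrightarrow> p k = 0 \<and> q k = 0"
    "p i * q i + p j * q j = 1" "\<not> (p j = 0 \<and> q j = 0)"
    using E_image[of i j t] assms by metis
  obtain p' q' where pq': "\<psi> (E i k s) = outer n p' q'" "dot n q' p' = 1"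
    "\<And>l. l < n \<Longrightarrow> l \<noteq> i \<Longrightarrow> l \<noteq> k \<Longrightarrow> p' l = 0 \<and> q' l = 0"
    "p' i * q' i + p' k * q' k = 1" "\<not> (p' k = 0 \<and> q' k = 0)"
    using E_image[of i k s] assms by metis
  have m: "- t \<noteq> 0" "- s \<noteq> 0" using assms by auto
  obtain u v where uv: "\<psi> (F i j (- t)) = outer n u v" "dot n v u = 1"
    "\<And>k. k < n \<Longrightarrow> k \<noteq> i \<Longrightarrow> k \<noteq> j \<Longrightarrow> u k = 0 \<and> v k = 0"
    "u i * v i + u j * v j = 1" "\<not> (u i = 0 \<and> v i = 0)"
    using F_image[of i j "- t"] m(1) assms(1,2,4,7) by metis
  obtain u' v' where uv': "\<psi> (F i k (- s)) = outer n u' v'" "dot n v' u' = 1"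
    "\<And>l. l < n \<Longrightarrow> l \<noteq> i \<Longrightarrow> l \<noteq> k \<Longrightarrow> u' l = 0 \<and> v' l = 0"
    "u' i * v' i + u' k * v' k = 1" "\<not> (u' i = 0 \<and> v' i = 0)"
    using F_image[of i k "- s"] m(2) assms(1,3,5,8) by metis
  have "dot n v u' = 0" "dot n v' u = 0"
    using preserver_orthogonal[OF \<psi>, of "\<lambda>l. ev j l + - t * ev i l" "ev j" u v "\<lambda>l. ev k l + - s * ev i l" "ev k" u' v']
      F_in[of i j "- t"] F_in[of i k "- s"] uv(1,2) uv'(1,2) assms
    by (simp_all add: F_def col_idem_def)
  moreover have "v l * u' l = 0" "v' l * u l = 0" if "l < n" "l \<noteq> i" for l
    using uv(3)[of l] uv'(3)[of l] that assms(6) by (cases "l = j"; auto)+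
  then have "dot n v u' = v i * u' i" "dot n v' u = v' i * u i"
    using dot_support1[OF assms(1)] by blast+
  ultimately have c: "(u i = 0 \<and> u' i = 0 \<and> v i \<noteq> 0 \<and> v' i \<noteq> 0) \<or> (v i = 0 \<and> v' i = 0 \<and> u i \<noteq> 0 \<and> u' i \<noteq> 0)"
    using uv(5) uv'(5) by auto
  have o: "q i * u i + q j * u j = 0" "v i * p i + v j * p j = 0"
    using E_F_orthogonal[OF assms(1,2,4,7) pq(1,2) uv(1,2)] dot_support2[OF assms(1,2,4)] uv(3) by simp_all
  have o': "q' i * u' i + q' k * u' k = 0" "v' i * p' i + v' k * p' k = 0"
    using E_F_orthogonal[OF assms(1,3,5,8) pq'(1,2) uv'(1,2)] dot_support2[OF assms(1,3,5)] uv'(3) by simp_all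
  have "(p j = 0 \<and> p' k = 0 \<and> q j \<noteq> 0 \<and> q' k \<noteq> 0) \<or> (q j = 0 \<and> q' k = 0 \<and> p j \<noteq> 0 \<and> p' k \<noteq> 0)"
    using c
  proof
    assume z: "u i = 0 \<and> u' i = 0 \<and> v i \<noteq> 0 \<and> v' i \<noteq> 0"
    then have "u j \<noteq> 0" "u' k \<noteq> 0" using uv(4) uv'(4) by auto
    then show ?thesis using o(1) o'(1) z pq(5) pq'(5) by simp
  next
    assume z: "v i = 0 \<and> v' i = 0 \<and> u i \<noteq> 0 \<and> u' i \<noteq> 0"
    then have "v j \<noteq> 0" "v' k \<noteq> 0" using uv(4) uv'(4) by auto
    then show ?thesis using o(2) o'(2) z pq(5) pq'(5) by simp
  qed
  then show ?thesis
    using type_iff[OF assms(1,2) pq(1,4)] type_iff[OF assms(1,3) pq'(1,4)] unfolding typed_def by metis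
qed

text \<open>The position (0, n-1) is the anchor: index 0 precedes every index and n-1 follows every
  index, so row and column moves from it stay among admissible positions.\<close>

lemma uniform_type:
  "\<exists>b. \<forall>i<n. \<forall>j<n. \<forall>t. i \<noteq> j \<longrightarrow> R i j \<longrightarrow> t \<noteq> 0 \<longrightarrow> typed b i j t"
proof -
  let ?l = "n - 1"
  have l: "0 < n" "1 < n" "?l < n" "?l \<noteq> 0" "?l \<noteq> 1" using n3 by auto
  have R0: "R 0 j" if "j < n" for j using le[OF l(1) that] by simp
  have R1: "R 1 ?l" using le[OF l(2,3)] l by simp
  have col: "typed b k j s"
    if "typed b i j t" "i < n" "j < n" "k < n" "i \<noteq> j" "k \<noteq> j" "i \<noteq> k" "R i j" "R k j" "t \<noteq> 0" "s \<noteq> 0"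
    for b i j k t s using column_partner[OF that(2-)] typed_unique[OF that(1)] by blast
  have row: "typed b i k s"
    if "typed b i j t" "i < n" "j < n" "k < n" "i \<noteq> j" "i \<noteq> k" "j \<noteq> k" "R i j" "R i k" "t \<noteq> 0" "s \<noteq> 0"
    for b i j k t s using row_partner[OF that(2-)] typed_unique[OF that(1)] by blast
  obtain b where b: "typed b 0 ?l 1" "typed b 1 ?l 1"
    using column_partner[of 0 ?l 1 1 1] l R0 R1 by auto
  have 1: "typed b 0 ?l t" if "t \<noteq> 0" for t
    by (rule col[OF b(2)]) (use l R0 R1 that in auto)
  have 2: "typed b 0 j t" if "j < n" "j \<noteq> 0" "t \<noteq> 0" for j t
  proof (cases "j = ?l")
    case True
    then show ?thesis using 1 that by simp
  next
    case False
    then show ?thesis by (intro row[OF 1[of 1]]) (use l R0 that in auto)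
  qed
  have 3: "typed b i j t" if "i < n" "j < n" "i \<noteq> j" "j \<noteq> 0" "R i j" "t \<noteq> 0" for i j t
  proof (cases "i = 0")
    case True
    then show ?thesis using 2 that by simp
  next
    case False
    then show ?thesis by (intro col[OF 2[of j 1]]) (use l R0 that in auto)
  qed
  \<comment> \<open>Column 0 comes last because \<open>R i 0\<close> is not automatic. It is reached
    along row i from another column k, admissible by transitivity through 0.\<close>
  have 4: "typed b i 0 t" if "i < n" "i \<noteq> 0" "R i 0" "t \<noteq> 0" for i t
  proof -
    obtain k where k: "k < n" "k \<noteq> 0" "k \<noteq> i" using ex_third by blast
    have "R i k" using trans[OF that(3) R0[OF k(1)] that(1) l(1) k(1)] .
    then show ?thesis by (intro row[OF 3[of i k 1]]) (use l k that in auto)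
  qed
  show ?thesis using 3 4 by metis
qed

lemma row_or_col_type:
  "(\<forall>i<n. \<forall>j<n. \<forall>t. i \<noteq> j \<longrightarrow> R i j \<longrightarrow> row_type i j t) \<or>
   (\<forall>i<n. \<forall>j<n. \<forall>t. i \<noteq> j \<longrightarrow> R i j \<longrightarrow> col_type i j t)"
proof -
  obtain b where b: "\<And>i j t. i < n \<Longrightarrow> j < n \<Longrightarrow> i \<noteq> j \<Longrightarrow> R i j \<Longrightarrow> t \<noteq> 0 \<Longrightarrow> typed b i j t"
    using uniform_type by blast
  have "row_type i j 0" "col_type i j 0" if "i < n" "j < n" "i \<noteq> j" for i j
    using that by (auto simp: row_type_def col_type_def E_zero \<psi>_ev)
  then show ?thesis using b by (cases b) (simp_all add: typed_def, metis+)
qed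

end

section \<open>The scalar functions of the row case\<close>

locale row_preserver = diag_preserver +
  assumes row_type: "\<And>i j t. i < n \<Longrightarrow> j < n \<Longrightarrow> i \<noteq> j \<Longrightarrow> R i j \<Longrightarrow> row_type i j t"
begin

definition g where "g i j t = \<psi> (E i j t) $$ (i, j)"

lemma \<psi>_E:
  assumes ij: "i < n" "j < n" "i \<noteq> j" "R i j"
  shows "\<psi> (E i j t) = E i j (g i j t)"
proof -
  obtain p q where pq: "\<psi> (E i j t) = outer n p q" "dot n q p = 1"
    "\<And>k. k < n \<Longrightarrow> k \<noteq> i \<Longrightarrow> k \<noteq> j \<Longrightarrow> p k = 0 \<and> q k = 0" "p i * q i + p j * q j = 1"
    using E_image[of i j t] ij by metis
  have pj: "p j = 0" using type_iff(1)[OF ij(1,2) pq(1,4)] row_type[OF ij] by simp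
  have g: "g i j t = p i * q j" using pq(1) ij by (simp add: g_def)
  have "outer n p q = outer n (ev i) (\<lambda>k. ev i k + g i j t * ev j k)"
  proof (rule outer_eqI)
    fix a b assume ab: "a < n" "b < n"
    show "p a * q b = ev i a * (ev i b + g i j t * ev j b)"
      using pq(3)[OF ab(1)] pq(3)[OF ab(2)] pq(4) pj g ij(3)
      by (cases "a = i"; cases "a = j"; cases "b = i"; cases "b = j") auto
  qed
  then show ?thesis using pq(1) by (simp add: E_def row_idem_def)
qed

lemma g_zero: "i < n \<Longrightarrow> j < n \<Longrightarrow> i \<noteq> j \<Longrightarrow> g i j 0 = 0"
  by (simp add: g_def E_zero \<psi>_ev)

lemma g_nonzero:
  assumes ij: "i < n" "j < n" "i \<noteq> j" "R i j" and t: "t \<noteq> 0"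
  shows "g i j t \<noteq> 0"
proof
  assume "g i j t = 0"
  then have "\<psi> (E i j t) = \<psi> (E i j 0)" using \<psi>_E[OF ij] g_zero ij by simp
  then have "E i j t = E i j 0" using inj E_in[OF ij(1,2,4)] by blast
  then show False using E_index[OF ij(1-3)] t by metis
qed

text \<open>\<open>E i j (- t)\<close> is orthogonal to \<open>F i j t\<close>, and its known image
  determines that of the latter.\<close>

lemma \<psi>_F:
  assumes ij: "i < n" "j < n" "i \<noteq> j" "R i j"
  shows "\<psi> (F i j t) = F i j (- g i j (- t))"
proof -
  obtain u v where uv: "\<psi> (F i j t) = outer n u v" "dot n v u = 1"
    "\<And>k. k < n \<Longrightarrow> k \<noteq> i \<Longrightarrow> k \<noteq> j \<Longrightarrow> u k = 0 \<and> v k = 0" "u i * v i + u j * v j = 1"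
    using F_image[of i j t] ij by metis
  let ?q = "\<lambda>k. ev i k + g i j (- t) * ev j k"
  have e: "\<psi> (E i j (- t)) = outer n (ev i) ?q"
    using \<psi>_E[OF ij, of "- t"] unfolding E_def row_idem_def .
  have d: "dot n ?q (ev i) = 1" using ij by simp
  have o: "dot n ?q u = 0" "dot n v (ev i) = 0"
    using E_F_orthogonal[OF ij e d, of u v] uv(1,2) by simp_all
  then have vi: "v i = 0" and ui: "u i = - g i j (- t) * u j"
    using ij by (simp_all add: dot_add dot_diff dot_scale eq_neg_iff_add_eq_0)
  have "outer n u v = outer n (\<lambda>k. ev j k + - g i j (- t) * ev i k) (ev j)"
  proof (rule outer_eqI)
    fix a b assume ab: "a < n" "b < n"
    show "u a * v b = (ev j a + - g i j (- t) * ev i a) * ev j b"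
      using uv(3)[OF ab(1)] uv(3)[OF ab(2)] uv(4) vi ui ij(3)
      by (cases "a = i"; cases "a = j"; cases "b = i"; cases "b = j") (auto simp: algebra_simps)
  qed
  then show ?thesis using uv(1) by (simp add: F_def col_idem_def)
qed

text \<open>For each admissible j the idempotent \<open>F i j (- w j)\<close> is orthogonal to this
  one, so its image pins down the j-th entry independently of the others; at the remaining j the
  entry is zero by \<open>support\<close>.\<close>

lemma \<psi>_row_idem:
  assumes i: "i < n" and w: "w i = 0" "\<And>j. j < n \<Longrightarrow> w j \<noteq> 0 \<Longrightarrow> R i j"
  shows "\<psi> (row_idem n i w) = row_idem n i (\<lambda>j. if j \<noteq> i \<and> R i j then g i j (w j) else 0)"
proof -
  let ?y = "\<lambda>k. ev i k + w k" and ?G = "\<lambda>j. if j \<noteq> i \<and> R i j then g i j (w j) else 0"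
  have in_A: "outer n (ev i) ?y \<in> A" using row_idem_in[of i w] i w by (simp add: row_idem_def)
  have d: "dot n ?y (ev i) = 1" using i w by simp
  obtain p q where pq: "dot n q p = 1" "\<psi> (outer n (ev i) ?y) = outer n p q"
    using preserver_rank_one'[OF R \<psi> in_A d] by blast
  have pj: "p j = 0 \<and> q j = ?G j * q i" if j: "j < n" "j \<noteq> i" for j
  proof (cases "R i j")
    case True
    let ?x = "\<lambda>k. ev j k + - w j * ev i k"
    have F: "outer n ?x (ev j) \<in> A" "\<psi> (outer n ?x (ev j)) = outer n (\<lambda>k. ev j k + - g i j (w j) * ev i k) (ev j)"
      using F_in[OF i j(1) True, of "- w j"] \<psi>_F[OF i j(1) j(2)[symmetric] True, of "- w j"]
      by (simp_all add: F_def col_idem_def)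
    have "dot n q (\<lambda>k. ev j k + - g i j (w j) * ev i k) = 0" "dot n (ev j) p = 0"
      using preserver_orthogonal[OF \<psi> in_A d pq(2,1) F(1) _ F(2)] i j w
      by (simp_all add: dot_add dot_diff dot_scale)
    then show ?thesis using i j True by (simp add: dot_add dot_diff dot_scale)
  next
    case False
    then have "w j = 0" using w j by blast
    then show ?thesis using support[OF in_A d pq(2,1) j(1)] j(2) False by simp
  qed
  have "p i * q i = 1" using dot_support1[of i n q p] pj i pq(1) by (simp add: mult.commute)
  then have "outer n p q = outer n (ev i) (\<lambda>k. ev i k + ?G k)"
  proof (intro outer_eqI)
    fix a b assume "a < n" "b < n"
    then show "p a * q b = ev i a * (ev i b + ?G b)"
      using pj[of a] pj[of b] \<open>p i * q i = 1\<close> by (cases "a = i"; cases "b = i") auto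
  qed
  then show ?thesis using pq(2) by (simp add: row_idem_def)
qed

text \<open>The dual argument, with \<open>E i j (- u i)\<close> as the probe for the i-th
  entry.\<close>

lemma \<psi>_col_idem:
  assumes j: "j < n" and u: "u j = 0" "\<And>i. i < n \<Longrightarrow> u i \<noteq> 0 \<Longrightarrow> R i j"
  shows "\<psi> (col_idem n j u) = col_idem n j (\<lambda>i. if i \<noteq> j \<and> R i j then - g i j (- u i) else 0)"
proof -
  let ?x = "\<lambda>k. ev j k + u k" and ?G = "\<lambda>i. if i \<noteq> j \<and> R i j then - g i j (- u i) else 0"
  have in_A: "outer n ?x (ev j) \<in> A" using col_idem_in[of j u] j u by (simp add: col_idem_def)
  have d: "dot n (ev j) ?x = 1" using j u by simp
  obtain p q where pq: "dot n q p = 1" "\<psi> (outer n ?x (ev j)) = outer n p q"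
    using preserver_rank_one'[OF R \<psi> in_A d] by blast
  have qi: "q i = 0 \<and> p i = ?G i * p j" if i: "i < n" "i \<noteq> j" for i
  proof (cases "R i j")
    case True
    let ?y = "\<lambda>k. ev i k + - u i * ev j k"
    have F: "outer n (ev i) ?y \<in> A" "\<psi> (outer n (ev i) ?y) = outer n (ev i) (\<lambda>k. ev i k + g i j (- u i) * ev j k)"
      using E_in[OF i(1) j True, of "- u i"] \<psi>_E[OF i(1) j i(2) True, of "- u i"]
      by (simp_all add: E_def row_idem_def)
    have "dot n (\<lambda>k. ev i k + g i j (- u i) * ev j k) p = 0" "dot n q (ev i) = 0"
      using preserver_orthogonal[OF \<psi> in_A d pq(2,1) F(1) _ F(2)] i j u
      by (simp_all add: dot_add dot_diff dot_scale)
    then show ?thesis using i j True by (simp add: dot_add dot_diff dot_scale eq_neg_iff_add_eq_0)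
  next
    case False
    then have "u i = 0" using u i by blast
    then show ?thesis using support[OF in_A d pq(2,1) i(1)] i(2) False by simp
  qed
  have "p j * q j = 1" using dot_support1[of j n q p] qi j pq(1) by (simp add: mult.commute)
  then have "outer n p q = outer n (\<lambda>k. ev j k + ?G k) (ev j)"
  proof (intro outer_eqI)
    fix a b assume "a < n" "b < n"
    then show "p a * q b = (ev j a + ?G a) * ev j b"
      using qi[of a] qi[of b] \<open>p j * q j = 1\<close> by (cases "a = j"; cases "b = j") auto
  qed
  then show ?thesis using pq(2) by (simp add: col_idem_def)
qed

lemma g_equation:
  assumes lt: "i < n" "j < n" "k < n" and ne: "i \<noteq> j" "i \<noteq> k" "k \<noteq> j" and Rs: "R i k" "R k j"
  shows "g i j (a + b * c) = g i j a - g i k b * g k j (- c)"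
proof -
  have Rij: "R i j" using trans[OF Rs] lt by blast
  \<comment> \<open>The coefficient of e_i in \<open>u\<close> is forced: it makes e_i + a e_j + b
    e_k pair to zero with e_j - (a + b c) e_i + c e_k. Orthogonality of the images is then the
    asserted equation.\<close>
  define w where "w l = a * ev j l + b * ev k l" for l
  define u where "u l = - (a + b * c) * ev i l + c * ev k l" for l
  have w: "w i = 0" "\<And>l. l < n \<Longrightarrow> w l \<noteq> 0 \<Longrightarrow> R i l"
    using ne Rij Rs by (auto simp: w_def ev_def split: if_splits)
  have u: "u j = 0" "\<And>l. l < n \<Longrightarrow> u l \<noteq> 0 \<Longrightarrow> R l j"
    using ne Rij Rs by (auto simp: u_def ev_def split: if_splits)
  define w' where "w' l = (if l \<noteq> i \<and> R i l then g i l (w l) else 0)" for l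
  define u' where "u' l = (if l \<noteq> j \<and> R l j then - g l j (- u l) else 0)" for l
  have "dot n (\<lambda>l. ev i l + w' l) (\<lambda>l. ev j l + u' l) = 0"
  proof (rule preserver_orthogonal[OF \<psi>])
    show "outer n (ev i) (\<lambda>l. ev i l + w l) \<in> A" using row_idem_in[of i w] lt w by (simp add: row_idem_def)
    show "outer n (\<lambda>l. ev j l + u l) (ev j) \<in> A" using col_idem_in[of j u] lt u by (simp add: col_idem_def)
    show "\<psi> (outer n (ev i) (\<lambda>l. ev i l + w l)) = outer n (ev i) (\<lambda>l. ev i l + w' l)"
      using \<psi>_row_idem[where w = w, OF lt(1) w] by (simp add: row_idem_def w'_def)
    show "\<psi> (outer n (\<lambda>l. ev j l + u l) (ev j)) = outer n (\<lambda>l. ev j l + u' l) (ev j)"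
      using \<psi>_col_idem[where u = u, OF lt(2) u] by (simp add: col_idem_def u'_def)
    have "w = (\<lambda>l. a * ev j l + b * ev k l)" by (simp add: w_def fun_eq_iff)
    then have "dot n w u = a * u j + b * u k" using lt by (simp only: dot_add dot_scale dot_ev)
    then have "dot n w u = b * c" using ne by (simp add: u_def)
    then show "dot n (\<lambda>l. ev i l + w l) (\<lambda>l. ev j l + u l) = 0"
      using lt ne by (simp add: dot_add, simp add: w_def u_def)
  qed (use lt ne w u in \<open>auto simp: w'_def u'_def\<close>)
  moreover have z: "w' i = 0" "u' j = 0" by (simp_all add: w'_def u'_def)
  moreover have "dot n w' u' = w' k * u' k"
  proof (rule dot_support1[OF lt(3)])
    fix l assume l: "l < n" "l \<noteq> k"
    show "w' l * u' l = 0"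
    proof (cases "l = j")
      case True
      then show ?thesis by (simp add: u'_def)
    next
      case False
      then have "w l = 0" using l by (simp add: w_def)
      then show ?thesis using g_zero[OF lt(1) l(1)] by (simp add: w'_def)
    qed
  qed
  ultimately have "w' j + u' i + w' k * u' k = 0"
    using lt ne by (simp add: dot_add z algebra_simps)
  moreover have "w' j = g i j a" "w' k = g i k b" "u' i = - g i j (a + b * c)" "u' k = - g k j (- c)"
    using ne Rs Rij by (auto simp: w'_def u'_def w_def u_def add.commute)
  ultimately show ?thesis by (simp add: algebra_simps)
qed

lemma g_add:
  assumes lt: "i < n" "j < n" "k < n" and ne: "i \<noteq> j" "i \<noteq> k" "k \<noteq> j" and Rs: "R i k" "R k j"
  shows "g i j (a + c) = g i j a + g i j c"
  using g_equation[OF assms, of a 1 c] g_equation[OF assms, of 0 1 c] g_zero[OF lt(1,2) ne(1)] by simp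

text \<open>Additivity only leaves real-linear \<open>g\<close>; complex conjugation is excluded because
  \<open>z g(a/z)\<close>, an entry of \<open>\<psi>(z E\<^sub>i\<^sub>i + a E\<^sub>i\<^sub>j)\<close>, has a limit as \<open>z \<rightarrow> 0\<close>.\<close>

lemma g_linear_triple:
  assumes lt: "i < n" "j < n" "k < n" and ne: "i \<noteq> j" "i \<noteq> k" "k \<noteq> j" and Rs: "R i k" "R k j"
  shows "g i j t = g i j 1 * t"
proof -
  have Rij: "R i j" using trans[OF Rs] lt by blast
  define X where "X = outer n (ev i) (ev j)"
  define Y where "Y = outer n (ev i) (ev i)"
  have X: "X \<in> A" unfolding X_def using Rij by (auto simp: pattern_algebra_def ev_def)
  have Y: "Y \<in> A" unfolding Y_def by (rule ev_in)
  define h where "h z = \<psi> (X + z \<cdot>\<^sub>m Y) $$ (i, j)" for z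
  have cont: "continuous_on UNIV h" unfolding h_def using preserverD(5)[OF \<psi> X Y lt(1,2)] .
  have h: "h z = z * g i j (1 / z)" if "z \<noteq> 0" for z
  proof -
    let ?y = "\<lambda>k. ev i k + (1 / z) * ev j k"
    have e: "X + z \<cdot>\<^sub>m Y = z \<cdot>\<^sub>m outer n (ev i) ?y"
      unfolding X_def Y_def using that by (intro eq_matI) (auto simp: field_simps)
    have in_A: "outer n (ev i) ?y \<in> A" and d: "dot n ?y (ev i) = 1"
      using E_in[OF lt(1,2) Rij, of "1 / z"] lt ne by (simp_all add: E_def row_idem_def)
    obtain p q where pq: "\<And>c. \<psi> (c \<cdot>\<^sub>m outer n (ev i) ?y) = c \<cdot>\<^sub>m outer n p q"
      using preserver_rank_one[OF R \<psi> in_A d] by blast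
    have "\<psi> (outer n (ev i) ?y) = outer n p q" using pq[of 1] by simp
    then have "g i j (1 / z) = p i * q j" using lt by (simp add: g_def E_def row_idem_def)
    then show ?thesis unfolding h_def e pq using lt by simp
  qed
  have nat: "g i j (of_nat m * a) = of_nat m * g i j a" for m a
    by (induction m) (simp_all add: g_zero lt ne distrib_right g_add[OF assms])
  \<comment> \<open>At z = 1/(m v) additivity cancels the positive integer m in \<open>h z\<close>
    and leaves the constant g(v)/v; the limit \<open>h 0\<close> does not depend on v.\<close>
  have "g i j v = v * h 0" if v: "v \<noteq> 0" for v
  proof -
    have "(\<lambda>m. h (1 / (of_nat (Suc m) * v))) \<longlonglongrightarrow> h 0"
    proof -
      have "(\<lambda>m. 1 / (of_nat (Suc m) * v)) = (\<lambda>m. inverse (of_nat (Suc m)) * (1 / v))"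
        by (auto simp: field_simps)
      moreover have "(\<lambda>m. inverse (of_nat (Suc m)) * (1 / v)) \<longlonglongrightarrow> 0 * (1 / v)"
        by (intro tendsto_mult tendsto_const LIMSEQ_Suc[OF lim_inverse_n])
      ultimately have "(\<lambda>m. 1 / (of_nat (Suc m) * v)) \<longlonglongrightarrow> 0" by simp
      then show ?thesis using cont by (auto intro: continuous_on_tendsto_compose[of UNIV h])
    qed
    moreover have "h (1 / (of_nat (Suc m) * v)) = g i j v / v" for m
    proof -
      have "h (1 / (of_nat (Suc m) * v)) = 1 / (of_nat (Suc m) * v) * g i j (of_nat (Suc m) * v)"
        using v by (subst h) (auto simp del: of_nat_Suc)
      then show ?thesis using v unfolding nat by (simp del: of_nat_Suc)
    qed
    ultimately have "g i j v / v = h 0" by (simp add: LIMSEQ_const_iff)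
    then show ?thesis using v by (simp add: field_simps)
  qed
  from this[of t] this[of 1] show ?thesis using g_zero[OF lt(1,2) ne(1)] by (cases "t = 0") simp_all
qed

text \<open>If the third index k does not lie between i and j, it follows j or precedes i. Then (i,
  k) has the intermediate index j, or (k, j) has the intermediate index i, and the functional
  equation expresses its linear function as g_ij times a nonzero constant, up to a sign of the
  argument.\<close>

lemma g_linear:
  assumes ij: "i < n" "j < n" "i \<noteq> j" "R i j"
  shows "g i j t = g i j 1 * t"
proof -
  obtain k where k: "k < n" "k \<noteq> i" "k \<noteq> j" using ex_third by blast
  consider "R j k" | "R i k" "R k j" | "R k i"
    using total_preorder_total[OF R] k ij by metis
  then show ?thesis
  proof cases
    case 1
    have Rik: "R i k" using trans[OF ij(4) 1] ij k by blast
    note as = ij(1) k(1) ij(2) k(2)[symmetric] ij(3) k(3)[symmetric] ij(4) 1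
    have e: "g i k b = - g i j b * g j k (- 1)" for b
      using g_equation[OF as, of 0 b 1] g_zero[OF ij(1) k(1) k(2)[symmetric]] by simp
    have nz: "g j k (- 1) \<noteq> 0" using g_nonzero[OF ij(2) k(1) k(3)[symmetric] 1] by simp
    have "g i j t * g j k (- 1) = (g i j 1 * t) * g j k (- 1)"
      using g_linear_triple[OF as, of t] e[of t] e[of 1] by (simp add: algebra_simps)
    then show ?thesis using nz by simp
  next
    case 2
    show ?thesis using g_linear_triple[OF ij(1,2) k(1) ij(3) k(2)[symmetric] k(3) 2] .
  next
    case 3
    note as = k(1) ij(2) ij(1) k(3) k(2) ij(3) 3 ij(4)
    have e: "g k j c = - g k i 1 * g i j (- c)" for c
      using g_equation[OF as, of 0 1 c] g_zero[OF k(1) ij(2) k(3)] by simp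
    have nz: "g k i 1 \<noteq> 0" using g_nonzero[OF k(1) ij(1) k(2) 3] by simp
    have e1: "g k i 1 * g i j c = - g k j 1 * (- c)" for c
      using e[of "- c"] g_linear_triple[OF as, of "- c"] by (simp add: algebra_simps)
    have "g k i 1 * g i j t = g k i 1 * (g i j 1 * t)" using e1[of t] e1[of 1] by (simp add: algebra_simps)
    then show ?thesis using nz by simp
  qed
qed

lemma g_cocycle:
  assumes lt: "i < n" "j < n" "k < n" and ne: "i \<noteq> j" "i \<noteq> k" "k \<noteq> j" and Rs: "R i k" "R k j"
  shows "g i j 1 = g i k 1 * g k j 1"
  using g_equation[OF assms, of 0 1 1] g_zero[OF lt(1,2) ne(1)]
    g_linear[OF lt(3,2) ne(3) Rs(2), of "- 1"] by simp

text \<open>The position (i, n-1) is admissible for every i, so its scalar can serve as the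
  potential \<open>d i\<close>; the cocycle relation through n-1 gives the quotients.\<close>

lemma g_coboundary:
  "\<exists>d. (\<forall>i. d i \<noteq> 0) \<and> (\<forall>i<n. \<forall>j<n. \<forall>t. i \<noteq> j \<longrightarrow> R i j \<longrightarrow> g i j t = d i / d j * t)"
proof -
  let ?l = "n - 1"
  define d where "d i = (if i < ?l then g i ?l 1 else 1)" for i
  have l: "?l < n" using n3 by simp
  have Rl: "R i ?l" if "i < n" for i using le[OF that l] that by simp
  have nz: "d i \<noteq> 0" for i
    using g_nonzero[OF _ l _ Rl, of i 1] by (auto simp: d_def)
  have "g i j 1 = d i / d j" if ij: "i < n" "j < n" "i \<noteq> j" "R i j" for i j
  proof -
    consider "i = ?l" | "j = ?l" | "i < ?l" "j < ?l" using ij by linarith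
    then show ?thesis
    proof cases
      case 1
      \<comment> \<open>Here n-1 and j lie in the same block. The cocycle relation for the two
        orders of n-1 and j, read in row k, shows that the scalars at (n-1, j) and (j, n-1) are
        reciprocal.\<close>
      obtain k where k: "k < n" "k \<noteq> ?l" "k \<noteq> j" using ex_third by blast
      have Rkj: "R k j" using trans[OF Rl[OF k(1)] ij(4)[unfolded 1]] k ij l by blast
      have a: "g k j 1 = g k ?l 1 * g ?l j 1"
        by (rule g_cocycle) (use k ij l 1 Rl in auto)
      have b: "g k ?l 1 = g k j 1 * g j ?l 1"
        by (rule g_cocycle) (use k ij l 1 Rl Rkj in auto)
      have "g k ?l 1 \<noteq> 0" by (rule g_nonzero) (use k l Rl in auto)
      with a b have gg: "g ?l j 1 * g j ?l 1 = 1" by simp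
      then have "g j ?l 1 \<noteq> 0" by (metis mult_zero_right zero_neq_one)
      with gg have "g ?l j 1 = 1 / g j ?l 1" by (simp add: eq_divide_eq)
      then show ?thesis using 1 ij by (simp add: d_def)
    next
      case 2
      then show ?thesis using ij by (simp add: d_def)
    next
      case 3
      have "g i ?l 1 = g i j 1 * g j ?l 1"
        by (rule g_cocycle) (use ij 3 l Rl in auto)
      then show ?thesis using 3 nz[of j] by (simp add: d_def field_simps)
    qed
  qed
  then show ?thesis using nz g_linear by metis
qed

lemma E_rescaled:
  "\<exists>d. (\<forall>i. d i \<noteq> 0) \<and> (\<forall>i<n. \<forall>j<n. \<forall>t. i \<noteq> j \<longrightarrow> R i j \<longrightarrow> \<psi> (E i j t) = E i j (d i / d j * t))"
  using g_coboundary \<psi>_E by metis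

end

section \<open>Rigidity\<close>

lemma conj_ev:
  fixes U V :: "complex mat"
  assumes UV: "U \<in> carrier_mat n n" "V \<in> carrier_mat n n" and k: "k < n"
  shows "U * outer n (ev k) (ev k) * V = outer n (\<lambda>i. U $$ (i, k)) (\<lambda>j. V $$ (k, j))"
proof (rule eq_matI)
  fix i j assume "i < dim_row (outer n (\<lambda>i. U $$ (i, k)) (\<lambda>j. V $$ (k, j)))"
    "j < dim_col (outer n (\<lambda>i. U $$ (i, k)) (\<lambda>j. V $$ (k, j)))"
  then have ij: "i < n" "j < n" by auto
  have "(U * mat_diag n (ev k) * V) $$ (i, j) = dot n (ev k) (\<lambda>l. U $$ (i, l) * V $$ (l, j))"
    using conj_diag_index[OF UV ij] by (simp add: dot_def)
  then show "(U * outer n (ev k) (ev k) * V) $$ (i, j) = outer n (\<lambda>i. U $$ (i, k)) (\<lambda>j. V $$ (k, j)) $$ (i, j)"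
    using ij k by (simp add: diag_ev)
qed (use UV in auto)

section \<open>Normalized maps fix the whole algebra\<close>

locale normal_preserver = diag_preserver +
  assumes E_fixed: "\<And>i j t. i < n \<Longrightarrow> j < n \<Longrightarrow> i \<noteq> j \<Longrightarrow> R i j \<Longrightarrow> \<psi> (E i j t) = E i j t"

sublocale normal_preserver \<subseteq> row_preserver
  by unfold_locales (simp add: row_type_def E_fixed, simp add: E_def row_idem_def)

context normal_preserver
begin

lemma g_eq: "i < n \<Longrightarrow> j < n \<Longrightarrow> i \<noteq> j \<Longrightarrow> R i j \<Longrightarrow> g i j t = t"
  by (simp add: g_def E_fixed E_index)

lemma row_idem_fixed:
  assumes i: "i < n" and w: "w i = 0" "\<And>j. j < n \<Longrightarrow> w j \<noteq> 0 \<Longrightarrow> R i j"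
  shows "\<psi> (row_idem n i w) = row_idem n i w"
proof -
  have "\<psi> (row_idem n i w) = row_idem n i (\<lambda>j. if j \<noteq> i \<and> R i j then g i j (w j) else 0)"
    by (rule \<psi>_row_idem[where w = w, OF assms])
  also have "\<dots> = row_idem n i w" by (rule row_idem_cong) (use w g_eq i in auto)
  finally show ?thesis .
qed

lemma col_idem_fixed:
  assumes j: "j < n" and u: "u j = 0" "\<And>i. i < n \<Longrightarrow> u i \<noteq> 0 \<Longrightarrow> R i j"
  shows "\<psi> (col_idem n j u) = col_idem n j u"
proof -
  have "\<psi> (col_idem n j u) = col_idem n j (\<lambda>i. if i \<noteq> j \<and> R i j then - g i j (- u i) else 0)"
    by (rule \<psi>_col_idem[where u = u, OF assms])
  also have "\<dots> = col_idem n j u" by (rule col_idem_cong) (use u g_eq j in auto)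
  finally show ?thesis .
qed

text \<open>Conjugation by I + u e_k^t turns every E_ll, and every \<open>E i j t\<close> with i
  different from k, into a row or column idempotent, which is fixed. Row k escapes this, since its
  idempotents become general rank-one ones. There the conjugated map is known up to the scalars d_i
  / d_j, and its values on the other rows force the needed scalars to be 1.\<close>

lemma normal_conj:
  assumes k: "k < n" and u: "u k = 0" "\<And>i. i < n \<Longrightarrow> u i \<noteq> 0 \<Longrightarrow> R i k"
  shows "normal_preserver n R (\<lambda>X. colm n k (\<lambda>i. - u i) * \<psi> (colm n k u * X * colm n k (\<lambda>i. - u i)) * colm n k u)"
proof -
  define S where "S = colm n k u"
  define S' where "S' = colm n k (\<lambda>i. - u i)"
  let ?\<psi> = "\<lambda>X. S' * \<psi> (S * X * S') * S"
  have p: "inverse_pair n S S'" unfolding S_def S'_def by (rule inverse_pair_colm[where u = u, OF k u(1)])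
  have SA: "S \<in> A" "S' \<in> A"
    unfolding S_def S'_def using u by (auto intro!: colm_pattern[OF R])
  have pres: "preserver n R ?\<psi>"
    by (rule preserver_codomain_conj[OF preserver_domain_conj[OF R \<psi> p SA] inverse_pair_sym[OF p]])
  have fixed: "?\<psi> X = X" if "X \<in> carrier_mat n n" "\<psi> (S * X * S') = S * X * S'" for X
    unfolding that(2) by (rule inverse_pair_cancel[OF p that(1)])
  note conj = colm_conj_outer[where u = u, OF k u(1), folded S_def S'_def]
  have ev_fixed: "\<psi> (S * outer n (ev l) (ev l) * S') = S * outer n (ev l) (ev l) * S'" if l: "l < n" for l
  proof (cases "l = k")
    case True
    have "S * outer n (ev l) (ev l) * S' = col_idem n k u"
      unfolding conj col_idem_def using k True u(1) by (intro outer_eqI) simp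
    then show ?thesis using col_idem_fixed[where u = u, OF k u] by simp
  next
    case False
    have "S * outer n (ev l) (ev l) * S' = row_idem n l (\<lambda>j. - u l * ev k j)"
      unfolding conj row_idem_def using l k False by (intro outer_eqI) (simp add: algebra_simps)
    moreover have "\<psi> (row_idem n l (\<lambda>j. - u l * ev k j)) = row_idem n l (\<lambda>j. - u l * ev k j)"
      by (rule row_idem_fixed[OF l]) (use False u l in \<open>auto simp: ev_def split: if_splits\<close>)
    ultimately show ?thesis by simp
  qed
  have "S * mat_diag n d * S' \<in> A" for d using pattern_sandwich[OF R SA(1) pattern_diag[OF R] SA(2)] .
  then have "\<psi> (S * mat_diag n d * S') = S * mat_diag n d * S'" for d
    using frame_fixed[OF \<psi> p] ev_fixed by blast
  then have diag': "?\<psi> (mat_diag n d) = mat_diag n d" for d using fixed[OF mat_diag_dim] by blast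
  have Ec: "E i j t \<in> carrier_mat n n" for i j t by (simp add: E_def row_idem_def)
  have E': "?\<psi> (E i j t) = E i j t" if ij: "i < n" "j < n" "i \<noteq> j" "R i j" "i \<noteq> k" for i j t
  proof (rule fixed[OF Ec])
    let ?w = "\<lambda>l. t * ev j l - (u i + t * u j) * ev k l"
    have "S * E i j t * S' = row_idem n i ?w"
      unfolding E_def row_idem_def conj using ij k
      by (intro outer_eqI) (simp add: dot_add dot_scale algebra_simps)
    moreover have "\<psi> (row_idem n i ?w) = row_idem n i ?w"
    proof (rule row_idem_fixed[OF ij(1)])
      show "?w i = 0" using ij by simp
      fix l assume l: "l < n" "?w l \<noteq> 0"
      then consider "l = j" | "l = k" "u i \<noteq> 0" | "l = k" "u j \<noteq> 0"
        by (cases "l = j"; cases "l = k"; cases "u i = 0"; cases "u j = 0") auto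
      then show "R i l"
      proof cases
        case 3
        then show ?thesis using trans[OF ij(4) u(2)[OF ij(2)]] ij k by blast
      qed (use ij u in auto)
    qed
    ultimately show "\<psi> (S * E i j t * S') = S * E i j t * S'" by simp
  qed
  interpret D: diag_preserver n R ?\<psi> by unfold_locales (use n3 R le pres diag' in auto)
  \<comment> \<open>A position outside row k, available since n \<ge> 3, at which the idempotent is
    already known to be fixed and so not of column type; this decides the type everywhere.\<close>
  define i0 where "i0 = (if k = 0 then 1 else 0 :: nat)"
  have i0: "i0 < n" "n - 1 < n" "i0 \<noteq> n - 1" "i0 \<noteq> k" "R i0 (n - 1)"
    using n3 le[of i0 "n - 1"] by (auto simp: i0_def)
  have "\<not> D.col_type i0 (n - 1) 1"
    unfolding D.col_type_def using E'[OF i0(1,2,3,5,4), of 1] i0 E_index[OF i0(1-3), of 1]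
    by (metis zero_neq_one)
  then have row: "D.row_type i j t" if "i < n" "j < n" "i \<noteq> j" "R i j" for i j t
    using D.row_or_col_type i0 that by blast
  interpret Rw: row_preserver n R ?\<psi> by unfold_locales (use row in auto)
  obtain d where d: "\<And>i. d i \<noteq> 0"
    "\<And>i j t. i < n \<Longrightarrow> j < n \<Longrightarrow> i \<noteq> j \<Longrightarrow> R i j \<Longrightarrow> ?\<psi> (E i j t) = E i j (d i / d j * t)"
    using Rw.E_rescaled by blast
  have d_eq: "d i = d j" if ij: "i < n" "j < n" "i \<noteq> j" "R i j" "i \<noteq> k" for i j
  proof -
    have "E i j 1 $$ (i, j) = E i j (d i / d j * 1) $$ (i, j)" using d(2)[OF ij(1-4), of 1] E'[OF ij, of 1] by simp
    then show ?thesis using E_index[OF ij(1-3)] d(1)[of j] by simp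
  qed
  have "?\<psi> (E i j t) = E i j t" if ij: "i < n" "j < n" "i \<noteq> j" "R i j" for i j t
  proof (cases "i = k")
    case False
    then show ?thesis using E' ij by blast
  next
    case True
    show ?thesis
    \<comment> \<open>If another index l precedes k, then d_l equals both d_k and d_j. Otherwise u
      vanishes at all indices and the conjugation is trivial.\<close>
    proof (cases "\<exists>l<n. l \<noteq> k \<and> R l k")
      case True
      then obtain l where l: "l < n" "l \<noteq> k" "R l k" by blast
      have "d i = d j"
      proof (cases "l = j")
        case True
        then show ?thesis using d_eq[of l k] l k \<open>i = k\<close> by simp
      next
        case False
        have "R l j" using trans[OF l(3) ij(4)[unfolded \<open>i = k\<close>] l(1) k ij(2)] .
        then show ?thesis using d_eq[of l k] d_eq[of l j] l k ij \<open>i = k\<close> False by simp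
      qed
      then show ?thesis using d(2)[OF ij, of t] d(1)[of j] by simp
    next
      case False
      then have u0: "u l = 0" if "l < n" for l using u that by blast
      then have du: "dot n y u = 0" for y by (simp add: dot_def)
      have "S * E i j t * S' = E i j t"
        unfolding E_def row_idem_def conj du by (rule outer_eqI) (simp add: u0)
      then have "\<psi> (S * E i j t * S') = S * E i j t * S'" using E_fixed[OF ij] by metis
      then show ?thesis by (rule fixed[OF Ec])
    qed
  qed
  then have "normal_preserver n R ?\<psi>" by unfold_locales auto
  then show ?thesis by (simp add: S_def S'_def)
qed

text \<open>One column conjugation reduces a rank-one idempotent to a row idempotent, which the
  conjugated map, again normal, fixes.\<close>

lemma rank_one_fixed:
  assumes P: "outer n x y \<in> A" and xy: "dot n y x = 1"
  shows "\<psi> (outer n x y) = outer n x y"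
proof -
  obtain k u w where k: "k < n" and uw: "u k = 0" "w k = 0"
    and Ru: "\<And>i. i < n \<Longrightarrow> u i \<noteq> 0 \<Longrightarrow> R i k" and Rw: "\<And>i. i < n \<Longrightarrow> w i \<noteq> 0 \<Longrightarrow> R k i"
    and o: "outer n x y = colm n k u * outer n (ev k) (\<lambda>j. ev k j + w j) * colm n k (\<lambda>i. - u i)"
    using rank_one_idempotent_conj[OF P xy] by blast
  let ?S = "colm n k u" and ?S' = "colm n k (\<lambda>i. - u i)"
  have p: "inverse_pair n ?S ?S'" by (rule inverse_pair_colm[where u = u, OF k uw(1)])
  interpret N: normal_preserver n R "\<lambda>X. ?S' * \<psi> (?S * X * ?S') * ?S"
    using normal_conj[where u = u, OF k uw(1) Ru] .
  have "?S' * \<psi> (outer n x y) * ?S = outer n (ev k) (\<lambda>j. ev k j + w j)"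
    using N.row_idem_fixed[where w = w, OF k uw(2) Rw] by (simp add: row_idem_def o)
  then have "?S * (?S' * \<psi> (outer n x y) * ?S) * ?S' = outer n x y" by (simp add: o)
  then show ?thesis
    using inverse_pair_cancel[OF inverse_pair_sym[OF p] preserverD(1)[OF \<psi> P]] by simp
qed

text \<open>Although \<open>T\<close> need not lie in the algebra, distinct values of
  \<open>d\<close> make every \<open>T * mat_diag n e * S\<close> a polynomial in the given element,
  by Lagrange interpolation.\<close>

lemma frame_in_algebra:
  assumes p: "inverse_pair n T S" and d: "inj_on d {..<n}" and X: "T * mat_diag n d * S \<in> A"
  shows "T * mat_diag n e * S \<in> A"
proof -
  note c = inverse_pairD[OF p]
  define B where "B e \<longleftrightarrow> T * mat_diag n e * S \<in> A" for e
  have cong: "B e \<longleftrightarrow> B f" if "\<And>m. m < n \<Longrightarrow> e m = f m" for e f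
  proof -
    have "mat_diag n e = mat_diag n f" using that by (intro eq_matI) (auto simp: mat_diag_def)
    then show ?thesis by (simp add: B_def)
  qed
  have line: "B (\<lambda>m. e m + z * f m)" if "B e" "B f" for e f z
  proof -
    have "mat_diag n (\<lambda>m. e m + z * f m) = mat_diag n e + z \<cdot>\<^sub>m mat_diag n f"
      by (intro eq_matI) (auto simp: mat_diag_def)
    then show ?thesis
      using pattern_line[OF that[unfolded B_def], of z] conj_line[OF c(1,2) mat_diag_dim mat_diag_dim]
      by (simp add: B_def)
  qed
  have mult: "B (\<lambda>m. e m * f m)" if "B e" "B f" for e f
    using pattern_mult[OF R that[unfolded B_def]] conj_mult[OF p mat_diag_dim mat_diag_dim] by (simp add: B_def)
  have one: "B (\<lambda>m. 1)" using c pattern_diag[OF R, of "\<lambda>m. 1"] by (simp add: B_def)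
  have zero: "B (\<lambda>m. 0)" using line[OF one one, of "-1"] by simp
  have Bd: "B d" using X by (simp add: B_def)
  have sep: "\<exists>e. B e \<and> e i = 1 \<and> (\<forall>j\<in>J. e j = 0)" if "i < n" "finite J" "J \<subseteq> {..<n} - {i}" for i J
    using that(2,3)
  proof (induction J rule: finite_induct)
    case empty
    then show ?case using one by auto
  next
    case (insert j J)
    then obtain e where e: "B e" "e i = 1" "\<forall>l\<in>J. e l = 0" by auto
    have "d i \<noteq> d j" using insert(4) that(1) d by (auto simp: inj_on_def)
    \<comment> \<open>The factor a d_m + b equals (d_m - d_j) / (d_i - d_j), which is 1 at m = i and
      0 at m = j.\<close>
    define a where "a = 1 / (d i - d j)"
    define b where "b = - d j * a"
    have "B (\<lambda>m. (0 + b * 1) + a * d m)" by (intro line zero one Bd)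
    then have "B (\<lambda>m. e m * ((0 + b * 1) + a * d m))" using mult[OF e(1)] by blast
    moreover have "e i * ((0 + b * 1) + a * d i) = 1" and "e j * ((0 + b * 1) + a * d j) = 0"
      using e(2) \<open>d i \<noteq> d j\<close> by (simp_all add: a_def b_def diff_divide_distrib[symmetric])
    ultimately show ?case using e(3) by (intro exI[of _ "\<lambda>m. e m * ((0 + b * 1) + a * d m)"]) simp
  qed
  have ev: "B (ev i)" if i: "i < n" for i
  proof -
    obtain f where f: "B f" "f i = 1" "\<forall>j\<in>{..<n} - {i}. f j = 0" using sep[OF i, of "{..<n} - {i}"] by auto
    have "ev i m = f m" if "m < n" for m using f that by (cases "m = i") auto
    then show ?thesis using cong[of "ev i" f] f(1) by simp
  qed
  have "B (\<lambda>m. if m \<in> J then e m else 0)" if "finite J" "J \<subseteq> {..<n}" for J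
    using that
  proof (induction J rule: finite_induct)
    case empty
    then show ?case using zero by simp
  next
    case (insert j J)
    then have "B (\<lambda>m. (if m \<in> J then e m else 0) + e j * ev j m)" by (intro line ev) auto
    moreover have "(\<lambda>m. (if m \<in> J then e m else 0) + e j * ev j m) = (\<lambda>m. if m \<in> insert j J then e m else 0)"
      using insert(2) by (auto simp: ev_def)
    ultimately show ?case by simp
  qed
  from this[of "{..<n}"] show ?thesis using cong[of "\<lambda>m. if m \<in> {..<n} then e m else 0" e] by (simp add: B_def)
qed

text \<open>The spectral idempotents of X lie in the algebra and are fixed, hence so is the frame
  through X.\<close>

lemma distinct_fixed:
  assumes X: "X \<in> A" and card: "card (spectrum X) = n"
  shows "\<psi> X = X"
proof -
  have "finite (spectrum X)" using card_finite_spectrum(1)[OF pattern_carrier[OF X]] .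
  from ex_bij_betw_nat_finite[OF this] obtain d where "bij_betw d {0..<n} (spectrum X)" using card by auto
  then have d: "inj_on d {..<n}" "d ` {..<n} = spectrum X" by (auto simp: bij_betw_def lessThan_atLeast0)
  then obtain T S where TS: "T \<in> carrier_mat n n" "S \<in> carrier_mat n n" "T * S = 1\<^sub>m n" "S * T = 1\<^sub>m n"
    and XTS: "X = T * mat_diag n d * S"
    using ex_diagonalization[OF pattern_carrier[OF X] d(1)] by blast
  have p: "inverse_pair n T S" using TS by (simp add: inverse_pair_def)
  have in_A: "T * mat_diag n e * S \<in> A" for e using frame_in_algebra[OF p d(1)] X XTS by simp
  have "\<psi> (T * outer n (ev k) (ev k) * S) = T * outer n (ev k) (ev k) * S" if k: "k < n" for k
    unfolding conj_ev[OF TS(1,2) k]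
  proof (rule rank_one_fixed)
    show "outer n (\<lambda>i. T $$ (i, k)) (\<lambda>j. S $$ (k, j)) \<in> A"
      using in_A[of "ev k"] conj_ev[OF TS(1,2) k] by (simp add: diag_ev)
    have "(S * T) $$ (k, k) = dot n (\<lambda>j. S $$ (k, j)) (\<lambda>i. T $$ (i, k))"
      unfolding mult_mat_index[OF TS(2,1) k k] by (simp add: dot_def)
    then show "dot n (\<lambda>j. S $$ (k, j)) (\<lambda>i. T $$ (i, k)) = 1" using TS(4) k by simp
  qed
  then show ?thesis unfolding XTS by (intro frame_fixed[OF \<psi> p in_A])
qed

text \<open>The line from a diagonal matrix with distinct entries to X meets repeated eigenvalues
  finitely often; equality off these points extends to X by continuity.\<close>

lemma all_fixed:
  assumes X: "X \<in> A"
  shows "\<psi> X = X"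
proof -
  define D where "D = mat_diag n (of_nat :: nat \<Rightarrow> complex)"
  have D: "D \<in> A" unfolding D_def by (rule pattern_diag[OF R])
  define Y where "Y = X + (-1) \<cdot>\<^sub>m D"
  have Y: "Y \<in> A" unfolding Y_def by (rule pattern_line[OF X D])
  have l0: "D + 0 \<cdot>\<^sub>m Y = D" and l1: "D + 1 \<cdot>\<^sub>m Y = X"
    using pattern_carrier[OF X] pattern_carrier[OF D] by (auto intro!: eq_matI simp: Y_def)
  let ?F = "{z. card (spectrum (D + z \<cdot>\<^sub>m Y)) \<noteq> n}"
  have c0: "card (spectrum (D + 0 \<cdot>\<^sub>m Y)) = n"
    unfolding l0 unfolding D_def card_spectrum_diag by (simp add: inj_on_def)
  have "\<psi> (D + 1 \<cdot>\<^sub>m Y) $$ (i, j) = (D + 1 \<cdot>\<^sub>m Y) $$ (i, j)" if ij: "i < n" "j < n" for i j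
  proof (rule continuous_selection[where F = ?F and ?z0.0 = 0 and n = 1 and i = 0 and
        g = "\<lambda>_ z. (D + z \<cdot>\<^sub>m Y) $$ (i, j)" and f = "\<lambda>z. \<psi> (D + z \<cdot>\<^sub>m Y) $$ (i, j)"])
    show "finite ?F" by (rule finite_discr_zero[OF pattern_carrier[OF D] pattern_carrier[OF Y] c0])
    show "continuous_on UNIV (\<lambda>z. \<psi> (D + z \<cdot>\<^sub>m Y) $$ (i, j))" by (rule preserverD(5)[OF \<psi> D Y ij])
    have "(\<lambda>z. (D + z \<cdot>\<^sub>m Y) $$ (i, j)) = (\<lambda>z. D $$ (i, j) + z * Y $$ (i, j))"
      using ij pattern_carrier[OF D] pattern_carrier[OF Y] by auto
    then show "continuous_on UNIV (\<lambda>z. (D + z \<cdot>\<^sub>m Y) $$ (i, j))"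
      by (simp only:) (intro continuous_intros)
    show "\<psi> (D + 0 \<cdot>\<^sub>m Y) $$ (i, j) = (D + 0 \<cdot>\<^sub>m Y) $$ (i, j)"
      using distinct_fixed[OF pattern_line[OF D Y] c0] by simp
    fix z assume "z \<notin> ?F"
    then have "card (spectrum (D + z \<cdot>\<^sub>m Y)) = n" by blast
    from distinct_fixed[OF pattern_line[OF D Y] this]
    show "\<exists>l<1::nat. \<psi> (D + z \<cdot>\<^sub>m Y) $$ (i, j) = (D + z \<cdot>\<^sub>m Y) $$ (i, j)" by auto
  qed (use c0 in auto)
  then show ?thesis unfolding l1 using pattern_carrier[OF X] preserverD(1)[OF \<psi> X] by (intro eq_matI) auto
qed

end

section \<open>The general form of a preserver\<close>

context row_preserver
begin

lemma conj_form: "\<exists>T S. inverse_pair n T S \<and> (\<forall>X\<in>A. \<psi> X = T * X * S)"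
proof -
  obtain d where d: "\<And>i. d i \<noteq> 0"
    "\<And>i j t. i < n \<Longrightarrow> j < n \<Longrightarrow> i \<noteq> j \<Longrightarrow> R i j \<Longrightarrow> \<psi> (E i j t) = E i j (d i / d j * t)"
    using E_rescaled by blast
  define T where "T = mat_diag n d"
  define S where "S = mat_diag n (\<lambda>i. 1 / d i)"
  have p: "inverse_pair n T S" using d(1) by (simp add: inverse_pair_def T_def S_def)
  have pres: "preserver n R (\<lambda>X. S * \<psi> X * T)"
    by (rule preserver_codomain_conj[OF \<psi> inverse_pair_sym[OF p]])
  interpret N: normal_preserver n R "\<lambda>X. S * \<psi> X * T"
  proof unfold_locales
    show "S * \<psi> (mat_diag n e) * T = mat_diag n e" for e
      unfolding diag T_def S_def using d(1) by simp
    show D: "preserver n R (\<lambda>X. S * \<psi> X * T)" by (rule pres)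
    fix i j t assume ij: "i < n" "j < n" "i \<noteq> j" "R i j"
    have "S * E i j s * T = mat n n (\<lambda>(a, b). (1 / d a) * (E i j s $$ (a, b)) * d b)" for s
    proof -
      have Ec: "E i j s \<in> carrier_mat n n" by (simp add: E_def row_idem_def)
      show ?thesis unfolding S_def T_def
        by (subst mat_diag_mult_left[OF Ec], subst mat_diag_mult_right[of _ n]) (auto intro!: eq_matI)
    qed
    then have "S * \<psi> (E i j t) * T = mat n n (\<lambda>(a, b). (1 / d a) * (E i j (d i / d j * t) $$ (a, b)) * d b)"
      using d(2)[OF ij] by simp
    also have "\<dots> = E i j t"
    proof (rule eq_matI)
      fix a b assume "a < dim_row (E i j t)" "b < dim_col (E i j t)"
      then have "a < n" "b < n" by (auto simp: E_def row_idem_def)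
      then show "mat n n (\<lambda>(a, b). (1 / d a) * (E i j (d i / d j * t) $$ (a, b)) * d b) $$ (a, b) = E i j t $$ (a, b)"
        using d(1) ij by (cases "a = i"; cases "b = i"; cases "b = j") (auto simp: E_def row_idem_def)
    qed (auto simp: E_def row_idem_def)
    finally show "S * \<psi> (E i j t) * T = E i j t" .
  qed (use n3 R le in auto)
  have "\<psi> X = T * X * S" if X: "X \<in> A" for X
    using inverse_pair_cancel[OF inverse_pair_sym[OF p] preserverD(1)[OF \<psi> X]] N.all_fixed[OF X] by simp
  then show ?thesis using p by blast
qed

end

text \<open>The image of the diagonal frame supplies the conjugation that normalizes the map; it is
  afterwards absorbed into \<open>T\<close> and \<open>S\<close>, whose membership in the algebra is
  a separate matter.\<close>

lemma preserver_form:
  assumes n3: "3 \<le> n" and R: "total_preorder n R"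
    and le: "\<And>i j. i < n \<Longrightarrow> j < n \<Longrightarrow> i \<le> j \<Longrightarrow> R i j" and \<psi>: "preserver n R \<psi>"
  shows "\<exists>T S. inverse_pair n T S \<and>
    ((\<forall>X\<in>pattern_algebra n R. \<psi> X = T * X * S) \<or> (\<forall>X\<in>pattern_algebra n R. \<psi> X = T * transpose_mat X * S))"
proof -
  let ?A = "pattern_algebra n R"
  have one: "inverse_pair n (1\<^sub>m n) (1\<^sub>m n)" by (simp add: inverse_pair_def)
  have id: "1\<^sub>m n * mat_diag n d * 1\<^sub>m n = mat_diag n d" for d :: "nat \<Rightarrow> complex"
    by (simp add: mat_diag_dim left_mult_one_mat[of _ n n] right_mult_one_mat[of _ n n])
  obtain T S where p: "inverse_pair n T S" and TS: "\<And>d. \<psi> (mat_diag n d) = T * mat_diag n d * S"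
    using preserver_frame[OF \<psi> one] pattern_diag[OF R] unfolding id by blast
  define \<eta> where "\<eta> X = S * \<psi> X * T" for X
  have recover: "\<psi> X = T * \<eta> X * S" if "X \<in> ?A" for X
    unfolding \<eta>_def using inverse_pair_cancel[OF inverse_pair_sym[OF p] preserverD(1)[OF \<psi> that]] by simp
  have \<eta>: "preserver n R \<eta>"
    unfolding \<eta>_def by (rule preserver_codomain_conj[OF \<psi> inverse_pair_sym[OF p]])
  have \<eta>diag: "\<eta> (mat_diag n d) = mat_diag n d" for d
    unfolding \<eta>_def TS by (rule inverse_pair_cancel[OF p mat_diag_dim])
  interpret D: diag_preserver n R \<eta> by unfold_locales (use n3 R le \<eta> \<eta>diag in auto)
  from D.row_or_col_type show ?thesis
  proof
    assume "\<forall>i<n. \<forall>j<n. \<forall>t. i \<noteq> j \<longrightarrow> R i j \<longrightarrow> D.row_type i j t"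
    then interpret Rw: row_preserver n R \<eta> by unfold_locales blast
    obtain U V where UV: "inverse_pair n U V" "\<And>X. X \<in> ?A \<Longrightarrow> \<eta> X = U * X * V"
      using Rw.conj_form by blast
    have "\<psi> X = (T * U) * X * (V * S)" if X: "X \<in> ?A" for X
      using recover[OF X] UV(2)[OF X] assoc_mult_mat5[of T n U X V S] inverse_pairD[OF p] inverse_pairD[OF UV(1)]
        pattern_carrier[OF X] by simp
    then show ?thesis using inverse_pair_mult[OF p UV(1)] by blast
  next
    assume col: "\<forall>i<n. \<forall>j<n. \<forall>t. i \<noteq> j \<longrightarrow> R i j \<longrightarrow> D.col_type i j t"
    \<comment> \<open>Transposing the values exchanges the two types and keeps the diagonal matrices
      fixed.\<close>
    define \<tau> where "\<tau> X = transpose_mat (\<eta> X)" for X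
    have \<tau>: "preserver n R \<tau>" unfolding \<tau>_def by (rule preserver_transpose[OF \<eta>])
    have \<tau>diag: "\<tau> (mat_diag n d) = mat_diag n d" for d
      unfolding \<tau>_def \<eta>diag by (intro eq_matI) (auto simp: mat_diag_def)
    interpret D': diag_preserver n R \<tau> by unfold_locales (use n3 R le \<tau> \<tau>diag in auto)
    interpret Rw: row_preserver n R \<tau>
    proof unfold_locales
      fix i j t assume ij: "i < n" "j < n" "i \<noteq> j" "R i j"
      have "D.col_type i j t" using col ij by blast
      moreover have "\<eta> (D.E i j t) \<in> carrier_mat n n" using preserverD(1)[OF \<eta> D.E_in[OF ij(1,2,4)]] .
      ultimately show "D'.row_type i j t"
        unfolding D'.row_type_def D.col_type_def \<tau>_def using ij by simp
    qed
    obtain U V where UV: "inverse_pair n U V" "\<And>X. X \<in> ?A \<Longrightarrow> \<tau> X = U * X * V"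
      using Rw.conj_form by blast
    note cU = inverse_pairD[OF UV(1)]
    have p': "inverse_pair n (transpose_mat V) (transpose_mat U)"
      unfolding inverse_pair_def
        transpose_mult[OF cU(1,2), symmetric] transpose_mult[OF cU(2,1), symmetric] cU(3,4) transpose_one
      using cU by simp
    have "\<psi> X = (T * transpose_mat V) * transpose_mat X * (transpose_mat U * S)" if X: "X \<in> ?A" for X
    proof -
      note Xc = pattern_carrier[OF X]
      have "\<eta> X = transpose_mat (U * X * V)"
        using UV(2)[OF X] unfolding \<tau>_def by (metis Matrix.transpose_transpose)
      also have "\<dots> = transpose_mat V * transpose_mat (U * X)"
        by (rule transpose_mult) (use cU Xc in auto)
      also have "\<dots> = transpose_mat V * (transpose_mat X * transpose_mat U)"
        using transpose_mult[OF cU(1) Xc] by simp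
      also have "\<dots> = transpose_mat V * transpose_mat X * transpose_mat U"
        using cU Xc by (intro assoc_mult_mat[symmetric, of _ n n _ n _ n]) auto
      finally show ?thesis
        using recover[OF X] assoc_mult_mat5[of T n "transpose_mat V" "transpose_mat X" "transpose_mat U" S]
          inverse_pairD[OF p] cU Xc by simp
    qed
    then show ?thesis using inverse_pair_mult[OF p p'] by blast
  qed
qed

section \<open>The conjugating matrix lies in the algebra\<close>

text \<open>The last n - m rows have only n - k columns outside the zero block, fewer than their
  number, so every permutation sends one of these rows into the block.\<close>

lemma det_zero_block:
  fixes M :: "complex mat"
  assumes M: "M \<in> carrier_mat n n" and "m < k" "k \<le> n"
    and zero: "\<And>a b. m \<le> a \<Longrightarrow> a < n \<Longrightarrow> b < k \<Longrightarrow> M $$ (a, b) = 0"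
  shows "det M = 0"
  unfolding det_def'[OF M]
proof (rule sum.neutral, rule ballI)
  fix p assume "p \<in> {p. p permutes {0..<n}}"
  then have p: "p permutes {0..<n}" by simp
  have "\<exists>a\<in>{m..<n}. p a < k"
  proof (rule ccontr)
    assume no: "\<not> (\<exists>a\<in>{m..<n}. p a < k)"
    have "p ` {m..<n} \<subseteq> {k..<n}"
    proof
      fix b assume "b \<in> p ` {m..<n}"
      then obtain a where a: "a \<in> {m..<n}" "b = p a" by blast
      then have "p a \<in> {0..<n}" using permutes_in_image[OF p, of a] by auto
      moreover have "\<not> p a < k" using no a(1) by blast
      ultimately show "b \<in> {k..<n}" using a(2) by simp
    qed
    then have "card (p ` {m..<n}) \<le> card {k..<n}" by (intro card_mono) auto
    moreover have "card (p ` {m..<n}) = card {m..<n}"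
      using permutes_inj[OF p] by (intro card_image) (auto intro: inj_on_subset)
    ultimately show False using assms(2,3) by simp
  qed
  then obtain a where a: "m \<le> a" "a < n" "p a < k" by auto
  then have "\<exists>a\<in>{0..<n}. M $$ (a, p a) = 0" using zero[OF a] by (intro bexI[of _ a]) auto
  then have "(\<Prod>i = 0..<n. M $$ (i, p i)) = 0" by (intro prod_zero) auto
  then show "signof p * (\<Prod>i = 0..<n. M $$ (i, p i)) = 0" by simp
qed

text \<open>Each column index \<open>b\<close> gives an invariant subspace, spanned by the first \<open>m\<close> basis vectors,
  of the target algebra. Its preimage under \<open>T\<close> is invariant under upper triangular matrices, hence spanned by the
  first \<open>k\<close> basis vectors, and invertibility forces \<open>k = m\<close>.\<close>

lemma conj_into_algebra:
  assumes R: "total_preorder n R" and le: "\<And>i j. i < n \<Longrightarrow> j < n \<Longrightarrow> i \<le> j \<Longrightarrow> R i j"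
    and p: "inverse_pair n T S"
    and conj: "\<And>X. X \<in> carrier_mat n n \<Longrightarrow> upper_triangular X \<Longrightarrow> T * X * S \<in> pattern_algebra n R"
  shows "T \<in> pattern_algebra n R" "S \<in> pattern_algebra n R"
proof -
  note c = inverse_pairD[OF p]
  have "det T * det S = 1" using det_mult[OF c(1,2)] c(3) by simp
  then have det: "det T \<noteq> 0" "det S \<noteq> 0" by auto
  have "T $$ (a, b) = 0 \<and> S $$ (a, b) = 0" if ab: "a < n" "b < n" "\<not> R a b" for a b
  proof -
    \<comment> \<open>The indices i with \<open>R i b\<close> form an initial segment of length m.
      Failure of \<open>R a b\<close> means b < m \<le> a.\<close>
    define m where "m = (LEAST m. \<not> (m < n \<and> R m b))"
    have m: "i < m \<longleftrightarrow> i < n \<and> R i b" for i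
    proof
      assume "i < m"
      then show "i < n \<and> R i b" unfolding m_def using not_less_Least by blast
    next
      assume i: "i < n \<and> R i b"
      show "i < m"
      proof (rule ccontr)
        assume "\<not> i < m"
        then have "m < n" "R m i" using i le[of m i] by auto
        then have "m < n \<and> R m b" using total_preorder_trans[OF R] i ab by blast
        moreover have "\<not> (m < n \<and> R m b)"
          unfolding m_def by (rule LeastI[where P = "\<lambda>m. \<not> (m < n \<and> R m b)", of n]) simp
        ultimately show False by blast
      qed
    qed
    \<comment> \<open>E_kl with k \<le> l is upper triangular. This product is the (i, j) entry of
      its conjugate, and (i, j) is not admissible because j lies in the segment and i does
      not.\<close>
    have prod: "T $$ (i, k) * S $$ (l, j) = 0" if "m \<le> i" "i < n" "j < m" "k \<le> l" "l < n" for i j k l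
    proof -
      let ?X = "outer n (ev k) (ev l)"
      have "upper_triangular ?X" using that unfolding upper_triangular_def by (auto simp: ev_def)
      then have "T * ?X * S \<in> pattern_algebra n R" by (intro conj) auto
      moreover have "\<not> R i j"
        using that m[of i] m[of j] total_preorder_trans[OF R, of i j b] ab(2) by fastforce
      moreover have "j < n" using that m by blast
      ultimately have "(T * ?X * S) $$ (i, j) = 0" using that unfolding pattern_algebra_def by blast
      moreover have "(T * ?X * S) $$ (i, j) = T $$ (i, k) * S $$ (l, j)"
      proof -
        have "(T * ?X * S) $$ (i, j) = dot n (\<lambda>l'. dot n (\<lambda>k'. T $$ (i, k')) (ev k) * S $$ (l', j)) (ev l)"
          unfolding conj_index[OF c(1,2) outer_carrier that(2) \<open>j < n\<close>]
          by (simp add: dot_def sum_distrib_left sum_distrib_right mult_ac)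
        then show ?thesis using that by simp
      qed
      ultimately show ?thesis by simp
    qed
    \<comment> \<open>The first column of \<open>T\<close> with a nonzero entry in the rows from m
      on, or n if there is none. Such an entry kills, through the products above, the entries of
      \<open>S\<close> in rows from k on and columns below m.\<close>
    define k where "k = (LEAST k. k = n \<or> (k < n \<and> (\<exists>i. m \<le> i \<and> i < n \<and> T $$ (i, k) \<noteq> 0)))"
    have k: "k = n \<or> (k < n \<and> (\<exists>i. m \<le> i \<and> i < n \<and> T $$ (i, k) \<noteq> 0))"
      unfolding k_def by (rule LeastI[where P = "\<lambda>k. k = n \<or> (k < n \<and> (\<exists>i. m \<le> i \<and> i < n \<and> T $$ (i, k) \<noteq> 0))", of n]) simp
    then have kn: "k \<le> n" by auto
    have T0: "T $$ (i, j) = 0" if "m \<le> i" "i < n" "j < k" for i j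
      using not_less_Least[OF that(3)[unfolded k_def]] that kn by auto
    have S0: "S $$ (l, j) = 0" if "k \<le> l" "l < n" "j < m" for l j
      using k that prod[of _ j k l] by auto
    have mn: "m \<le> n" using m[of n] by simp
    \<comment> \<open>The zero blocks of \<open>T\<close> and of \<open>S\<close> bound k from
      opposite sides.\<close>
    have "k \<le> m" using det_zero_block[OF c(1), of m k] kn T0 det(1) by (meson not_le)
    moreover have "m \<le> k" using det_zero_block[OF c(2), of k m] mn S0 det(2) by (meson not_le)
    ultimately have km: "k = m" by simp
    have "m \<le> a" using m[of a] ab by auto
    moreover have "b < m" using m[of b] ab total_preorder_refl[OF R] by simp
    ultimately show ?thesis using T0[of a b] S0[of a b] ab km by simp
  qed
  then show "T \<in> pattern_algebra n R" "S \<in> pattern_algebra n R"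
    using c by (auto simp: pattern_algebra_def)
qed

section \<open>Reflection in the antidiagonal and conclusion\<close>

lemma exchange_carrier [simp]: "exchange_mat n \<in> carrier_mat n n"
  by (simp add: exchange_mat_def)

lemma exchange_mult:
  assumes X: "X \<in> carrier_mat n n" and ij: "i < n" "j < n"
  shows "(exchange_mat n * X) $$ (i, j) = X $$ (n - 1 - i, j)"
proof -
  have "(exchange_mat n * X) $$ (i, j) = dot n (ev (n - 1 - i)) (\<lambda>l. X $$ (l, j))"
    unfolding mult_mat_index[OF exchange_carrier X ij] dot_def
    by (rule sum.cong) (use ij in \<open>auto simp: exchange_mat_def ev_def\<close>)
  then show ?thesis using ij by simp
qed

lemma mult_exchange:
  assumes X: "X \<in> carrier_mat n n" and ij: "i < n" "j < n"
  shows "(X * exchange_mat n) $$ (i, j) = X $$ (i, n - 1 - j)"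
proof -
  have "(X * exchange_mat n) $$ (i, j) = dot n (\<lambda>l. X $$ (i, l)) (ev (n - 1 - j))"
    unfolding mult_mat_index[OF X exchange_carrier ij] dot_def
    by (rule sum.cong) (use ij in \<open>auto simp: exchange_mat_def ev_def\<close>)
  then show ?thesis using ij by simp
qed

lemma exchange_inverse: "inverse_pair n (exchange_mat n) (exchange_mat n)"
proof -
  have "exchange_mat n * exchange_mat n = 1\<^sub>m n"
    by (rule eq_matI) (auto simp: exchange_mult, auto simp: exchange_mat_def)
  then show ?thesis by (simp add: inverse_pair_def)
qed

lemma odot_carrier [simp]: "X \<in> carrier_mat n n \<Longrightarrow> odot n X \<in> carrier_mat n n"
  unfolding odot_def by (intro mult_carrier_mat[of _ n n _ n]) auto

lemma odot_index:
  assumes X: "X \<in> carrier_mat n n" and ij: "i < n" "j < n"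
  shows "odot n X $$ (i, j) = X $$ (n - 1 - j, n - 1 - i)"
proof -
  have "odot n X $$ (i, j) = (exchange_mat n * transpose_mat X) $$ (i, n - 1 - j)"
    unfolding odot_def using X ij by (intro mult_exchange mult_carrier_mat[of _ n n _ n]) auto
  also have "\<dots> = transpose_mat X $$ (n - 1 - i, n - 1 - j)"
    using X ij by (intro exchange_mult) auto
  finally show ?thesis using X ij by simp
qed

lemma odot_odot:
  assumes X: "X \<in> carrier_mat n n"
  shows "odot n (odot n X) = X"
  using X by (intro eq_matI) (auto simp: odot_index carrier_matD[OF odot_carrier[OF odot_carrier[OF X]]])

theorem corollary4p5:
  fixes n :: nat and \<A> :: "complex mat set" and \<phi> :: "complex mat \<Rightarrow> complex mat"
  assumes "n \<ge> 3"
    and "block_upper_triangular_algebra n \<A>"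
    and "\<phi> ` \<A> \<subseteq> \<A>"
    and "continuous_on_mat n \<A> \<phi>"
    and "inj_on \<phi> \<A>"
    and "commutativity_preserving \<A> \<phi>"
    and "spectrum_shrinking \<A> \<phi>"
  shows "(\<exists>T S. inverse_in \<A> T S \<and> (\<forall>X\<in>\<A>. \<phi> X = T * X * S)) \<or>
         (odot n ` \<A> = \<A> \<and>
          (\<exists>T S. inverse_in \<A> T S \<and> (\<forall>X\<in>\<A>. \<phi> X = T * odot n X * S)))"
proof -
  obtain R where R: "total_preorder n R" and le: "\<And>i j. i < n \<Longrightarrow> j < n \<Longrightarrow> i \<le> j \<Longrightarrow> R i j"
    and A: "\<A> = pattern_algebra n R"
    using block_upper_triangular_pattern[OF assms(2)] by blast
  have carr: "X \<in> carrier_mat n n" if "X \<in> \<A>" for X using that A pattern_carrier by blast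
  have \<phi>A: "\<phi> X \<in> \<A>" if "X \<in> \<A>" for X using assms(3) that by blast
  have ut: "X \<in> \<A>" if "X \<in> carrier_mat n n" "upper_triangular X" for X
    using assms(2) that by (auto simp: block_upper_triangular_algebra_def)
  have cont: "continuous_on UNIV (\<lambda>z. \<phi> (X + z \<cdot>\<^sub>m Y) $$ (i, j))"
    if XY: "X \<in> \<A>" "Y \<in> \<A>" and ij: "i < n" "j < n" for X Y i j
  proof (rule continuous_on_mat_entries[OF assms(4) _ _ _ ij])
    show "\<A> \<subseteq> carrier_mat n n" using carr by blast
    show "X + z \<cdot>\<^sub>m Y \<in> \<A>" for z using XY unfolding A by (rule pattern_line)
    fix a b assume "a < n" "b < n"
    then have "(\<lambda>z. (X + z \<cdot>\<^sub>m Y) $$ (a, b)) = (\<lambda>z. X $$ (a, b) + z * Y $$ (a, b))"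
      using carr[OF XY(1)] carr[OF XY(2)] by auto
    then show "continuous_on UNIV (\<lambda>z. (X + z \<cdot>\<^sub>m Y) $$ (a, b))"
      by (simp only:) (intro continuous_intros)
  qed
  have pres: "preserver n R \<phi>"
    unfolding preserver_def A[symmetric]
    using \<phi>A carr assms(5,6) cont spectrum_preserved[OF R assms(3,4,5,7)[unfolded A]]
    by (auto simp: A[symmetric])
  obtain T S where p: "inverse_pair n T S" and form: "(\<forall>X\<in>\<A>. \<phi> X = T * X * S) \<or> (\<forall>X\<in>\<A>. \<phi> X = T * transpose_mat X * S)"
    using preserver_form[OF assms(1) R le pres] unfolding A by blast
  have inv_in: "inverse_in \<A> U V" if q: "inverse_pair n U V"
    and "\<And>X. X \<in> carrier_mat n n \<Longrightarrow> upper_triangular X \<Longrightarrow> U * X * V \<in> \<A>" for U V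
    using conj_into_algebra[OF R le q that(2)[unfolded A]] inverse_pairD[OF q]
    by (simp add: inverse_in_def inverts_mat_def A)
  from form show ?thesis
  proof
    assume f: "\<forall>X\<in>\<A>. \<phi> X = T * X * S"
    have "inverse_in \<A> T S" by (rule inv_in[OF p]) (metis f ut \<phi>A)
    then show ?thesis using f by blast
  next
    assume f: "\<forall>X\<in>\<A>. \<phi> X = T * transpose_mat X * S"
    let ?J = "exchange_mat n"
    note c = inverse_pairD[OF p]
    \<comment> \<open>Since J is its own inverse, T X^t S = (T J) (J X^t J) (J S), so the transposed
      form becomes the reflected one.\<close>
    define U where "U = T * ?J"
    define V where "V = ?J * S"
    have q: "inverse_pair n U V" unfolding U_def V_def by (rule inverse_pair_mult[OF p exchange_inverse])
    have fo: "\<phi> X = U * odot n X * V" if X: "X \<in> \<A>" for X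
    proof -
      note Xc = carr[OF X]
      have "U * odot n X * V = T * (?J * odot n X * ?J) * S"
        unfolding U_def V_def using c Xc by (intro assoc_mult_mat5[where n = n]) auto
      also have "?J * odot n X * ?J = transpose_mat X"
        unfolding odot_def by (rule inverse_pair_cancel[OF exchange_inverse]) (use Xc in simp)
      finally show ?thesis using f X by simp
    qed
    \<comment> \<open>Reflection keeps upper triangular matrices upper triangular. For such X,
      \<open>U * X * V\<close> is therefore a value of \<phi>, and this puts \<open>U\<close> and
      \<open>V\<close> into the algebra.\<close>
    have odot_ut: "upper_triangular (odot n X)" if "X \<in> carrier_mat n n" "upper_triangular X" for X
      using that odot_index[OF that(1)] carrier_matD[OF odot_carrier[OF that(1)]]
      by (auto simp: upper_triangular_def)
    have q_in: "inverse_in \<A> U V"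
    proof (rule inv_in[OF q])
      fix X :: "complex mat" assume X: "X \<in> carrier_mat n n" "upper_triangular X"
      then have "odot n X \<in> \<A>" using odot_ut ut by simp
      then show "U * X * V \<in> \<A>" using fo \<phi>A odot_odot[OF X(1)] by metis
    qed
    \<comment> \<open>The reflection of X is V \<phi>(X) U, a product inside the algebra.\<close>
    have sub: "odot n X \<in> \<A>" if X: "X \<in> \<A>" for X
    proof -
      have "V * (U * odot n X * V) * U \<in> \<A>"
        using fo[OF X] \<phi>A[OF X] q_in unfolding A inverse_in_def by (auto intro: pattern_sandwich[OF R])
      then show ?thesis using inverse_pair_cancel[OF q odot_carrier[OF carr[OF X]]] by simp
    qed
    have "odot n ` \<A> = \<A>"
    proof
      show "odot n ` \<A> \<subseteq> \<A>" using sub by blast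
      show "\<A> \<subseteq> odot n ` \<A>" using sub odot_odot carr by (metis image_eqI subsetI)
    qed
    then show ?thesis using q_in fo by blast
  qed
qed

end
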